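(* Let $Y$ be a topological space having at least four points, with an algebraic cross-ratio $R\colon Y^{(4)}\to[0,+\infty]$. There is a cardinal $\kappa$ and a continuous function $f\colon Y\to\partial\mathbf H^\kappa$ with total image such that for all $(x^-,x^+,y^-,y^+)\in Y^{(4)}$ we have $[f(x^-),f(x^+);f(y^-),f(y^+)]=R(x^-,x^+,y^-,y^+)$. Moreover, for any two such maps $f_1\colon Y\to\partial\mathbf H^{\kappa_1}$ and $f_2\colon Y\to\partial\mathbf H^{\kappa_2}$ there exists a unique isometry $\varphi\colon\mathbf H^{\kappa_1}\to\mathbf H^{\kappa_2}$ such that $f_2=\varphi\circ f_1$ (where $\varphi$ also denotes its boundary extension); in particular $\kappa_1=\kappa_2$. Consequently, if a group $\Gamma$ acts on $Y$ preserving $R$, then there is a representation $\rho\colon\Gamma\to\operatorname{Isom}(\mathbf H^\kappa)$ such that $f$ is $\rho$-equivariant.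
   Context: $\mathbf H^\kappa$ is the real algebraic hyperbolic space of dimension $\kappa$ (any cardinal): in $\mathbb R\oplus\ell^2(\kappa)$ with the form $\langle x,y\rangle=x_0y_0-\sum_{i>0}x_iy_i$, it is $\{x:\langle x,x\rangle=1,\ x_0>0\}$ with $\cosh \mathbf d(x,y)=\langle x,y\rangle$. Its Gromov boundary $\partial\mathbf H^\kappa$ is the set of isotropic lines. A subset of $\partial\mathbf H^\kappa$ is total when it is not contained in the boundary of a proper closed totally geodesic subspace of $\mathbf H^\kappa$. For a space $Y$, $Y^{(4)}\subset Y^4$ is the set of quadruples of which at least three entries are distinct. The cross-ratio on $(\partial\mathbf H^\kappa)^{(4)}$ with values in $[0,\infty]$ is given by $[a,a';b,b']^2=\frac{\langle a,a'\rangle\langle b,b'\rangle}{\langle a,b'\rangle\langle b,a'\rangle}$ for any isotropic representatives. In the upper half-space model where $\partial\mathbf H^\kappa\setminus\{\infty\}$ is a Hilbert space, $[x,y;z,\infty]=\|y-x\|/\|y-z\|$. An abstract cross-ratio on $Y$ is a continuous function $B\colon Y^{(4)}\to[0,\infty]$ such that (whenever the expressions are defined): $B(x,x',y,y')=B(y,y',x,x')=B(x',x,y',y)$; $B(x,x',y,y')=B(y,x',x,y')^{-1}=B(x,y',y,x')^{-1}$; $B(x,y,x',y')=B(x,y,x'',y')\,B(x'',y,x',y')$; $B(x,x',y,y')=0$ iff $x=x'$ or $y=y'$; $B(x,x',y,y')=\infty$ iff $x=y'$ or $y=x'$. An algebraic cross-ratio on $Y$ is an abstract cross-ratio $R$ such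 that for any triple of distinct points, denoted $0,1,\infty\in Y$, the function $(Y\setminus\{\infty\})^2\to\mathbb R_{\ge0}$ equal to $0$ on the diagonal and to $(x,y)\mapsto\big(R(x,y,0,\infty)R(y,0,1,\infty)\big)^2$ off the diagonal (for $y=0\ne x$ the product $R(x,y,0,\infty)R(y,0,1,\infty)$ is interpreted, via the cocycle relation, as $R(x,0,1,\infty)$) is a kernel of conditionally negative type. A kernel of conditionally negative type on a space $Z$ is a continuous symmetric $K\colon Z^2\to\mathbb R$ vanishing on the diagonal with $\sum_{i,j}\lambda_i\lambda_jK(x_i,x_j)\le0$ for all finite families $x_i\in Z$, $\lambda_i\in\mathbb R$ with $\sum_i\lambda_i=0$. *)

theory Defs
  imports
    "HOL-Analysis.Analysis"
    "HOL-Algebra.Group_Action"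
    "HOL-Library.Equipollence"
begin

section \<open>Square-summable families\<close>

typedef 'i ell2 = "{x :: 'i \<Rightarrow> real. (\<lambda>i. (x i)\<^sup>2) summable_on UNIV}"
  morphisms ell2_coord Abs_ell2
  by (rule exI[of _ "\<lambda>_. 0"]) simp

setup_lifting type_definition_ell2

lemma ell2_mult_summable:
  fixes x y :: "'i \<Rightarrow> real"
  assumes "(\<lambda>i. (x i)\<^sup>2) summable_on UNIV" "(\<lambda>i. (y i)\<^sup>2) summable_on UNIV"
  shows "(\<lambda>i. x i * y i) summable_on UNIV"
proof -
  have "(\<lambda>i. norm (x i * y i)) summable_on UNIV"
  proof (rule Infinite_Sum.abs_summable_on_comparison_test')
    show "(\<lambda>i. (x i)\<^sup>2 + (y i)\<^sup>2) summable_on UNIV"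
      using assms by (rule summable_on_add)
    fix i
    have "0 \<le> (\<bar>x i\<bar> - \<bar>y i\<bar>)\<^sup>2" by simp
    then have "2 * (\<bar>x i\<bar> * \<bar>y i\<bar>) \<le> (x i)\<^sup>2 + (y i)\<^sup>2"
      by (simp add: power2_diff)
    moreover have "0 \<le> \<bar>x i\<bar> * \<bar>y i\<bar>" by simp
    ultimately show "norm (x i * y i) \<le> (x i)\<^sup>2 + (y i)\<^sup>2"
      unfolding real_norm_def abs_mult by linarith
  qed
  then show ?thesis by (rule iffD2[OF summable_on_iff_abs_summable_on_real])
qed

instantiation ell2 :: (type) real_vector
begin

lift_definition zero_ell2 :: "'a ell2" is "\<lambda>_. 0"
  by simp

lift_definition plus_ell2 :: "'a ell2 \<Rightarrow> 'a ell2 \<Rightarrow> 'a ell2" is "\<lambda>x y i. x i + y i"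
proof -
  fix x y :: "'a \<Rightarrow> real"
  assume *: "(\<lambda>i. (x i)\<^sup>2) summable_on UNIV" "(\<lambda>i. (y i)\<^sup>2) summable_on UNIV"
  have "(\<lambda>i. ((x i)\<^sup>2 + (y i)\<^sup>2) + 2 * (x i * y i)) summable_on UNIV"
    by (intro summable_on_add summable_on_cmult_right ell2_mult_summable *)
  then show "(\<lambda>i. (x i + y i)\<^sup>2) summable_on UNIV"
    by (simp add: power2_sum algebra_simps)
qed

lift_definition uminus_ell2 :: "'a ell2 \<Rightarrow> 'a ell2" is "\<lambda>x i. - x i"
  by simp

definition minus_ell2 :: "'a ell2 \<Rightarrow> 'a ell2 \<Rightarrow> 'a ell2"
  where "minus_ell2 x y = x + - y"

lift_definition scaleR_ell2 :: "real \<Rightarrow> 'a ell2 \<Rightarrow> 'a ell2" is "\<lambda>c x i. c * x i"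
  unfolding power_mult_distrib by (rule summable_on_cmult_right)

instance
proof
  fix x y z :: "'a ell2" and c d :: real
  show "x + y + z = x + (y + z)" by transfer (simp add: add.assoc)
  show "x + y = y + x" by transfer (simp add: add.commute)
  show "0 + x = x" by transfer simp
  show "- x + x = 0" by transfer simp
  show "x - y = x + - y" by (rule minus_ell2_def)
  show "c *\<^sub>R (x + y) = c *\<^sub>R x + c *\<^sub>R y" by transfer (simp add: distrib_left)
  show "(c + d) *\<^sub>R x = c *\<^sub>R x + d *\<^sub>R x" by transfer (simp add: distrib_right)
  show "c *\<^sub>R d *\<^sub>R x = (c * d) *\<^sub>R x" by transfer (simp add: mult.assoc)
  show "1 *\<^sub>R x = x" by transfer simp
qed

end

instantiation ell2 :: (type) real_inner
begin

lift_definition inner_ell2 :: "'a ell2 \<Rightarrow> 'a ell2 \<Rightarrow> real" is "\<lambda>x y. \<Sum>\<^sub>\<infinity>i. x i * y i" .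

definition norm_ell2 :: "'a ell2 \<Rightarrow> real"
  where "norm_ell2 x = sqrt (inner x x)"

definition dist_ell2 :: "'a ell2 \<Rightarrow> 'a ell2 \<Rightarrow> real"
  where "dist_ell2 x y = norm (x - y)"

definition sgn_ell2 :: "'a ell2 \<Rightarrow> 'a ell2"
  where "sgn_ell2 x = x /\<^sub>R norm x"

definition uniformity_ell2 :: "('a ell2 \<times> 'a ell2) filter"
  where "uniformity_ell2 = (INF e\<in>{0<..}. principal {(x, y). dist x y < e})"

definition open_ell2 :: "'a ell2 set \<Rightarrow> bool"
  where "open_ell2 U = (\<forall>x\<in>U. \<forall>\<^sub>F (x', y) in uniformity. x' = x \<longrightarrow> y \<in> U)"

instance
proof
  fix x y z :: "'a ell2" and r :: real and U :: "'a ell2 set"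
  show "dist x y = norm (x - y)" by (rule dist_ell2_def)
  show "sgn x = x /\<^sub>R norm x" by (rule sgn_ell2_def)
  show "uniformity = (INF e\<in>{0<..}. principal {(x, y :: 'a ell2). dist x y < e})"
    by (rule uniformity_ell2_def)
  show "open U \<longleftrightarrow> (\<forall>x\<in>U. \<forall>\<^sub>F (x', y) in uniformity. x' = x \<longrightarrow> y \<in> U)"
    by (rule open_ell2_def)
  show "norm x = sqrt (inner x x)" by (rule norm_ell2_def)
  show "inner x y = inner y x" by transfer (simp add: mult.commute)
  show "inner (x + y) z = inner x z + inner y z"
    by transfer (simp add: distrib_right infsum_add ell2_mult_summable)
  show "inner (scaleR r x) y = r * inner x y"
    by transfer (simp add: mult.assoc infsum_cmult_right')
  show "0 \<le> inner x x" by transfer (simp add: infsum_nonneg)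
  show "inner x x = 0 \<longleftrightarrow> x = 0"
  proof
    assume "inner x x = 0"
    then show "x = 0"
    proof transfer
      fix x :: "'a \<Rightarrow> real"
      assume s: "(\<lambda>i. (x i)\<^sup>2) summable_on UNIV" and z: "(\<Sum>\<^sub>\<infinity>i. x i * x i) = 0"
      have "(x i)\<^sup>2 = 0" for i
        by (rule nonneg_infsum_le_0D[where f = "\<lambda>i. (x i)\<^sup>2" and A = UNIV])
          (use s z in \<open>simp_all add: power2_eq_square\<close>)
      then show "x = (\<lambda>_. 0)" by auto
    qed
  next
    assume "x = 0"
    then show "inner x x = 0" by (simp, transfer, simp)
  qed
qed

end


section \<open>Hyperbolic space and its boundary\<close>

text \<open>A cardinal is represented by a set \<open>I\<close> of indices; the ambient Lorentz space over \<open>I\<close> is the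
  closed subspace of \<open>\<real> \<oplus> \<ell>\<^sup>2\<close> of the vectors whose \<open>\<ell>\<^sup>2\<close> component is supported in \<open>I\<close>.\<close>

definition lorentz_space :: "'i set \<Rightarrow> (real \<times> 'i ell2) set"
  where "lorentz_space I = {v. \<forall>i. i \<notin> I \<longrightarrow> ell2_coord (snd v) i = 0}"

definition lorentz :: "real \<times> 'i ell2 \<Rightarrow> real \<times> 'i ell2 \<Rightarrow> real"
  where "lorentz x y = fst x * fst y - inner (snd x) (snd y)"

definition hyp :: "'i set \<Rightarrow> (real \<times> 'i ell2) set"
  where "hyp I = {x \<in> lorentz_space I. lorentz x x = 1 \<and> fst x > 0}"

definition hdist :: "real \<times> 'i ell2 \<Rightarrow> real \<times> 'i ell2 \<Rightarrow> real"
  where "hdist x y = arcosh (lorentz x y)"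

definition boundary :: "'i set \<Rightarrow> (real \<times> 'i ell2) set set"
  where "boundary I = {span {v} |v. v \<in> lorentz_space I \<and> v \<noteq> 0 \<and> lorentz v v = 0}"

text \<open>The quotient topology on the projective space of all lines. Both \<open>hyp I\<close> (via
  \<open>x \<mapsto> span {x}\<close>) and \<open>boundary I\<close> are subspaces of it; the induced topology on their union
  is the usual topology of the bordification (the closed unit ball in norm topology in the
  projective model), hence that of the Gromov boundary on \<open>boundary I\<close>.\<close>

definition proj_topology :: "(real \<times> 'i ell2) set topology"
  where "proj_topology =
    topology (\<lambda>U. U \<subseteq> {span {v} |v. v \<noteq> 0} \<and> open {v. v \<noteq> 0 \<and> span {v} \<in> U})"

lemma openin_proj_topology:
  "openin proj_topology U \<longleftrightarrow>
    U \<subseteq> {span {v} |v. v \<noteq> 0} \<and> open {v. v \<noteq> 0 \<and> span {v} \<in> U}"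
proof -
  let ?P = "\<lambda>U :: (real \<times> 'a ell2) set set.
    U \<subseteq> {span {v} |v. v \<noteq> 0} \<and> open {v. v \<noteq> 0 \<and> span {v} \<in> U}"
  have "istopology ?P"
    unfolding istopology_def
  proof (intro conjI allI impI)
    fix S T assume S: "?P S" and T: "?P T"
    have eq: "{v. v \<noteq> 0 \<and> span {v} \<in> S \<inter> T} =
      {v. v \<noteq> 0 \<and> span {v} \<in> S} \<inter> {v. v \<noteq> 0 \<and> span {v} \<in> T}" by auto
    show "S \<inter> T \<subseteq> {span {v} |v. v \<noteq> 0}" using S by blast
    show "open {v. v \<noteq> 0 \<and> span {v} \<in> S \<inter> T}"
      unfolding eq using S T by (intro open_Int) auto
  next
    fix \<K> assume K: "\<forall>K\<in>\<K>. ?P K"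
    have eq: "{v. v \<noteq> 0 \<and> span {v} \<in> \<Union>\<K>} = (\<Union>K\<in>\<K>. {v. v \<noteq> 0 \<and> span {v} \<in> K})" by auto
    show "\<Union>\<K> \<subseteq> {span {v} |v. v \<noteq> 0}" using K by blast
    show "open {v. v \<noteq> 0 \<and> span {v} \<in> \<Union>\<K>}"
      unfolding eq using K by (intro open_UN) auto
  qed
  then show ?thesis by (simp add: proj_topology_def)
qed

definition boundary_topology :: "'i set \<Rightarrow> (real \<times> 'i ell2) set topology"
  where "boundary_topology I = subtopology proj_topology (boundary I)"

definition geodesic_line :: "'i set \<Rightarrow> (real \<Rightarrow> real \<times> 'i ell2) \<Rightarrow> bool"
  where "geodesic_line I c \<longleftrightarrow>
    (\<forall>t. c t \<in> hyp I) \<and> (\<forall>s t. hdist (c s) (c t) = \<bar>s - t\<bar>)"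

definition totally_geodesic :: "'i set \<Rightarrow> (real \<times> 'i ell2) set \<Rightarrow> bool"
  where "totally_geodesic I S \<longleftrightarrow> S \<subseteq> hyp I \<and>
    (\<forall>c s t. geodesic_line I c \<and> s \<noteq> t \<and> c s \<in> S \<and> c t \<in> S \<longrightarrow> range c \<subseteq> S)"

definition hyp_closed :: "'i set \<Rightarrow> (real \<times> 'i ell2) set \<Rightarrow> bool"
  where "hyp_closed I S \<longleftrightarrow> S \<subseteq> hyp I \<and>
    (\<forall>x\<in>hyp I. (\<forall>e>0. \<exists>y\<in>S. hdist x y < e) \<longrightarrow> x \<in> S)"

definition boundary_of :: "'i set \<Rightarrow> (real \<times> 'i ell2) set \<Rightarrow> (real \<times> 'i ell2) set set"
  where "boundary_of I S = boundary I \<inter> (proj_topology closure_of ((\<lambda>x. span {x}) ` S))"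

definition total :: "'i set \<Rightarrow> (real \<times> 'i ell2) set set \<Rightarrow> bool"
  where "total I A \<longleftrightarrow> A \<subseteq> boundary I \<and>
    \<not> (\<exists>S. totally_geodesic I S \<and> hyp_closed I S \<and> S \<noteq> hyp I \<and> A \<subseteq> boundary_of I S)"

text \<open>Elements of \<open>hyp_isometries\<close> are normalised to be \<open>undefined\<close> outside \<open>hyp I\<close>, so that
  equality of isometries is equality of functions.\<close>

definition hyp_isometries ::
    "'i set \<Rightarrow> 'j set \<Rightarrow> (real \<times> 'i ell2 \<Rightarrow> real \<times> 'j ell2) set"
  where "hyp_isometries I J = {\<phi> \<in> extensional (hyp I). bij_betw \<phi> (hyp I) (hyp J) \<and>
    (\<forall>x\<in>hyp I. \<forall>y\<in>hyp I. hdist (\<phi> x) (\<phi> y) = hdist x y)}"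

definition Isom :: "'i set \<Rightarrow> (real \<times> 'i ell2 \<Rightarrow> real \<times> 'i ell2) monoid"
  where "Isom I = (BijGroup (hyp I))\<lparr>carrier := hyp_isometries I I\<rparr>"

definition boundary_ext :: "'i set \<Rightarrow> 'j set \<Rightarrow> (real \<times> 'i ell2 \<Rightarrow> real \<times> 'j ell2) \<Rightarrow>
    (real \<times> 'i ell2) set \<Rightarrow> (real \<times> 'j ell2) set"
  where "boundary_ext I J \<phi> \<xi> = (THE \<eta>. \<eta> \<in> boundary J \<and>
    (\<forall>x. (\<forall>n::nat. x n \<in> hyp I) \<and> limitin proj_topology (\<lambda>n. span {x n}) \<xi> sequentially \<longrightarrow>
      limitin proj_topology (\<lambda>n. span {\<phi> (x n)}) \<eta> sequentially))"


section \<open>Cross-ratios\<close>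

definition quads :: "('y \<times> 'y \<times> 'y \<times> 'y) set"
  where "quads = {(a, b, c, d). card {a, b, c, d} \<ge> 3}"

text \<open>The cross-ratio is computed on the isotropic representatives with first coordinate \<open>1\<close>; lemma
  \<open>cross_ratio_span\<close> below shows that the choice of representatives is irrelevant. On quadruples
  of boundary points with at least three distinct entries, numerator and denominator do not
  vanish simultaneously.\<close>

definition iso_rep :: "(real \<times> 'i ell2) set \<Rightarrow> real \<times> 'i ell2"
  where "iso_rep \<xi> = (THE v. v \<in> \<xi> \<and> fst v = 1)"

definition cross_ratio :: "(real \<times> 'i ell2) set \<Rightarrow> (real \<times> 'i ell2) set \<Rightarrow>
    (real \<times> 'i ell2) set \<Rightarrow> (real \<times> 'i ell2) set \<Rightarrow> ennreal"
  where "cross_ratio a a' b b' =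
    (let num = lorentz (iso_rep a) (iso_rep a') * lorentz (iso_rep b) (iso_rep b');
         den = lorentz (iso_rep a) (iso_rep b') * lorentz (iso_rep b) (iso_rep a')
     in if den = 0 then \<infinity> else ennreal (sqrt (num / den)))"

lemma iso_rep_span:
  assumes "v \<noteq> 0" "lorentz v v = 0"
  shows "fst v \<noteq> 0" "iso_rep (span {v}) = v /\<^sub>R fst v"
proof -
  show nz: "fst v \<noteq> 0"
  proof
    assume "fst v = 0"
    with assms(2) have "snd v = 0" by (simp add: lorentz_def)
    with \<open>fst v = 0\<close> assms(1) show False by (simp add: prod_eq_iff)
  qed
  show "iso_rep (span {v}) = v /\<^sub>R fst v"
    unfolding iso_rep_def
  proof (rule the_equality)
    show "v /\<^sub>R fst v \<in> span {v} \<and> fst (v /\<^sub>R fst v) = 1"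
      using nz by (simp add: span_mul span_base)
  next
    fix w assume w: "w \<in> span {v} \<and> fst w = 1"
    then obtain k where k: "w = k *\<^sub>R v" by (auto simp: span_singleton)
    with w have "k * fst v = 1" by simp
    with nz have "k = inverse (fst v)" by (metis inverse_unique mult.commute)
    with k show "w = v /\<^sub>R fst v" by simp
  qed
qed

lemma lorentz_scaleR:
  "lorentz (c *\<^sub>R x) (d *\<^sub>R y) = c * d * lorentz x y"
  by (simp add: lorentz_def right_diff_distrib)

lemma cross_ratio_span:
  assumes "a \<noteq> 0" "lorentz a a = 0" "a' \<noteq> 0" "lorentz a' a' = 0"
    and "b \<noteq> 0" "lorentz b b = 0" "b' \<noteq> 0" "lorentz b' b' = 0"
  shows "cross_ratio (span {a}) (span {a'}) (span {b}) (span {b'}) =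
    (if lorentz a b' * lorentz b a' = 0 then \<infinity>
     else ennreal (sqrt (lorentz a a' * lorentz b b' / (lorentz a b' * lorentz b a'))))"
proof -
  define r where "r = inverse (fst a) * inverse (fst a') * (inverse (fst b) * inverse (fst b'))"
  have r: "r \<noteq> 0"
    using iso_rep_span(1)[OF assms(1,2)] iso_rep_span(1)[OF assms(3,4)]
      iso_rep_span(1)[OF assms(5,6)] iso_rep_span(1)[OF assms(7,8)]
    by (simp add: r_def)
  note reps = iso_rep_span(2)[OF assms(1,2)] iso_rep_span(2)[OF assms(3,4)]
    iso_rep_span(2)[OF assms(5,6)] iso_rep_span(2)[OF assms(7,8)]
  have num: "lorentz (iso_rep (span {a})) (iso_rep (span {a'})) *
      lorentz (iso_rep (span {b})) (iso_rep (span {b'})) =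
      r * (lorentz a a' * lorentz b b')"
    unfolding reps lorentz_scaleR r_def by (simp only: mult_ac)
  have den: "lorentz (iso_rep (span {a})) (iso_rep (span {b'})) *
      lorentz (iso_rep (span {b})) (iso_rep (span {a'})) =
      r * (lorentz a b' * lorentz b a')"
    unfolding reps lorentz_scaleR r_def by (simp only: mult_ac)
  show ?thesis
    unfolding cross_ratio_def Let_def num den using r
    by (simp only: mult_eq_0_iff mult_divide_mult_cancel_left simp_thms if_False)
qed

text \<open>\<open>ennreal\<close> has \<open>0 * \<infinity> = 0\<close>, so the cocycle identity must explicitly exclude the products that
  are undefined in \<open>[0, \<infinity>]\<close>.\<close>

definition abstract_cross_ratio ::
    "('y::topological_space \<times> 'y \<times> 'y \<times> 'y \<Rightarrow> ennreal) \<Rightarrow> bool"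
  where "abstract_cross_ratio B \<longleftrightarrow>
    continuous_on quads B \<and>
    (\<forall>x x' y y'. (x, x', y, y') \<in> quads \<longrightarrow>
      B (x, x', y, y') = B (y, y', x, x') \<and>
      B (x, x', y, y') = B (x', x, y', y) \<and>
      B (x, x', y, y') = inverse (B (y, x', x, y')) \<and>
      B (x, x', y, y') = inverse (B (x, y', y, x')) \<and>
      (B (x, x', y, y') = 0 \<longleftrightarrow> x = x' \<or> y = y') \<and>
      (B (x, x', y, y') = \<infinity> \<longleftrightarrow> x = y' \<or> y = x')) \<and>
    (\<forall>x y x' y' x''.
      (x, y, x', y') \<in> quads \<and> (x, y, x'', y') \<in> quads \<and> (x'', y, x', y') \<in> quads \<and>
      \<not> (B (x, y, x'', y') = 0 \<and> B (x'', y, x', y') = \<infinity>) \<and>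
      \<not> (B (x, y, x'', y') = \<infinity> \<and> B (x'', y, x', y') = 0) \<longrightarrow>
      B (x, y, x', y') = B (x, y, x'', y') * B (x'', y, x', y'))"

definition cond_neg_kernel ::
    "'z::topological_space set \<Rightarrow> ('z \<Rightarrow> 'z \<Rightarrow> real) \<Rightarrow> bool"
  where "cond_neg_kernel Z K \<longleftrightarrow>
    continuous_on (Z \<times> Z) (\<lambda>(x, y). K x y) \<and>
    (\<forall>x\<in>Z. \<forall>y\<in>Z. K x y = K y x) \<and>
    (\<forall>x\<in>Z. K x x = 0) \<and>
    (\<forall>(n::nat) x l. (\<forall>i<n. x i \<in> Z) \<and> (\<Sum>i<n. l i) = 0 \<longrightarrow>
      (\<Sum>i<n. \<Sum>j<n. l i * l j * K (x i) (x j)) \<le> 0)"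

text \<open>\<open>p\<close>, \<open>u\<close>, \<open>w\<close> play the roles of \<open>0\<close>, \<open>1\<close>, \<open>\<infinity>\<close>. For \<open>y = p \<noteq> x\<close> the product in the last
  branch would be \<open>\<infinity> * 0\<close>, whence the separate case.\<close>

definition cr_kernel :: "('y \<times> 'y \<times> 'y \<times> 'y \<Rightarrow> ennreal) \<Rightarrow> 'y \<Rightarrow> 'y \<Rightarrow> 'y \<Rightarrow> 'y \<Rightarrow> 'y \<Rightarrow> real"
  where "cr_kernel R p u w x y =
    (if x = y then 0
     else if y = p then (enn2real (R (x, p, u, w)))\<^sup>2
     else (enn2real (R (x, y, p, w) * R (y, p, u, w)))\<^sup>2)"

definition algebraic_cross_ratio ::
    "('y::topological_space \<times> 'y \<times> 'y \<times> 'y \<Rightarrow> ennreal) \<Rightarrow> bool"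
  where "algebraic_cross_ratio R \<longleftrightarrow> abstract_cross_ratio R \<and>
    (\<forall>p u w. p \<noteq> u \<and> u \<noteq> w \<and> p \<noteq> w \<longrightarrow> cond_neg_kernel (UNIV - {w}) (cr_kernel R p u w))"

definition realizes :: "('y::topological_space \<times> 'y \<times> 'y \<times> 'y \<Rightarrow> ennreal) \<Rightarrow>
    'i set \<Rightarrow> ('y \<Rightarrow> (real \<times> 'i ell2) set) \<Rightarrow> bool"
  where "realizes R I f \<longleftrightarrow>
    continuous_map euclidean (boundary_topology I) f \<and>
    total I (range f) \<and>
    (\<forall>a a' b b'. (a, a', b, b') \<in> quads \<longrightarrow>
      cross_ratio (f a) (f a') (f b) (f b') = R (a, a', b, b'))"

end

theory Submission
  imports Defs
begin

text \<open>Sending \<open>w\<close> to infinity, the kernel of conditionally negative type embeds \<open>Y - {w}\<close>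
  isometrically into a Hilbert space, whose one-point compactification is the boundary of a
  hyperbolic space; the cocycle relation expresses all cross-ratios through the kernel. For
  uniqueness, equality of the cross-ratios of two maps allows one to choose isotropic
  representatives with the same Lorentz products. By totality these representatives span dense
  subspaces, so that the correspondence between them extends to a linear Lorentz isometry. Both
  totally geodesic subspaces and isometries of hyperbolic space turn out to be linear in this
  sense, which also gives the uniqueness of the isometry and, through uniqueness, the
  representation of a group that preserves the cross-ratio.\<close>

section \<open>The Hilbert space of square-summable families\<close>

text \<open>The embedding of \<open>Y - {w}\<close> is lifted to isotropic vectors by horospherical
  coordinates: a point \<open>T\<close> goes to
  \<open>((|T|^2 + 1) / 2, (|T|^2 - 1) / 2 * e + T)\<close>, and two such vectors have as Lorentz
  product half the squared distance. The kernel says nothing at \<open>w\<close>; continuity there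
  comes from the divergence of \<open>R\<close> itself. A total image must fill
  \<open>lorentz_space I'\<close> for an actual index set, so the Hilbert space is constructed
  together with an orthonormal basis of the closed span, plus one spare index for \<open>e\<close>.

  For uniqueness, cross-ratios fix the products of representatives only up to one factor per point
  and one global constant; rescaling both sides removes them. The form is indefinite, so preserving
  it does not visibly bound a linear map. A timelike unit vector \<open>q\<close> repairs this:
  \<open>2 <v, q>^2 - <v, v>\<close> is positive definite, is carried along by the map, and is
  equivalent to the squared norm. The extension of linear maps to closures rests on this bound.
  Boundary lines determine images only up to sign and scale; time orientation (positive first
  coordinates) and a third point remove this freedom.\<close>

lemma ell2_coord_minus: "ell2_coord (x - y) i = ell2_coord x i - ell2_coord y i"
  unfolding minus_ell2_def plus_ell2.rep_eq uminus_ell2.rep_eq by simp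

lemmas ell2_coord_simps = zero_ell2.rep_eq plus_ell2.rep_eq uminus_ell2.rep_eq
  ell2_coord_minus scaleR_ell2.rep_eq

lemma ell2_coord_summable: "(\<lambda>i. (ell2_coord x i)\<^sup>2) summable_on UNIV"
  using ell2_coord[of x] by simp

lift_definition ell2_unit :: "'i \<Rightarrow> 'i ell2" is "\<lambda>i j. if j = i then 1 else 0"
  by (rule finite_nonzero_values_imp_summable_on) simp

lemma inner_ell2_unit: "inner x (ell2_unit i) = ell2_coord x i"
proof transfer
  fix x :: "'a \<Rightarrow> real" and i
  have "(\<Sum>\<^sub>\<infinity>j. x j * (if j = i then 1 else 0)) = (\<Sum>\<^sub>\<infinity>j\<in>{i}. x j * (if j = i then 1 else 0))"
    by (rule infsum_cong_neutral) auto
  then show "(\<Sum>\<^sub>\<infinity>j. x j * (if j = i then 1 else 0)) = x i" by simp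
qed

lemma ell2_coord_unit: "ell2_coord (ell2_unit i) j = (if j = i then 1 else 0)"
  by (simp add: ell2_unit.rep_eq)

lemma inner_ell2_unit_self [simp]: "inner (ell2_unit i) (ell2_unit i) = 1"
  by (simp add: inner_ell2_unit ell2_coord_unit)

lemma norm_ell2_unit [simp]: "norm (ell2_unit i) = 1"
  by (simp add: norm_eq_sqrt_inner)

lemma ell2_unit_nonzero [simp]: "ell2_unit i \<noteq> 0"
  using norm_ell2_unit[of i] by (metis norm_zero zero_neq_one)

lemma continuous_on_ell2_coord [continuous_intros]:
  "continuous_on A f \<Longrightarrow> continuous_on A (\<lambda>x. ell2_coord (f x) i)"
  unfolding inner_ell2_unit[symmetric] by (rule continuous_on_inner[OF _ continuous_on_const])

lemma ell2_eqI: "(\<And>i. ell2_coord x i = ell2_coord y i) \<Longrightarrow> x = y"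
  by (rule iffD1[OF ell2_coord_inject], rule ext)

lemma norm_ell2_infsum: "(norm x)\<^sup>2 = (\<Sum>\<^sub>\<infinity>i. (ell2_coord x i)\<^sup>2)"
  unfolding power2_norm_eq_inner by (simp add: inner_ell2.rep_eq power2_eq_square)

lemma sum_coord_le_norm:
  assumes "finite F" shows "(\<Sum>i\<in>F. (ell2_coord x i)\<^sup>2) \<le> (norm x)\<^sup>2"
  unfolding norm_ell2_infsum
  by (rule finite_sum_le_infsum) (use assms in \<open>auto intro: ell2_coord_summable\<close>)

instance ell2 :: (type) complete_space
proof
  fix X :: "nat \<Rightarrow> 'a ell2" assume X: "Cauchy X"
  define c where "c n i = ell2_coord (X n) i" for n i
  have "Cauchy (\<lambda>n. c n i)" for i
  proof (rule CauchyI)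
    fix e :: real assume "0 < e"
    then obtain N where N: "\<And>m n. m \<ge> N \<Longrightarrow> n \<ge> N \<Longrightarrow> norm (X m - X n) < e"
      using CauchyD[OF X] by blast
    have "norm (c m i - c n i) \<le> norm (X m - X n)" for m n
      using Cauchy_Schwarz_ineq2[of "X m - X n" "ell2_unit i"]
      by (simp add: c_def inner_ell2_unit ell2_coord_minus)
    with N show "\<exists>M. \<forall>m\<ge>M. \<forall>n\<ge>M. norm (c m i - c n i) < e"
      by (meson le_less_trans)
  qed
  then have "\<forall>i. \<exists>l. (\<lambda>n. c n i) \<longlonglongrightarrow> l"
    using Cauchy_convergent convergent_def by blast
  then obtain x where x: "\<And>i. (\<lambda>n. c n i) \<longlonglongrightarrow> x i" by metis
  \<comment> \<open>The tail estimate is taken over finite index sets, uniformly in them, so that it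
    gives both the square-summability of \<open>x - c m\<close> and, later, convergence in
    norm.\<close>
  have fin: "\<exists>N. \<forall>m\<ge>N. \<forall>F. finite F \<longrightarrow> (\<Sum>i\<in>F. (x i - c m i)\<^sup>2) \<le> e\<^sup>2" if e: "0 < e" for e
  proof -
    obtain N where N: "\<And>m n. m \<ge> N \<Longrightarrow> n \<ge> N \<Longrightarrow> norm (X m - X n) < e"
      using CauchyD[OF X e] by blast
    have "(\<Sum>i\<in>F. (x i - c m i)\<^sup>2) \<le> e\<^sup>2" if m: "m \<ge> N" and F: "finite F" for m F
    proof (rule LIMSEQ_le_const2)
      show "(\<lambda>n. \<Sum>i\<in>F. (c n i - c m i)\<^sup>2) \<longlonglongrightarrow> (\<Sum>i\<in>F. (x i - c m i)\<^sup>2)"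
        by (intro tendsto_intros x)
      have "(\<Sum>i\<in>F. (c n i - c m i)\<^sup>2) \<le> e\<^sup>2" if n: "n \<ge> N" for n
      proof -
        have "(\<Sum>i\<in>F. (c n i - c m i)\<^sup>2) \<le> (norm (X n - X m))\<^sup>2"
          using sum_coord_le_norm[OF F, of "X n - X m"] by (simp add: c_def ell2_coord_minus)
        also have "\<dots> \<le> e\<^sup>2"
          using N[OF n m] by (intro power_mono) auto
        finally show ?thesis .
      qed
      then show "\<exists>N. \<forall>n\<ge>N. (\<Sum>i\<in>F. (c n i - c m i)\<^sup>2) \<le> e\<^sup>2" by blast
    qed
    then show ?thesis by blast
  qed
  have summ: "(\<lambda>i. (x i - c m i)\<^sup>2) summable_on UNIV"
    if "\<forall>F. finite F \<longrightarrow> (\<Sum>i\<in>F. (x i - c m i)\<^sup>2) \<le> e\<^sup>2" for m e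
    by (rule nonneg_bdd_above_summable_on) (use that in \<open>auto intro!: bdd_aboveI[of _ "e\<^sup>2"]\<close>)
  obtain N1 where N1: "\<forall>m\<ge>N1. \<forall>F. finite F \<longrightarrow> (\<Sum>i\<in>F. (x i - c m i)\<^sup>2) \<le> 1\<^sup>2"
    using fin[of 1] by auto
  \<comment> \<open>Only the difference from \<open>X N1\<close> is known to be square-summable, so
    the limit is entered into the type as \<open>X N1\<close> plus that difference.\<close>
  define Y where "Y = X N1 + Abs_ell2 (\<lambda>i. x i - c N1 i)"
  have Y: "ell2_coord Y i = x i" for i
    using summ[of N1 1] N1 by (simp add: Y_def plus_ell2.rep_eq Abs_ell2_inverse c_def)
  have "X \<longlonglongrightarrow> Y"
  proof (rule LIMSEQ_I)
    fix r :: real assume r: "0 < r"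
    then obtain N where N: "\<forall>m\<ge>N. \<forall>F. finite F \<longrightarrow> (\<Sum>i\<in>F. (x i - c m i)\<^sup>2) \<le> (r/2)\<^sup>2"
      using fin[of "r/2"] by auto
    have "norm (X m - Y) < r" if m: "m \<ge> N" for m
    proof -
      have "(norm (Y - X m))\<^sup>2 \<le> (r/2)\<^sup>2"
        unfolding norm_ell2_infsum
        by (rule infsum_le_finite_sums[OF ell2_coord_summable])
          (use N m in \<open>simp add: ell2_coord_minus Y c_def\<close>)
      then have "norm (Y - X m) \<le> r/2" using r power2_le_imp_le by fastforce
      then show ?thesis using r by (simp add: norm_minus_commute)
    qed
    then show "\<exists>no. \<forall>n\<ge>no. norm (X n - Y) < r" by blast
  qed
  then show "convergent X" by (rule convergentI)
qed

instance ell2 :: (type) banach ..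

section \<open>Closed subspaces, orthogonal projection and Gram kernels\<close>

lemma subspace_closure:
  fixes S :: "'a::real_normed_vector set"
  assumes "subspace S" shows "subspace (closure S)"
proof -
  have "0 \<in> closure S" using assms closure_subset subspace_0 by blast
  moreover have "x + y \<in> closure S" if xy: "x \<in> closure S" "y \<in> closure S" for x y
  proof -
    from xy obtain f g where "\<And>n. f n \<in> S" "f \<longlonglongrightarrow> x" "\<And>n. g n \<in> S" "g \<longlonglongrightarrow> y"
      unfolding closure_sequential by blast
    then show ?thesis unfolding closure_sequential
      by (intro exI[of _ "\<lambda>n. f n + g n"]) (auto intro: tendsto_add subspace_add[OF assms])
  qed
  moreover have "c *\<^sub>R x \<in> closure S" if x: "x \<in> closure S" for x c
  proof -
    from x obtain f where "\<And>n. f n \<in> S" "f \<longlonglongrightarrow> x"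
      unfolding closure_sequential by blast
    then show ?thesis unfolding closure_sequential
      by (intro exI[of _ "\<lambda>n. c *\<^sub>R f n"]) (auto intro: tendsto_scaleR subspace_mul[OF assms])
  qed
  ultimately show ?thesis by (simp add: subspace_def)
qed

definition ell2_on :: "'i set \<Rightarrow> 'i ell2 set"
  where "ell2_on I = {x. \<forall>i. i \<notin> I \<longrightarrow> ell2_coord x i = 0}"

lemma subspace_ell2_on: "subspace (ell2_on I)"
  by (auto simp: subspace_def ell2_on_def ell2_coord_simps)

lemma closed_ell2_on: "closed (ell2_on I)"
proof -
  have "closed {x. ell2_coord x i = 0}" for i
    using continuous_on_ell2_coord[OF continuous_on_id, of UNIV i] continuous_on_const
    by (rule closed_Collect_eq)
  then have "closed (\<Inter>i\<in>-I. {x. ell2_coord x i = 0})" by (rule closed_INT[OF ballI])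
  also have "(\<Inter>i\<in>-I. {x. ell2_coord x i = 0}) = ell2_on I"
    unfolding ell2_on_def by blast
  finally show ?thesis .
qed

lemma ell2_on_mono: "I \<subseteq> J \<Longrightarrow> ell2_on I \<subseteq> ell2_on J"
  unfolding ell2_on_def by blast

lemma ell2_unit_mem: "ell2_unit i \<in> ell2_on I \<longleftrightarrow> i \<in> I"
  by (auto simp: ell2_on_def ell2_coord_unit)

text \<open>\<open>G\<close> is the graph of a linear functional that need not be known to be
  single-valued or bounded; the positivity hypothesis contains both. For \<open>c = |y|^2\<close>
  and \<open>s = <y, v>\<close> the quantity is \<open>|v - y|^2\<close>, so minimising it produces
  the orthogonal projection \<open>P\<close> of a vector \<open>y\<close> that may not exist yet,
  and \<open>inner P P <= c\<close> leaves room for the remaining component.\<close>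

lemma riesz_subspace:
  fixes G :: "('a::{real_inner,complete_space} \<times> real) set"
  assumes G: "subspace G" and pos: "\<And>v s. (v, s) \<in> G \<Longrightarrow> 0 \<le> inner v v - 2 * s + c"
  obtains P where "P \<in> closure (fst ` G)" "\<And>v s. (v, s) \<in> G \<Longrightarrow> inner P v = s" "inner P P \<le> c"
proof -
  define J where "J g = inner (fst g) (fst g) - 2 * snd g + c" for g :: "'a \<times> real"
  define m where "m = Inf (J ` G)"
  have ne: "G \<noteq> {}" using subspace_0[OF G] by auto
  have Jpos: "0 \<le> J g" if "g \<in> G" for g
    using pos[of "fst g" "snd g"] that by (simp add: J_def)
  have bdd: "bdd_below (J ` G)"
    by (rule bdd_belowI[of _ 0]) (use Jpos in auto)
  have mle: "m \<le> J g" if "g \<in> G" for g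
    unfolding m_def using that bdd by (intro cInf_lower) auto
  have m0: "0 \<le> m" unfolding m_def using ne Jpos by (intro cInf_greatest) auto
  have "\<exists>g\<in>G. J g < m + inverse (real (Suc n))" for n
  proof (rule ccontr)
    assume "\<not> ?thesis"
    then have "m + inverse (real (Suc n)) \<le> Inf (J ` G)"
      using ne by (intro cInf_greatest) (auto simp: not_less)
    then show False by (simp add: m_def[symmetric])
  qed
  then obtain g where g: "\<And>n. g n \<in> G" and gJ: "\<And>n. J (g n) < m + inverse (real (Suc n))"
    by metis
  define v where "v n = fst (g n)" for n
  have Jlim: "(\<lambda>n. J (g n)) \<longlonglongrightarrow> m"
  proof (rule tendsto_sandwich[of "\<lambda>_. m" _ _ "\<lambda>n. m + inverse (real (Suc n))"])
    show "(\<lambda>n. m + inverse (real (Suc n))) \<longlonglongrightarrow> m"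
      using tendsto_add[OF tendsto_const LIMSEQ_inverse_real_of_nat, of m] by simp
  qed (use mle g gJ in \<open>auto intro!: eventuallyI less_imp_le\<close>)
  \<comment> \<open>Parallelogram identity at the midpoint, whose value is at least the infimum: the
    minimising sequence is Cauchy.\<close>
  have par: "(norm (v i - v j))\<^sup>2 \<le> 2 * J (g i) + 2 * J (g j) - 4 * m" for i j
  proof -
    let ?h = "(1/2) *\<^sub>R (g i + g j)"
    have "?h \<in> G" using G g by (simp add: subspace_add subspace_mul)
    then have "m \<le> J ?h" by (rule mle)
    moreover have "(norm (v i - v j))\<^sup>2 + 4 * J ?h = 2 * J (g i) + 2 * J (g j)"
      unfolding power2_norm_eq_inner J_def v_def
      by (simp add: inner_add inner_diff inner_commute algebra_simps)
    ultimately show ?thesis by linarith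
  qed
  have "Cauchy v"
  proof (rule CauchyI)
    fix e :: real assume e: "0 < e"
    then obtain N where N: "\<forall>n\<ge>N. \<bar>J (g n) - m\<bar> < e\<^sup>2/4"
      using LIMSEQ_D[OF Jlim, of "e\<^sup>2/4"] by auto
    have "norm (v i - v j) < e" if "i \<ge> N" "j \<ge> N" for i j
    proof (rule power2_less_imp_less)
      have "\<bar>J (g i) - m\<bar> < e\<^sup>2/4" "\<bar>J (g j) - m\<bar> < e\<^sup>2/4" using N that by blast+
      then show "(norm (v i - v j))\<^sup>2 < e\<^sup>2" using par[of i j] by linarith
    qed (use e in simp)
    then show "\<exists>M. \<forall>m\<ge>M. \<forall>n\<ge>M. norm (v m - v n) < e" by blast
  qed
  then obtain P where P: "v \<longlonglongrightarrow> P"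
    using Cauchy_convergent convergent_def by blast
  have cl: "P \<in> closure (fst ` G)"
    unfolding closure_sequential using P g by (intro exI[of _ v]) (auto simp: v_def)
  have in': "inner P w = s" if ws: "(w, s) \<in> G" for w s
  proof -
    let ?d = "inner P w - s"
    have ineq: "0 \<le> 2 * t * ?d + t\<^sup>2 * inner w w" for t
    proof -
      have "m \<le> J (g n) + (2 * t * (inner (v n) w - s) + t\<^sup>2 * inner w w)" for n
      proof -
        have "g n + t *\<^sub>R (w, s) \<in> G" using G g ws by (intro subspace_add subspace_mul)
        then have "m \<le> J (g n + t *\<^sub>R (w, s))" by (rule mle)
        also have "\<dots> = J (g n) + (2 * t * (inner (v n) w - s) + t\<^sup>2 * inner w w)"
          unfolding J_def v_def
          by (simp add: inner_add inner_commute power2_eq_square algebra_simps)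
        finally show ?thesis .
      qed
      moreover have "(\<lambda>n. J (g n) + (2 * t * (inner (v n) w - s) + t\<^sup>2 * inner w w))
          \<longlonglongrightarrow> m + (2 * t * (inner P w - s) + t\<^sup>2 * inner w w)"
        by (intro tendsto_intros Jlim P)
      ultimately have "m \<le> m + (2 * t * ?d + t\<^sup>2 * inner w w)"
        by (intro LIMSEQ_le_const) auto
      then show ?thesis by simp
    qed
    have "?d = 0"
    proof (rule ccontr)
      assume d: "?d \<noteq> 0"
      \<comment> \<open>The extra \<open>1\<close> keeps the denominator positive when
        \<open>w = 0\<close>; \<open>t = - ?d / q\<close> then makes the quadratic in
        \<open>ineq\<close> negative.\<close>
      define q where "q = inner w w + 1"
      have q: "q > 0" "inner w w < q" by (auto simp: q_def add_nonneg_pos)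
      have "0 \<le> 2 * (- ?d / q) * ?d + (- ?d / q)\<^sup>2 * inner w w" by (rule ineq)
      also have "\<dots> = (?d\<^sup>2 / q) * (inner w w / q - 2)"
        using q by (simp add: power2_eq_square field_simps)
      also have "\<dots> < 0"
        using d q by (intro mult_pos_neg) (auto simp: field_simps)
      finally show False by simp
    qed
    then show ?thesis by simp
  qed
  have "inner P P \<le> c"
  proof -
    have "J (g n) = inner (v n) (v n) - 2 * inner P (v n) + c" for n
      using in'[of "v n" "snd (g n)"] g[of n] by (simp add: J_def v_def)
    moreover have "(\<lambda>n. inner (v n) (v n) - 2 * inner P (v n) + c)
        \<longlonglongrightarrow> inner P P - 2 * inner P P + c"
      by (intro tendsto_intros P)
    ultimately have "m = inner P P - 2 * inner P P + c"
      using Jlim LIMSEQ_unique by fastforce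
    with m0 show ?thesis by linarith
  qed
  with cl in' that show ?thesis by blast
qed

text \<open>Choosing \<open>F\<close> with \<open>h\<close> injective on it indexes the combination
  by \<open>D\<close>, so one family of coefficients can be read off in both components of a
  pair.\<close>

lemma span_image_expl:
  assumes "x \<in> span (h ` D)"
  obtains F l where "finite F" "F \<subseteq> D" "x = (\<Sum>z\<in>F. l z *\<^sub>R h z)"
proof -
  from assms obtain t r where t: "finite t" "t \<subseteq> h ` D" and x: "x = (\<Sum>a\<in>t. r a *\<^sub>R a)"
    unfolding span_explicit by auto
  from t(2) obtain F where F: "F \<subseteq> D" "inj_on h F" "t = h ` F"
    by (auto simp: subset_image_inj)
  show ?thesis
  proof (rule that)
    show "finite F" using t(1) F finite_imageD by blast
    show "F \<subseteq> D" by fact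
    show "x = (\<Sum>z\<in>F. r (h z) *\<^sub>R h z)"
      using F by (simp add: x sum.reindex)
  qed
qed

text \<open>A transfinite Cholesky decomposition: along a well-order of the index set, each new vector
  is the sum of its projection onto the closed span of the previous ones and a multiple of a new
  basis vector. This keeps the basis vectors used inside the closed span.\<close>

lemma gram_embedding:
  fixes k :: "'y \<Rightarrow> 'y \<Rightarrow> real" and \<iota> :: "'y \<Rightarrow> 'k"
  assumes inj: "inj \<iota>" and sym: "\<And>x y. k x y = k y x"
    and psd: "\<And>F l. finite F \<Longrightarrow> 0 \<le> (\<Sum>x\<in>F. \<Sum>y\<in>F. l x * l y * k x y)"
  obtains T :: "'y \<Rightarrow> 'k ell2" and I where
    "I \<subseteq> range \<iota>" "\<And>x y. inner (T x) (T y) = k x y" "closure (span (range T)) = ell2_on I"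
proof -
  obtain r :: "'y rel" where "well_order_on UNIV r" using well_order_on by blast
  define R where "R = r - Id"
  have wf: "wf R" and tot: "\<And>x y. x \<noteq> y \<Longrightarrow> (x, y) \<in> R \<or> (y, x) \<in> R" and tr: "trans R"
    using \<open>well_order_on UNIV r\<close>
    by (auto simp: R_def well_order_on_def linear_order_on_def partial_order_on_def
        preorder_on_def total_on_def intro: trans_diff_Id)
  have irr: "(x, x) \<notin> R" for x by (simp add: R_def)
  \<comment> \<open>The support condition makes the basis vector of \<open>y\<close> orthogonal to
    all earlier \<open>T z\<close>. The last condition will put that basis vector into the closed
    span whenever its coefficient is nonzero.\<close>
  define good where "good T y h \<longleftrightarrow>
      (\<forall>z. (z, y) \<in> R \<longrightarrow> inner h (T z) = k y z) \<and> inner h h = k y y \<and>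
      h \<in> ell2_on (insert (\<iota> y) (\<iota> ` {z. (z, y) \<in> R})) \<and>
      (\<exists>c. h - c *\<^sub>R ell2_unit (\<iota> y) \<in> closure (span (T ` {z. (z, y) \<in> R})))"
    for T :: "'y \<Rightarrow> 'k ell2" and y h
  define T where "T = wfrec R (\<lambda>T y. SOME h. good T y h)"
  \<comment> \<open>\<open>good\<close> consults \<open>T\<close> only below \<open>y\<close>, so
    the truncation made by well-founded recursion changes nothing.\<close>
  have good_cut: "good (cut T R y) y = good T y" for y
  proof -
    have "cut T R y ` {z. (z, y) \<in> R} = T ` {z. (z, y) \<in> R}"
      by (intro image_cong) (auto simp: cut_apply)
    then show ?thesis by (intro ext) (simp add: good_def cut_apply cong: conj_cong)
  qed
  have T: "T y = (SOME h. good T y h)" for y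
    using wfrec[OF wf, of "\<lambda>T y. SOME h. good T y h" y] by (simp add: good_cut flip: T_def)
  have step: "\<exists>h. good T y h" if IH: "\<And>z. (z, y) \<in> R \<Longrightarrow> good T z (T z)" for y
  proof -
    define D where "D = {z. (z, y) \<in> R}"
    have gram: "inner (T z) (T z') = k z z'" if "z \<in> D" "z' \<in> D" for z z'
    proof (cases "z = z'")
      case True
      then show ?thesis using IH[of z] that by (auto simp: D_def good_def)
    next
      case False
      then consider "(z, z') \<in> R" | "(z', z) \<in> R" using tot by blast
      then show ?thesis
      proof cases
        case 1
        then have "inner (T z') (T z) = k z' z" using IH[of z'] that by (simp add: D_def good_def)
        then show ?thesis by (simp only: inner_commute sym)
      next
        case 2
        then show ?thesis using IH[of z] that by (simp add: D_def good_def)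
      qed
    qed
    \<comment> \<open>Graph of the functional sending \<open>T z\<close> to \<open>k y z\<close>,
      that is, of the inner product with the vector still to be found. Positivity of
      \<open>k\<close> supplies the hypothesis of \<open>riesz_subspace\<close>, which includes that
      the functional is well defined.\<close>
    define G where "G = span ((\<lambda>z. (T z, k y z)) ` D)"
    have pos: "0 \<le> inner v v - 2 * s + k y y" if "(v, s) \<in> G" for v s
    proof -
      from that[unfolded G_def] obtain F l where F: "finite F" "F \<subseteq> D"
        and vs: "(v, s) = (\<Sum>z\<in>F. l z *\<^sub>R (T z, k y z))" by (rule span_image_expl)
      from arg_cong[OF vs, of fst] have v: "v = (\<Sum>z\<in>F. l z *\<^sub>R T z)" by (simp add: fst_sum)
      from arg_cong[OF vs, of snd] have s: "s = (\<Sum>z\<in>F. l z * k y z)" by (simp add: snd_sum)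
      have y: "y \<notin> F" using F irr by (auto simp: D_def)
      \<comment> \<open>Weight \<open>- 1\<close> on \<open>y\<close> turns the quadratic form of
        \<open>k\<close> into \<open>inner v v - 2 * s + k y y\<close>.\<close>
      define l' where "l' = l(y := - 1)"
      have l': "l' z = l z" if "z \<in> F" for z using that y by (auto simp: l'_def)
      have "0 \<le> (\<Sum>x\<in>insert y F. \<Sum>z\<in>insert y F. l' x * l' z * k x z)"
        using F by (intro psd) simp
      also have "\<dots> = k y y - 2 * (\<Sum>z\<in>F. l z * k y z) + (\<Sum>x\<in>F. \<Sum>z\<in>F. l x * l z * k x z)"
      proof -
        have "l' y = - 1" by (simp add: l'_def)
        moreover have "(\<Sum>z\<in>F. l' y * l' z * k y z) = - (\<Sum>z\<in>F. l z * k y z)"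
          unfolding sum_negf[symmetric] by (rule sum.cong) (simp_all add: l' \<open>l' y = - 1\<close>)
        moreover have "(\<Sum>z\<in>F. l' z * l' y * k z y) = - (\<Sum>z\<in>F. l z * k y z)"
          unfolding sum_negf[symmetric]
          by (rule sum.cong) (simp_all add: l' \<open>l' y = - 1\<close> sym)
        moreover have "(\<Sum>x\<in>F. \<Sum>z\<in>F. l' x * l' z * k x z) = (\<Sum>x\<in>F. \<Sum>z\<in>F. l x * l z * k x z)"
          by (intro sum.cong refl) (simp add: l')
        moreover have "(\<Sum>x\<in>insert y F. \<Sum>z\<in>insert y F. l' x * l' z * k x z) =
            l' y * l' y * k y y + (\<Sum>z\<in>F. l' y * l' z * k y z) +
            ((\<Sum>x\<in>F. l' x * l' y * k x y) + (\<Sum>x\<in>F. \<Sum>z\<in>F. l' x * l' z * k x z))"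
          using F y by (simp only: sum.insert sum.distrib if_False simp_thms)
        ultimately show ?thesis by simp
      qed
      also have "(\<Sum>x\<in>F. \<Sum>z\<in>F. l x * l z * k x z) = inner v v"
        unfolding v inner_sum_left inner_sum_right
        by (rule sum.cong[OF refl], rule sum.cong[OF refl]) (use F in \<open>simp add: gram sym subset_iff mult_ac\<close>)
      finally show ?thesis by (simp add: s)
    qed
    have sG: "subspace G" by (simp add: G_def)
    obtain P where P: "P \<in> closure (fst ` G)" "\<And>v s. (v, s) \<in> G \<Longrightarrow> inner P v = s"
        "inner P P \<le> k y y"
      using riesz_subspace[OF sG pos] by blast
    have fG: "fst ` G = span (T ` D)"
      using linear_span_image[OF bounded_linear.linear[OF bounded_linear_fst],
          of "(\<lambda>z. (T z, k y z)) ` D"]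
      by (simp only: G_def image_image fst_conv)
    have P': "inner P (T z) = k y z" if "z \<in> D" for z
      by (rule P(2), unfold G_def, rule span_base, use that in blast)
    have supp: "P \<in> ell2_on (\<iota> ` D)"
    proof -
      have "T z \<in> ell2_on (\<iota> ` D)" if "z \<in> D" for z
      proof -
        have "(x, y) \<in> R" if "(x, z) \<in> R" for x
          using that \<open>z \<in> D\<close> transD[OF tr] unfolding D_def by blast
        then have "insert (\<iota> z) (\<iota> ` {x. (x, z) \<in> R}) \<subseteq> \<iota> ` D"
          using that by (auto simp: D_def)
        moreover have "T z \<in> ell2_on (insert (\<iota> z) (\<iota> ` {x. (x, z) \<in> R}))"
          using IH[of z] that unfolding D_def good_def by blast
        ultimately show ?thesis using ell2_on_mono by blast
      qed
      then have "span (T ` D) \<subseteq> ell2_on (\<iota> ` D)"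
        by (intro span_minimal subspace_ell2_on) auto
      then have "closure (span (T ` D)) \<subseteq> ell2_on (\<iota> ` D)"
        by (intro closure_minimal closed_ell2_on)
      then show ?thesis using P(1) fG by auto
    qed
    have ny: "\<iota> y \<notin> \<iota> ` D" using inj irr by (auto simp: D_def dest: injD)
    then have Py: "inner P (ell2_unit (\<iota> y)) = 0"
      using supp by (simp add: inner_ell2_unit ell2_on_def)
    have Ty: "inner (ell2_unit (\<iota> y)) (T z) = 0" if "z \<in> D" for z
    proof -
      have "(x, y) \<in> R" if "(x, z) \<in> R" for x
        using that \<open>z \<in> D\<close> transD[OF tr] unfolding D_def by blast
      then have "\<iota> y \<notin> insert (\<iota> z) (\<iota> ` {x. (x, z) \<in> R})"
        using that ny by (auto simp: D_def)
      moreover have "T z \<in> ell2_on (insert (\<iota> z) (\<iota> ` {x. (x, z) \<in> R}))"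
        using IH[of z] that unfolding D_def good_def by blast
      ultimately show ?thesis
        unfolding inner_commute[of "ell2_unit _"] inner_ell2_unit ell2_on_def by blast
    qed
    \<comment> \<open>The length of the new vector beyond its projection \<open>P\<close>; it is
      zero when \<open>k\<close> forces the vector into the closed span of its predecessors.\<close>
    define c where "c = sqrt (k y y - inner P P)"
    have c: "c * c = k y y - inner P P" using P(3) by (simp add: c_def)
    have "good T y (P + c *\<^sub>R ell2_unit (\<iota> y))"
      unfolding good_def
    proof (intro conjI allI impI)
      fix z assume "(z, y) \<in> R"
      then show "inner (P + c *\<^sub>R ell2_unit (\<iota> y)) (T z) = k y z"
        using P' Ty by (simp add: D_def inner_add)
    next
      show "inner (P + c *\<^sub>R ell2_unit (\<iota> y)) (P + c *\<^sub>R ell2_unit (\<iota> y)) = k y y"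
        using Py c by (simp add: inner_add inner_commute)
    next
      show "P + c *\<^sub>R ell2_unit (\<iota> y) \<in> ell2_on (insert (\<iota> y) (\<iota> ` {z. (z, y) \<in> R}))"
        using supp by (auto simp: ell2_on_def D_def ell2_coord_simps ell2_coord_unit)
    next
      show "\<exists>c'. P + c *\<^sub>R ell2_unit (\<iota> y) - c' *\<^sub>R ell2_unit (\<iota> y)
          \<in> closure (span (T ` {z. (z, y) \<in> R}))"
        using P(1) fG by (intro exI[of _ c]) (simp add: D_def)
    qed
    then show ?thesis ..
  qed
  have good: "good T y (T y)" for y
  proof (induction y rule: wf_induct_rule[OF wf])
    case (1 y)
    from step[OF this] show ?case by (subst T) (rule someI_ex)
  qed
  define L where "L = closure (span (range T))"
  have L: "subspace L" "closed L" by (simp_all add: L_def subspace_closure)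
  have TL: "T y \<in> L" for y
    unfolding L_def by (rule subsetD[OF closure_subset], rule span_base, rule rangeI)
  \<comment> \<open>Retaining only unit vectors of \<open>L\<close> is what allows
    \<open>ell2_on I \<subseteq> L\<close>; the induction for \<open>TI\<close> shows that the
    construction is supported on these indices.\<close>
  define I where "I = {i. ell2_unit i \<in> L} \<inter> range \<iota>"
  have TI: "T y \<in> ell2_on I" for y
  proof (induction y rule: wf_induct_rule[OF wf])
    case (1 y)
    let ?S = "closure (span (T ` {z. (z, y) \<in> R}))"
    obtain c where c: "T y - c *\<^sub>R ell2_unit (\<iota> y) \<in> ?S"
      using good[of y] unfolding good_def by blast
    have S1: "?S \<subseteq> ell2_on I"
      using 1 by (intro closure_minimal closed_ell2_on span_minimal subspace_ell2_on) auto
    have "span (T ` {z. (z, y) \<in> R}) \<subseteq> span (range T)" by (intro span_mono) auto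
    then have S2: "?S \<subseteq> L" unfolding L_def by (rule closure_mono)
    have u: "c *\<^sub>R ell2_unit (\<iota> y) \<in> ell2_on I"
    proof (cases "c = 0")
      case True
      then show ?thesis by (simp add: subspace_0 subspace_ell2_on)
    next
      case False
      have "T y - (T y - c *\<^sub>R ell2_unit (\<iota> y)) \<in> L"
        using S2 c by (blast intro: subspace_diff[OF L(1)] TL)
      then have "c *\<^sub>R ell2_unit (\<iota> y) \<in> L" by simp
      then have "(1 / c) *\<^sub>R (c *\<^sub>R ell2_unit (\<iota> y)) \<in> L"
        by (rule subspace_mul[OF L(1)])
      then have "\<iota> y \<in> I" using False by (simp add: I_def)
      then show ?thesis by (simp add: subspace_mul subspace_ell2_on ell2_unit_mem)
    qed
    have "T y - c *\<^sub>R ell2_unit (\<iota> y) + c *\<^sub>R ell2_unit (\<iota> y) \<in> ell2_on I"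
      using S1 c u by (blast intro: subspace_add[OF subspace_ell2_on])
    then show ?case by simp
  qed
  have LI: "L \<subseteq> ell2_on I"
    unfolding L_def using TI
    by (intro closure_minimal closed_ell2_on span_minimal subspace_ell2_on) auto
  have IL: "ell2_on I \<subseteq> L"
  proof
    fix y assume y: "y \<in> ell2_on I"
    \<comment> \<open>\<open>riesz_subspace\<close> for the functional \<open>inner y\<close> on the
      closed subspace \<open>L\<close> yields the projection of \<open>y\<close>. It has the
      coordinates of \<open>y\<close> in \<open>I\<close>, since those unit vectors lie in
      \<open>L\<close>, and both vanish outside \<open>I\<close>.\<close>
    define G where "G = (\<lambda>v. (v, inner y v)) ` L"
    have "subspace G"
      unfolding G_def using L(1)
      by (intro linear_subspace_image linearI) (auto simp: inner_add_right)
    moreover have "0 \<le> inner v v - 2 * s + inner y y" if "(v, s) \<in> G" for v s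
    proof -
      have "0 \<le> inner (v - y) (v - y)" by (rule inner_ge_zero)
      then show ?thesis using that by (auto simp: G_def inner_diff inner_commute)
    qed
    ultimately obtain P where P: "P \<in> closure (fst ` G)"
      "\<And>v s. (v, s) \<in> G \<Longrightarrow> inner P v = s"
      using riesz_subspace[of G] by metis
    have "fst ` G = L" by (simp add: G_def image_image)
    then have PL: "P \<in> L" using P(1) L(2) by simp
    have "ell2_coord P i = ell2_coord y i" for i
    proof (cases "i \<in> I")
      case True
      then have "(ell2_unit i, inner y (ell2_unit i)) \<in> G" by (simp add: G_def I_def)
      from P(2)[OF this] show ?thesis by (simp only: inner_ell2_unit)
    next
      case False
      then show ?thesis using subsetD[OF LI PL] y by (simp add: ell2_on_def)
    qed
    then have "P = y" by (rule ell2_eqI)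
    with PL show "y \<in> L" by simp
  qed
  show ?thesis
  proof (rule that)
    show "I \<subseteq> range \<iota>" by (auto simp: I_def)
    show "closure (span (range T)) = ell2_on I" using LI IL by (simp only: L_def subset_antisym)
    fix x y show "inner (T x) (T y) = k x y"
    proof (cases "x = y")
      case True
      then show ?thesis using good[of x] by (simp add: good_def)
    next
      case False
      then consider "(x, y) \<in> R" | "(y, x) \<in> R" using tot by blast
      then show ?thesis
      proof cases
        case 1
        then have "inner (T y) (T x) = k y x" using good[of y] by (simp add: good_def)
        then show ?thesis by (simp only: inner_commute sym)
      next
        case 2
        then show ?thesis using good[of x] by (simp add: good_def)
      qed
    qed
  qed
qed

section \<open>The Lorentz form\<close>

lemma lorentz_eq_inner: "lorentz x y = 2 * fst x * fst y - inner x y"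
  by (simp add: lorentz_def inner_prod_def)

lemma lorentz_commute: "lorentz x y = lorentz y x"
  by (simp add: lorentz_def inner_commute mult.commute)

lemma lorentz_add_left: "lorentz (x + y) z = lorentz x z + lorentz y z"
  by (simp add: lorentz_def inner_add algebra_simps)

lemma lorentz_add_right: "lorentz z (x + y) = lorentz z x + lorentz z y"
  by (simp add: lorentz_def inner_add algebra_simps)

lemma lorentz_diff_left: "lorentz (x - y) z = lorentz x z - lorentz y z"
  by (simp add: lorentz_def inner_diff algebra_simps)

lemma lorentz_diff_right: "lorentz z (x - y) = lorentz z x - lorentz z y"
  by (simp add: lorentz_def inner_diff algebra_simps)

lemma lorentz_scaleR_left: "lorentz (c *\<^sub>R x) y = c * lorentz x y"
  using lorentz_scaleR[of c x 1 y] by simp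

lemma lorentz_scaleR_right: "lorentz x (c *\<^sub>R y) = c * lorentz x y"
  using lorentz_scaleR[of 1 x c y] by simp

lemma lorentz_zero [simp]: "lorentz 0 x = 0" "lorentz x 0 = 0"
  by (simp_all add: lorentz_def)

lemmas lorentz_simps = lorentz_add_left lorentz_add_right lorentz_diff_left lorentz_diff_right
  lorentz_scaleR_left lorentz_scaleR_right

lemma tendsto_lorentz [tendsto_intros]:
  "(f \<longlongrightarrow> a) F \<Longrightarrow> (g \<longlongrightarrow> b) F \<Longrightarrow> ((\<lambda>x. lorentz (f x) (g x)) \<longlongrightarrow> lorentz a b) F"
  unfolding lorentz_def by (intro tendsto_intros)

lemma lorentz_self: "lorentz v v = (fst v)\<^sup>2 - (norm (snd v))\<^sup>2"
  unfolding lorentz_def power2_norm_eq_inner by (simp only: power2_eq_square)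

lemma norm_lorentz: "(norm v)\<^sup>2 = 2 * (fst v)\<^sup>2 - lorentz v v"
  unfolding power2_norm_eq_inner by (simp add: lorentz_eq_inner power2_eq_square)

lemma subspace_lorentz_space: "subspace (lorentz_space I)"
  by (auto simp: subspace_def lorentz_space_def ell2_coord_simps)

lemma lorentz_space_iff: "v \<in> lorentz_space I \<longleftrightarrow> snd v \<in> ell2_on I"
  by (simp add: lorentz_space_def ell2_on_def)

lemma closed_lorentz_space: "closed (lorentz_space I)"
proof -
  have "lorentz_space I = snd -` ell2_on I" by (auto simp: lorentz_space_iff)
  then show ?thesis
    using closed_vimage[OF closed_ell2_on continuous_on_snd[OF continuous_on_id]] by simp
qed

text \<open>Pairing \<open>v\<close> with its space reflection \<open>(fst v, - snd v)\<close> gives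
  the Euclidean \<open>inner v v\<close>.\<close>

lemma lorentz_nondegenerate:
  assumes "v \<in> lorentz_space I" and "\<And>w. w \<in> lorentz_space I \<Longrightarrow> lorentz v w = 0"
  shows "v = 0"
proof -
  have "snd v \<in> ell2_on I" using assms(1) by (simp add: lorentz_space_iff)
  then have "- snd v \<in> ell2_on I" by (rule subspace_neg[OF subspace_ell2_on])
  then have "(fst v, - snd v) \<in> lorentz_space I" by (simp add: lorentz_space_iff)
  then have "lorentz v (fst v, - snd v) = 0" by (rule assms(2))
  then have "inner v v = 0" by (simp add: lorentz_def inner_prod_def)
  then show ?thesis by simp
qed

abbreviation base_point :: "real \<times> 'i ell2"
  where "base_point \<equiv> (1, 0)"

lemma lorentz_base_point [simp]: "lorentz v base_point = fst v" "lorentz base_point v = fst v"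
  by (simp_all add: lorentz_def)

lemma base_point_hyp: "base_point \<in> hyp I"
  by (simp add: hyp_def lorentz_space_iff subspace_0 subspace_ell2_on)

text \<open>The form has a single positive direction, so it is negative definite orthogonally to a
  timelike \<open>q\<close>. In coordinates, orthogonality expresses \<open>fst q * fst v\<close> as
  an inner product of spatial parts, and Cauchy-Schwarz together with
  \<open>|snd q| < |fst q|\<close> gives the sign.\<close>

lemma lorentz_orthogonal:
  assumes q: "lorentz q q > 0" and v: "lorentz q v = 0"
  shows "lorentz v v \<le> 0" "lorentz v v = 0 \<Longrightarrow> v = 0"
proof -
  have q0: "inner (snd q) (snd q) < (fst q)\<^sup>2"
    using q by (simp add: lorentz_def power2_eq_square)
  have "fst q * fst v = inner (snd q) (snd v)" using v by (simp add: lorentz_def)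
  then have "(fst q)\<^sup>2 * (fst v)\<^sup>2 = (inner (snd q) (snd v))\<^sup>2"
    by (metis power_mult_distrib)
  then have le: "(fst q)\<^sup>2 * (fst v)\<^sup>2 \<le> inner (snd q) (snd q) * inner (snd v) (snd v)"
    by (simp add: Cauchy_Schwarz_ineq)
  have pos: "0 < (fst q)\<^sup>2"
    using q0 le_less_trans[OF inner_ge_zero] by blast
  have lt: "lorentz v v < 0" if "v \<noteq> 0"
  proof (cases "snd v = 0")
    case True
    then have "fst v = 0" using le pos by (simp add: mult_le_0_iff)
    with True that show ?thesis by (simp add: prod_eq_iff)
  next
    case False
    then have "inner (snd q) (snd q) * inner (snd v) (snd v) < (fst q)\<^sup>2 * inner (snd v) (snd v)"
      using q0 by simp
    with le have "(fst q)\<^sup>2 * (fst v)\<^sup>2 < (fst q)\<^sup>2 * inner (snd v) (snd v)" by linarith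
    then have "(fst v)\<^sup>2 < inner (snd v) (snd v)" using pos by simp
    then show ?thesis by (simp add: lorentz_def power2_eq_square)
  qed
  show "lorentz v v \<le> 0" using lt by (cases "v = 0") auto
  show "lorentz v v = 0 \<Longrightarrow> v = 0" using lt by fastforce
qed

text \<open>Subtracting from \<open>v\<close> its component along \<open>q\<close> leaves a vector
  orthogonal to \<open>q\<close>, where the form is negative definite.\<close>

lemma lorentz_reverse_Cauchy_Schwarz:
  assumes "lorentz q q = 1"
  shows "lorentz v v \<le> (lorentz v q)\<^sup>2" "lorentz v v = (lorentz v q)\<^sup>2 \<Longrightarrow> v = lorentz v q *\<^sub>R q"
proof -
  let ?w = "v - lorentz v q *\<^sub>R q"
  have "lorentz q ?w = 0" using assms by (simp add: lorentz_simps lorentz_commute)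
  moreover have ww: "lorentz ?w ?w = lorentz v v - (lorentz v q)\<^sup>2"
    using assms by (simp add: lorentz_simps lorentz_commute power2_eq_square algebra_simps)
  moreover have "lorentz q q > 0" using assms by simp
  ultimately show "lorentz v v \<le> (lorentz v q)\<^sup>2"
      "lorentz v v = (lorentz v q)\<^sup>2 \<Longrightarrow> v = lorentz v q *\<^sub>R q"
    using lorentz_orthogonal[of q ?w] by auto
qed

text \<open>Cauchy-Schwarz for the spatial parts of two future vectors. Only \<open>x\<close> must
  be strictly timelike; \<open>y\<close> may be isotropic, which covers pairings of points with
  boundary representatives.\<close>

lemma lorentz_pos:
  assumes "fst x > 0" "fst y > 0" "lorentz x x > 0" "lorentz y y \<ge> 0"
  shows "lorentz x y > 0"
proof -
  have x: "norm (snd x) < fst x"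
    by (rule power2_less_imp_less) (use assms in \<open>simp_all add: lorentz_self\<close>)
  have y: "norm (snd y) \<le> fst y"
    by (rule power2_le_imp_le) (use assms in \<open>simp_all add: lorentz_self\<close>)
  have "inner (snd x) (snd y) \<le> norm (snd x) * norm (snd y)" by (rule norm_cauchy_schwarz)
  also have "\<dots> \<le> norm (snd x) * fst y" using y by (simp add: mult_left_mono)
  also have "\<dots> < fst x * fst y" using x assms by simp
  finally show ?thesis by (simp add: lorentz_def)
qed

section \<open>Points of hyperbolic space as future unit vectors\<close>

lemma hypD:
  assumes "x \<in> hyp I"
  shows "x \<in> lorentz_space I" "lorentz x x = 1" "fst x > 0"
  using assms by (auto simp: hyp_def)

lemma hyp_normalize:
  assumes "v \<in> lorentz_space I" "lorentz v v > 0" "fst v > 0"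
  shows "(1 / sqrt (lorentz v v)) *\<^sub>R v \<in> hyp I"
proof -
  define r where "r = sqrt (lorentz v v)"
  have r: "r > 0" "lorentz v v = r * r" using assms(2) by (simp_all add: r_def)
  then have "lorentz ((1 / r) *\<^sub>R v) ((1 / r) *\<^sub>R v) = 1" by (simp add: lorentz_simps)
  moreover have "(1 / r) *\<^sub>R v \<in> lorentz_space I"
    using assms(1) by (rule subspace_mul[OF subspace_lorentz_space])
  moreover have "fst ((1 / r) *\<^sub>R v) > 0" using assms(3) r(1) by simp
  ultimately show ?thesis by (simp add: hyp_def r_def)
qed

lemma hyp_lorentz_ge_1:
  assumes "x \<in> hyp I" "y \<in> hyp I"
  shows "lorentz x y \<ge> 1"
proof -
  have "lorentz x y > 0" by (rule lorentz_pos) (use assms in \<open>simp_all add: hypD\<close>)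
  moreover have "1\<^sup>2 \<le> (lorentz x y)\<^sup>2"
    using lorentz_reverse_Cauchy_Schwarz(1)[of y x] assms by (simp add: hypD lorentz_commute)
  ultimately show ?thesis using power2_le_imp_le[of 1 "lorentz x y"] by simp
qed

lemma hyp_lorentz_eq_1:
  assumes "x \<in> hyp I" "y \<in> hyp I" "lorentz x y = 1"
  shows "x = y"
  using lorentz_reverse_Cauchy_Schwarz(2)[of y x] assms by (simp add: hypD lorentz_commute)

text \<open>The negative of a past timelike vector would pair positively with \<open>x\<close> by
  \<open>lorentz_pos\<close>. This lets a map that preserves products transport the time
  orientation.\<close>

lemma fst_pos_of_lorentz_pos:
  assumes "lorentz v v > 0" "lorentz x v > 0" "lorentz x x \<ge> 0" "fst x > 0"
  shows "fst v > 0"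
proof (rule ccontr)
  assume "\<not> ?thesis"
  moreover have "fst v \<noteq> 0"
  proof
    assume "fst v = 0"
    then have "lorentz v v \<le> 0" by (simp add: lorentz_def)
    with assms(1) show False by simp
  qed
  ultimately have "fst (- v) > 0" by simp
  moreover have "lorentz (- v) (- v) > 0" using assms(1) by (simp add: lorentz_def)
  ultimately have "lorentz (- v) x > 0" using assms by (intro lorentz_pos[of "- v" x])
  with assms(2) show False by (simp add: lorentz_def inner_commute mult.commute)
qed

lemma hypI_pos:
  assumes "v \<in> lorentz_space I" "lorentz v v = 1" "x \<in> hyp J" "lorentz x v > 0"
  shows "v \<in> hyp I"
  using assms fst_pos_of_lorentz_pos[of v x] by (auto simp: hyp_def)

lemma cosh_hdist:
  assumes "x \<in> hyp I" "y \<in> hyp I"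
  shows "cosh (hdist x y) = lorentz x y"
  using hyp_lorentz_ge_1[OF assms] by (simp add: hdist_def)

lemma hdist_eq_iff:
  assumes "x \<in> hyp I" "y \<in> hyp I" "x' \<in> hyp J" "y' \<in> hyp J"
  shows "hdist x y = hdist x' y' \<longleftrightarrow> lorentz x y = lorentz x' y'"
  by (metis assms cosh_hdist hdist_def)

lemma hdist_eq_abs_iff:
  assumes "x \<in> hyp I" "y \<in> hyp I"
  shows "hdist x y = \<bar>t\<bar> \<longleftrightarrow> lorentz x y = cosh t"
proof
  assume "hdist x y = \<bar>t\<bar>"
  then show "lorentz x y = cosh t" using cosh_hdist[OF assms] by simp
next
  assume "lorentz x y = cosh t"
  then have "lorentz x y = cosh \<bar>t\<bar>" by simp
  then show "hdist x y = \<bar>t\<bar>" by (simp only: hdist_def) (simp add: arcosh_cosh_real del: cosh_real_abs)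
qed

lemma span_hyp: "span (hyp I) = lorentz_space I"
proof
  show "span (hyp I) \<subseteq> lorentz_space I"
    by (intro span_minimal subspace_lorentz_space) (auto dest: hypD)
  show "lorentz_space I \<subseteq> span (hyp I)"
  proof
    fix v assume v: "v \<in> lorentz_space I"
    \<comment> \<open>A shift by \<open>t\<close> along the time axis makes any vector future
      timelike, hence a positive multiple of a point of \<open>hyp I\<close>.\<close>
    define t where "t = norm (snd v) + \<bar>fst v\<bar> + 1"
    let ?w = "v + t *\<^sub>R base_point"
    have w: "norm (snd v) < fst ?w" by (simp add: t_def)
    have w0: "fst ?w > 0" using le_less_trans[OF norm_ge_zero w] .
    have "(norm (snd v))\<^sup>2 < (fst ?w)\<^sup>2" using w by (intro power_strict_mono) auto
    then have ww: "lorentz ?w ?w > 0"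
      by (simp add: lorentz_self)
    have wL: "?w \<in> lorentz_space I"
      using v base_point_hyp[of I]
      by (intro subspace_add subspace_mul subspace_lorentz_space) (auto dest: hypD)
    have "(1 / sqrt (lorentz ?w ?w)) *\<^sub>R ?w \<in> span (hyp I)"
      using hyp_normalize[OF wL ww w0] by (rule span_base)
    then have "sqrt (lorentz ?w ?w) *\<^sub>R ((1 / sqrt (lorentz ?w ?w)) *\<^sub>R ?w) \<in> span (hyp I)"
      by (rule span_mul)
    then have "?w \<in> span (hyp I)" using ww by simp
    moreover have "t *\<^sub>R base_point \<in> span (hyp I)"
      using base_point_hyp by (intro span_mul span_base)
    ultimately have "?w - t *\<^sub>R base_point \<in> span (hyp I)" by (rule span_diff)
    then show "v \<in> span (hyp I)" by (simp only: add_diff_cancel_right')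
  qed
qed

text \<open>The reflection of a timelike unit vector \<open>q\<close> turns the Lorentz form into the positive
  definite form \<open>2 * (lorentz v q)\<^sup>2 - lorentz v v\<close>. The Cauchy-Schwarz inequality for this form
  against the reflected base point bounds the coordinate \<open>fst v\<close>.\<close>

lemma norm_le_timelike_form:
  assumes q: "lorentz q q = 1"
  shows "(norm v)\<^sup>2 \<le> (4 * (fst q)\<^sup>2 - 1) * (2 * (lorentz v q)\<^sup>2 - lorentz v v)"
proof -
  define N where "N v = 2 * (lorentz v q)\<^sup>2 - lorentz v v" for v
  have Nnn: "0 \<le> N v" for v
    using lorentz_reverse_Cauchy_Schwarz(1)[OF q, of v] zero_le_power2[of "lorentz v q"]
    unfolding N_def by linarith
  define m where "m = 2 * (fst q)\<^sup>2 - 1"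
  have "1 \<le> (fst q)\<^sup>2"
    using q zero_le_power2[of "norm (snd q)"] unfolding lorentz_self by linarith
  then have m: "m > 0" by (simp add: m_def)
  \<comment> \<open>\<open>w\<close> is the reflected base point: the bilinear form polarising
    \<open>N\<close> pairs \<open>v\<close> with \<open>w\<close> to \<open>fst v\<close>, and
    \<open>N w = m\<close>. The coefficient \<open>s\<close> is the one that minimises
    \<open>N (v - s w)\<close>.\<close>
  define w where "w = (2 * fst q) *\<^sub>R q - base_point"
  define s where "s = fst v / m"
  have wq: "lorentz w q = fst q" using q by (simp add: w_def lorentz_simps)
  have ww: "lorentz w w = 1"
    using q by (simp add: w_def lorentz_simps algebra_simps)
  have vw: "lorentz v w = 2 * fst q * lorentz v q - fst v"
    by (simp add: w_def lorentz_simps)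
  have "0 \<le> N (v - s *\<^sub>R w)" by (rule Nnn)
  also have "N (v - s *\<^sub>R w) = N v - 2 * s * fst v + s\<^sup>2 * m"
    unfolding N_def by (simp add: lorentz_simps wq ww vw lorentz_commute[of w v] m_def
        power2_eq_square algebra_simps)
  also have "\<dots> = N v - (fst v)\<^sup>2 / m"
    using m by (simp add: s_def power2_eq_square field_simps)
  finally have "(fst v)\<^sup>2 \<le> m * N v" using m by (simp add: field_simps)
  moreover have "- lorentz v v \<le> N v" by (simp add: N_def)
  ultimately have "(norm v)\<^sup>2 \<le> 2 * (m * N v) + N v" unfolding norm_lorentz by linarith
  then show ?thesis by (simp add: m_def N_def[symmetric] algebra_simps)
qed

section \<open>Geodesics\<close>

lemma geodesic_points:
  fixes x u :: "real \<times> 'i ell2"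
  assumes "lorentz x x = 1" "lorentz u u = - 1" "lorentz x u = 0"
  shows "lorentz (cosh s *\<^sub>R x + sinh s *\<^sub>R u) (cosh t *\<^sub>R x + sinh t *\<^sub>R u) = cosh (s - t)"
  using assms by (simp add: lorentz_simps lorentz_commute[of u x] cosh_diff)

lemma geodesic_direction:
  fixes x y :: "real \<times> 'i ell2"
  assumes "lorentz x x = 1" "lorentz y y = 1" "lorentz x y = cosh T" "T \<noteq> 0"
  defines "u \<equiv> (1 / sinh T) *\<^sub>R (y - cosh T *\<^sub>R x)"
  shows "lorentz u u = - 1" "lorentz x u = 0" "cosh T *\<^sub>R x + sinh T *\<^sub>R u = y"
proof -
  have T: "sinh T \<noteq> 0" using assms(4) by simp
  have "lorentz (y - cosh T *\<^sub>R x) (y - cosh T *\<^sub>R x) = - (sinh T)\<^sup>2"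
    using assms(1-3) cosh_square_eq[of T]
    by (simp add: lorentz_simps lorentz_commute[of y x] power2_eq_square)
  then show "lorentz u u = - 1"
    using T by (simp add: u_def lorentz_scaleR_left lorentz_scaleR_right power2_eq_square)
  show "lorentz x u = 0" using assms(1-3) by (simp add: u_def lorentz_simps)
  show "cosh T *\<^sub>R x + sinh T *\<^sub>R u = y" using T by (simp add: u_def)
qed

lemma cosh_diff_commute: "cosh (x - y) = cosh (y - x)" for x y :: real
  by (metis cosh_minus minus_diff_eq)

text \<open>Inside the span, the hyperbola through \<open>c s\<close> and \<open>c t\<close>
  contains a vector \<open>z\<close> with the same products against both as \<open>c r\<close>. Then
  \<open>c r - z\<close> is isotropic and orthogonal to the timelike \<open>c s\<close>, so it
  vanishes.\<close>

lemma geodesic_line_in_span: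
  assumes c: "geodesic_line I c" and st: "s \<noteq> t"
  shows "c r \<in> span {c s, c t}"
proof -
  have ch: "c t \<in> hyp I" for t using c by (simp add: geodesic_line_def)
  have cl: "lorentz (c a) (c b) = cosh (a - b)" for a b
    using c ch by (simp add: geodesic_line_def flip: hdist_eq_abs_iff[OF ch ch])
  define u where "u = (1 / sinh (s - t)) *\<^sub>R (c t - cosh (s - t) *\<^sub>R c s)"
  have st': "s - t \<noteq> 0" using st by simp
  note u = geodesic_direction[OF hypD(2)[OF ch] hypD(2)[OF ch] cl st', folded u_def]
  define z where "z = cosh (s - r) *\<^sub>R c s + sinh (s - r) *\<^sub>R u"
  have zz: "lorentz z z = 1"
    using geodesic_points[OF hypD(2)[OF ch] u(1,2), of "s - r" "s - r"] by (simp add: z_def)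
  have zs: "lorentz z (c s) = cosh (s - r)"
    using u(2) hypD(2)[OF ch] by (simp add: z_def lorentz_simps lorentz_commute)
  have zt: "lorentz z (c t) = cosh (r - t)"
    using geodesic_points[OF hypD(2)[OF ch] u(1,2), of "s - r" "s - t"]
    by (simp add: z_def u(3))
  have uspan: "u \<in> span {c s, c t}"
    unfolding u_def by (intro span_mul span_diff) (auto intro: span_base)
  have zspan: "z \<in> span {c s, c t}"
    unfolding z_def by (intro span_add span_mul uspan) (auto intro: span_base)
  have "lorentz (c r - z) w = 0" if "w \<in> span {c s, c t}" for w
    using that
  proof (induction rule: span_induct_alt)
    case (step a x y)
    have "lorentz (c r - z) x = 0"
      using step(1) zs zt cl[of r s] cl[of r t] cosh_diff_commute[of r s]
      by (auto simp: lorentz_diff_left)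
    then show ?case using step by (simp add: lorentz_simps)
  qed simp
  from this[OF zspan] have "lorentz (c r) z = 1" by (simp add: lorentz_diff_left zz)
  then have "lorentz (c r - z) (c r - z) = 0"
    using hypD(2)[OF ch] zz by (simp add: lorentz_simps lorentz_commute)
  moreover have "lorentz (c s) (c r - z) = 0"
    using \<open>\<And>w. w \<in> span {c s, c t} \<Longrightarrow> lorentz (c r - z) w = 0\<close>[of "c s"]
    by (simp add: lorentz_commute span_base)
  ultimately have "c r - z = 0"
    using lorentz_orthogonal(2)[of "c s" "c r - z"] hypD(2)[OF ch] by simp
  with zspan show ?thesis by simp
qed

lemma geodesic_line_through:
  assumes x: "x \<in> hyp I" and y: "y \<in> hyp I" and xy: "x \<noteq> y"
  obtains c s t where "geodesic_line I c" "s \<noteq> t" "c s = x" "c t = y"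
    "hyp I \<inter> span {x, y} \<subseteq> range c"
proof -
  define T where "T = hdist x y"
  have T: "lorentz x y = cosh T" using cosh_hdist[OF x y] by (simp add: T_def)
  have T0: "T \<noteq> 0"
  proof
    assume "T = 0"
    then have "lorentz x y = 1" using T by simp
    with xy hyp_lorentz_eq_1[OF x y] show False by simp
  qed
  define u where "u = (1 / sinh T) *\<^sub>R (y - cosh T *\<^sub>R x)"
  note u = geodesic_direction[OF hypD(2)[OF x] hypD(2)[OF y] T T0, folded u_def]
  have uL: "u \<in> lorentz_space I"
    unfolding u_def using x y
    by (intro subspace_mul subspace_diff subspace_lorentz_space) (auto dest: hypD)
  define c where "c t = cosh t *\<^sub>R x + sinh t *\<^sub>R u" for t
  have cl: "lorentz (c s) (c t) = cosh (s - t)" for s t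
    unfolding c_def by (rule geodesic_points[OF hypD(2)[OF x] u(1,2)])
  have ch: "c t \<in> hyp I" for t
  proof (rule hypI_pos[OF _ _ x])
    show "c t \<in> lorentz_space I"
      unfolding c_def using x uL
      by (intro subspace_add subspace_mul subspace_lorentz_space) (auto dest: hypD)
    show "lorentz (c t) (c t) = 1" using cl[of t t] by simp
    show "lorentz x (c t) > 0"
      using cl[of 0 t] by (simp add: c_def)
  qed
  show ?thesis
  proof (rule that)
    show "geodesic_line I c"
      using ch cl by (simp add: geodesic_line_def hdist_eq_abs_iff[OF ch ch])
    show "0 \<noteq> T" "c 0 = x" "c T = y" using T0 u(3) by (auto simp: c_def)
    show "hyp I \<inter> span {x, y} \<subseteq> range c"
    proof
      fix z assume z: "z \<in> hyp I \<inter> span {x, y}"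
      then obtain a b where "z = a *\<^sub>R x + b *\<^sub>R y"
        unfolding span_insert span_empty by (auto simp: algebra_simps eq_diff_eq)
      also have "\<dots> = (a + b * cosh T) *\<^sub>R x + (b * sinh T) *\<^sub>R u"
        using u(3) by (metis (no_types, lifting) add.assoc scaleR_add_left scaleR_add_right
            scaleR_scaleR)
      finally obtain p q where zpq: "z = p *\<^sub>R x + q *\<^sub>R u" by blast
      have "lorentz x z = p"
        using u(2) hypD(2)[OF x] by (simp add: zpq lorentz_simps)
      \<comment> \<open>The bound \<open>p >= 1\<close> selects the branch of the hyperbola
        \<open>p^2 - q^2 = 1\<close> along which \<open>c\<close> runs.\<close>
      then have p: "p \<ge> 1" using hyp_lorentz_ge_1[OF x, of z] z by simp
      have "lorentz z z = p * p - q * q"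
        using u hypD(2)[OF x] by (simp add: zpq lorentz_simps lorentz_commute)
      then have "p\<^sup>2 = 1 + q\<^sup>2" using z hypD(2)[of z I] by (simp add: power2_eq_square)
      define t where "t = arsinh q"
      have sq: "sinh t = q" by (simp add: t_def)
      have "(cosh t)\<^sup>2 = p\<^sup>2" using sq \<open>p\<^sup>2 = 1 + q\<^sup>2\<close> by (simp add: cosh_square_eq)
      then have "cosh t = p" using p cosh_real_pos[of t] by (simp add: power2_eq_iff_nonneg)
      with sq have "z = c t" by (simp add: c_def zpq)
      then show "z \<in> range c" by blast
    qed
  qed
qed

section \<open>Totally geodesic subspaces and totality\<close>

text \<open>For distinct points this is the definition applied to the line through them.
  \<open>span {x}\<close> meets the hyperboloid sheet in \<open>x\<close> alone, which settles
  \<open>x = y\<close>, a case about which the definition says nothing.\<close>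

lemma totally_geodesic_pair:
  assumes S: "totally_geodesic I S" and xy: "x \<in> S" "y \<in> S" and z: "z \<in> hyp I" "z \<in> span {x, y}"
  shows "z \<in> S"
proof (cases "x = y")
  case True
  have x: "x \<in> hyp I" using S xy by (auto simp: totally_geodesic_def)
  obtain k where k: "z = k *\<^sub>R x" using z(2) True by (auto simp: span_singleton)
  have "lorentz x z = k" using hypD(2)[OF x] by (simp add: k lorentz_simps)
  then have "k > 0" using hyp_lorentz_ge_1[OF x z(1)] by simp
  moreover have "k\<^sup>2 = 1"
    using hypD(2)[OF x] hypD(2)[OF z(1)] by (simp add: k lorentz_simps power2_eq_square)
  ultimately have "k = 1" by (simp add: power2_eq_1_iff)
  then show ?thesis using k xy by simp
next
  case False
  have "x \<in> hyp I" "y \<in> hyp I" using S xy by (auto simp: totally_geodesic_def)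
  from geodesic_line_through[OF this False] obtain c s t where c: "geodesic_line I c" "s \<noteq> t"
    "c s = x" "c t = y" "hyp I \<inter> span {x, y} \<subseteq> range c" by metis
  then have "range c \<subseteq> S" using S xy unfolding totally_geodesic_def by blast
  with c(5) z show ?thesis by blast
qed

lemma totally_geodesic_subspace:
  assumes "subspace L"
  shows "totally_geodesic I (L \<inter> hyp I)"
  unfolding totally_geodesic_def
proof (intro conjI allI impI)
  fix c s t assume c: "geodesic_line I c \<and> s \<noteq> t \<and> c s \<in> L \<inter> hyp I \<and> c t \<in> L \<inter> hyp I"
  then have "span {c s, c t} \<subseteq> L" using assms by (intro span_minimal) auto
  then have "c r \<in> L" for r using geodesic_line_in_span c by blast
  moreover have "c r \<in> hyp I" for r using c by (simp add: geodesic_line_def)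
  ultimately show "range c \<subseteq> L \<inter> hyp I" by blast
qed simp

text \<open>The cone over a totally geodesic subset is closed under addition, so that its span consists
  of differences of two of its elements.\<close>

lemma span_totally_geodesic:
  assumes S: "totally_geodesic I S"
  shows "span S \<inter> hyp I \<subseteq> S"
proof (cases "S = {}")
  case True
  then show ?thesis using hypD(2)[of 0 I] by auto
next
  case False
  then obtain o' where o': "o' \<in> S" by blast
  have SI: "S \<subseteq> hyp I" using S by (simp add: totally_geodesic_def)
  define C where "C = {t *\<^sub>R x |t x. t > 0 \<and> x \<in> S}"
  have SC: "x \<in> C" if "x \<in> S" for x
    using that unfolding C_def by (intro CollectI exI[of _ 1] exI[of _ x]) simp
  have Cs: "t *\<^sub>R a \<in> C" if "a \<in> C" "t > 0" for a t
  proof -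
    from \<open>a \<in> C\<close> obtain s x where "a = s *\<^sub>R x" "s > 0" "x \<in> S" unfolding C_def by blast
    then show ?thesis using \<open>t > 0\<close>
      unfolding C_def by (intro CollectI exI[of _ "t * s"] exI[of _ x] conjI) simp_all
  qed
  have Cadd: "a + b \<in> C" if "a \<in> C" "b \<in> C" for a b
  proof -
    from that obtain s x t y where a: "a = s *\<^sub>R x" "s > 0" "x \<in> S"
      and b: "b = t *\<^sub>R y" "t > 0" "y \<in> S" unfolding C_def by blast
    have x: "x \<in> hyp I" and y: "y \<in> hyp I" using SI a b by auto
    have xy: "lorentz x y > 0" using hyp_lorentz_ge_1[OF x y] by simp
    define v where "v = a + b"
    have "lorentz v v = s * s + t * t + 2 * (s * t * lorentz x y)"
      unfolding v_def a(1) b(1) using hypD(2)[OF x] hypD(2)[OF y]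
      by (simp add: lorentz_simps lorentz_commute[of y x] algebra_simps)
    moreover have "s * t * lorentz x y > 0" using a b xy by simp
    ultimately have vv: "lorentz v v > 0" using mult_pos_pos[OF a(2) a(2)] zero_le_square[of t]
      by linarith
    have "fst v > 0" using a b hypD(3)[OF x] hypD(3)[OF y] by (simp add: v_def add_pos_pos)
    moreover have "v \<in> lorentz_space I" unfolding v_def a(1) b(1)
      by (intro subspace_add[OF subspace_lorentz_space] subspace_mul[OF subspace_lorentz_space]
          hypD(1)[OF x] hypD(1)[OF y])
    ultimately have h: "(1 / sqrt (lorentz v v)) *\<^sub>R v \<in> hyp I" using vv by (intro hyp_normalize)
    have "(1 / sqrt (lorentz v v)) *\<^sub>R v \<in> span {x, y}"
      unfolding v_def a(1) b(1) by (intro span_mul span_add) (auto intro: span_base span_mul)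
    with h have "(1 / sqrt (lorentz v v)) *\<^sub>R v \<in> S"
      using totally_geodesic_pair[OF S a(3) b(3)] by blast
    then have "sqrt (lorentz v v) *\<^sub>R (1 / sqrt (lorentz v v)) *\<^sub>R v \<in> C"
      using vv by (intro Cs SC) auto
    then show ?thesis using vv by (simp add: v_def)
  qed
  define D where "D = {a - b |a b. a \<in> C \<and> b \<in> C}"
  have DI: "a - b \<in> D" if "a \<in> C" "b \<in> C" for a b using that unfolding D_def by blast
  have D: "subspace D"
    unfolding subspace_def
  proof (intro conjI ballI allI)
    show "0 \<in> D" using DI[OF SC[OF o'] SC[OF o']] by simp
  next
    fix u v assume "u \<in> D" "v \<in> D"
    then obtain a b a' b' where uv: "u = a - b" "v = a' - b'"
      and "a \<in> C" "b \<in> C" "a' \<in> C" "b' \<in> C"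
      unfolding D_def by blast
    then have "(a + a') - (b + b') \<in> D" by (intro DI Cadd)
    then show "u + v \<in> D" by (simp only: uv add_diff_add)
  next
    fix c :: real and u assume "u \<in> D"
    then obtain a b where u: "u = a - b" "a \<in> C" "b \<in> C" unfolding D_def by blast
    consider "c = 0" | "c > 0" | "c < 0" by linarith
    then show "c *\<^sub>R u \<in> D"
    proof cases
      case 1
      then show ?thesis using DI[OF SC[OF o'] SC[OF o']] by simp
    next
      case 2
      then show ?thesis using DI[OF Cs[of a c] Cs[of b c]] u by (simp add: scaleR_diff_right)
    next
      case 3
      then show ?thesis using DI[OF Cs[of b "- c"] Cs[of a "- c"]] u
        by (simp add: scaleR_diff_right)
    qed
  qed
  \<comment> \<open>Written as \<open>2 x - x\<close>, a point of \<open>S\<close> is a difference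
    of two elements of the cone.\<close>
  have "x \<in> D" if "x \<in> S" for x
    using DI[OF Cs[OF SC[OF that], of 2] SC[OF that]] by (simp add: scaleR_2)
  with D have "span S \<subseteq> D" by (intro span_minimal) auto
  moreover have "v \<in> S" if v: "v \<in> D" "v \<in> hyp I" for v
  proof -
    from v(1) obtain s x t y where "v = s *\<^sub>R x - t *\<^sub>R y" and xy: "x \<in> S" "y \<in> S"
      unfolding D_def C_def by blast
    then have "v \<in> span {x, y}" by (auto intro: span_diff span_mul span_base)
    then show ?thesis using totally_geodesic_pair[OF S xy v(2)] by blast
  qed
  ultimately show ?thesis by blast
qed

text \<open>Vectors of \<open>span S\<close> near a point \<open>x\<close> of \<open>hyp I\<close>
  are future timelike, and their normalisations lie in \<open>S\<close> by
  \<open>span_totally_geodesic\<close>. Their product with \<open>x\<close> tends to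
  \<open>1\<close>, so their distance to \<open>x\<close> tends to \<open>0\<close>.\<close>

lemma closure_span_totally_geodesic:
  assumes S: "totally_geodesic I S" and cl: "hyp_closed I S"
  shows "closure (span S) \<inter> hyp I \<subseteq> S"
proof
  fix x assume x: "x \<in> closure (span S) \<inter> hyp I"
  then have "x \<in> closure (span S)" by blast
  then obtain v where v: "\<And>n. v n \<in> span S" and vx: "v \<longlonglongrightarrow> x"
    unfolding closure_sequential by blast
  have xh: "x \<in> hyp I" using x by simp
  have "(\<lambda>n. lorentz (v n) (v n)) \<longlonglongrightarrow> lorentz x x" by (intro tendsto_intros vx)
  then have l1: "(\<lambda>n. lorentz (v n) (v n)) \<longlonglongrightarrow> 1" using hypD(2)[OF xh] by simp
  have e1: "\<forall>\<^sub>F n in sequentially. lorentz (v n) (v n) > 0"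
    using order_tendstoD(1)[OF l1, of 0] by simp
  have e2: "\<forall>\<^sub>F n in sequentially. fst (v n) > 0"
    using order_tendstoD(1)[OF tendsto_fst[OF vx], of 0] hypD(3)[OF xh] by simp
  define w where "w n = (1 / sqrt (lorentz (v n) (v n))) *\<^sub>R v n" for n
  have SL: "span S \<subseteq> lorentz_space I"
    using S by (intro span_minimal subspace_lorentz_space) (auto simp: totally_geodesic_def dest: hypD)
  have e3: "\<forall>\<^sub>F n in sequentially. w n \<in> S"
    using e1 e2
  proof eventually_elim
    case (elim n)
    then have "w n \<in> hyp I" unfolding w_def using SL v by (intro hyp_normalize) auto
    moreover have "w n \<in> span S" unfolding w_def using v by (intro span_mul)
    ultimately show ?case using span_totally_geodesic[OF S] by blast
  qed
  have "(\<lambda>n. lorentz x (w n)) \<longlonglongrightarrow> lorentz x ((1 / sqrt 1) *\<^sub>R x)"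
    unfolding w_def by (intro tendsto_intros vx l1) simp
  then have lw: "(\<lambda>n. lorentz x (w n)) \<longlonglongrightarrow> 1" using hypD(2)[OF xh] by simp
  have "\<exists>y\<in>S. hdist x y < e" if e: "e > 0" for e
  proof -
    have "1 < cosh e" using cosh_real_strict_mono[of 0 e] e by simp
    then have "\<forall>\<^sub>F n in sequentially. lorentz x (w n) < cosh e" by (rule order_tendstoD(2)[OF lw])
    from eventually_conj[OF e3 this] obtain n where n: "w n \<in> S" "lorentz x (w n) < cosh e"
      using eventually_happens' sequentially_bot by blast
    have "w n \<in> hyp I" using n S by (auto simp: totally_geodesic_def)
    then have "cosh (hdist x (w n)) < cosh e" using n cosh_hdist[OF xh] by simp
    moreover have "0 \<le> hdist x (w n)"
      unfolding hdist_def using hyp_lorentz_ge_1[OF xh \<open>w n \<in> hyp I\<close>] by simp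
    ultimately have "hdist x (w n) < e" using e by (simp add: cosh_real_nonneg_less_iff)
    with n show ?thesis by blast
  qed
  with cl xh show "x \<in> S" by (auto simp: hyp_closed_def)
qed

text \<open>Hyperbolic convergence has to be turned into norm convergence. The bound
  \<open>norm_le_timelike_form\<close> with \<open>q = x\<close> does this, since its right-hand
  side for \<open>y n - x\<close> is governed by \<open>lorentz x (y n)\<close> alone.\<close>

lemma hyp_closed_subspace:
  assumes L: "subspace L" "closed L"
  shows "hyp_closed I (L \<inter> hyp I)"
  unfolding hyp_closed_def
proof (intro conjI ballI impI)
  fix x assume xh: "x \<in> hyp I" and ex: "\<forall>e>0. \<exists>y\<in>L \<inter> hyp I. hdist x y < e"
  have "\<exists>y\<in>L \<inter> hyp I. hdist x y < inverse (real (Suc n))" for n using ex by simp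
  then obtain y where y: "\<And>n. y n \<in> L \<inter> hyp I" "\<And>n. hdist x (y n) < inverse (real (Suc n))"
    by metis
  have nn: "0 \<le> hdist x (y n)" for n
    unfolding hdist_def using hyp_lorentz_ge_1[OF xh, of "y n"] y(1) by simp
  have "(\<lambda>n. hdist x (y n)) \<longlonglongrightarrow> 0"
    by (rule tendsto_sandwich[OF _ _ tendsto_const LIMSEQ_inverse_real_of_nat])
      (use nn y(2) in \<open>auto intro!: eventuallyI less_imp_le\<close>)
  then have "(\<lambda>n. cosh (hdist x (y n))) \<longlonglongrightarrow> cosh 0" by (intro tendsto_intros)
  then have l: "(\<lambda>n. lorentz x (y n)) \<longlonglongrightarrow> 1" using cosh_hdist[OF xh] y(1) by simp
  define C where "C = 4 * (fst x)\<^sup>2 - 1"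
  define B where "B n = C * (2 * (lorentz x (y n) - 1)\<^sup>2 - (2 - 2 * lorentz x (y n)))" for n
  have bound: "(norm (y n - x))\<^sup>2 \<le> B n" for n
    using norm_le_timelike_form[OF hypD(2)[OF xh], of "y n - x"] hypD(2)[OF xh]
      hypD(2)[of "y n" I] y(1)[of n]
    by (simp add: B_def C_def lorentz_simps lorentz_commute[of "y n" x])
  have "B \<longlonglongrightarrow> C * (2 * (1 - 1)\<^sup>2 - (2 - 2 * 1))"
    unfolding B_def by (intro tendsto_intros l)
  then have "B \<longlonglongrightarrow> 0" by simp
  then have "(\<lambda>n. (norm (y n - x))\<^sup>2) \<longlonglongrightarrow> 0"
    by (rule Lim_null_comparison[rotated]) (simp add: bound)
  from tendsto_real_sqrt[OF this] have "(\<lambda>n. norm (y n - x)) \<longlonglongrightarrow> 0" by simp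
  then have "y \<longlonglongrightarrow> x" by (simp add: LIM_zero_iff tendsto_norm_zero_iff)
  then show "x \<in> L \<inter> hyp I" using closed_sequentially[OF L(2)] y(1) xh by blast
qed simp

section \<open>Lines in the projective topology\<close>

lemma topspace_proj_topology: "topspace proj_topology = {span {v} |v. v \<noteq> 0}"
proof -
  define P :: "(real \<times> 'a ell2) set set" where "P = {span {v} |v. v \<noteq> 0}"
  have "span {v} \<in> P" if "v \<noteq> 0" for v using that unfolding P_def by blast
  then have "{v. v \<noteq> 0 \<and> span {v} \<in> P} = - {0}" by blast
  then have "openin proj_topology P"
    unfolding openin_proj_topology P_def[symmetric] by (simp add: open_Compl)
  moreover have "U \<subseteq> P" if "openin proj_topology U" for U
    using that unfolding openin_proj_topology P_def by (rule conjunct1)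
  ultimately have "topspace proj_topology = P" unfolding topspace_def by blast
  then show ?thesis by (simp only: P_def)
qed

lemma span_scaleR: "c \<noteq> 0 \<Longrightarrow> span {c *\<^sub>R v} = span {v :: 'a::real_vector}"
  using span_image_scale[of "{v}" "\<lambda>_. c"] by simp

lemma span_singleton_eq:
  assumes "span {u} = span {v}"
  obtains k where "u = k *\<^sub>R v" 
proof -
  have "u \<in> span {v}" using assms by (metis insertI1 span_base)
  then show ?thesis using that by (auto simp: span_singleton)
qed

lemma span_fst_normalize:
  assumes "span {u} = span {v}" "fst u \<noteq> 0"
  shows "fst v \<noteq> 0" "u /\<^sub>R fst u = v /\<^sub>R fst v"
proof -
  obtain k where k: "u = k *\<^sub>R v" using span_singleton_eq[OF assms(1)] by blast
  then have "k \<noteq> 0" "fst v \<noteq> 0" using assms(2) by auto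
  then show "fst v \<noteq> 0" "u /\<^sub>R fst u = v /\<^sub>R fst v" using k by auto
qed

text \<open>Normalising to first coordinate \<open>1\<close> is an affine chart of the projective
  space, so convergence of lines becomes norm convergence. The chart contains all points of
  \<open>hyp I\<close> and, by \<open>iso_rep_span\<close>, all isotropic lines.\<close>

lemma limitin_proj_topology:
  assumes x: "\<And>n. fst (x n) \<noteq> 0" and v: "fst v \<noteq> 0"
  shows "limitin proj_topology (\<lambda>n. span {x n}) (span {v}) sequentially \<longleftrightarrow>
    (\<lambda>n. x n /\<^sub>R fst (x n)) \<longlonglongrightarrow> v /\<^sub>R fst v"
proof
  assume lim: "limitin proj_topology (\<lambda>n. span {x n}) (span {v}) sequentially"
  show "(\<lambda>n. x n /\<^sub>R fst (x n)) \<longlonglongrightarrow> v /\<^sub>R fst v"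
    unfolding tendsto_iff
  proof (intro allI impI)
    fix e :: real assume e: "e > 0"
    \<comment> \<open>Being invariant under nonzero scaling, \<open>W\<close> is the full preimage
      of its set of lines, so that set is open in the quotient topology.\<close>
    define W where "W = {u :: real \<times> 'a ell2. fst u \<noteq> 0} \<inter> {u. u /\<^sub>R fst u \<in> ball (v /\<^sub>R fst v) e}"
    have o1: "open {u :: real \<times> 'a ell2. fst u \<noteq> 0}"
      by (intro open_Collect_neq continuous_on_fst continuous_on_id continuous_on_const)
    have "continuous_on {u :: real \<times> 'a ell2. fst u \<noteq> 0} (\<lambda>u. u /\<^sub>R fst u)"
      by (intro continuous_on_scaleR continuous_on_inverse continuous_on_fst continuous_on_id) auto
    then have W: "open W"
      using continuous_open_preimage[OF _ o1 open_ball[of "v /\<^sub>R fst v" e]]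
      by (simp add: W_def vimage_def)
    define U where "U = (\<lambda>u. span {u}) ` W"
    have WU: "u \<in> W" if u: "span {u} \<in> U" for u
    proof -
      from u obtain u' where u': "span {u} = span {u'}" "u' \<in> W"
        unfolding U_def by (rule imageE)
      then have "fst u' \<noteq> 0" by (simp add: W_def)
      from span_fst_normalize[OF u'(1)[symmetric] this] u'(2) show ?thesis by (simp add: W_def)
    qed
    have "{u. u \<noteq> 0 \<and> span {u} \<in> U} = W"
    proof (intro equalityI subsetI)
      fix u assume "u \<in> W"
      then have "fst u \<noteq> 0" "span {u} \<in> U" unfolding W_def U_def by blast+
      then show "u \<in> {u. u \<noteq> 0 \<and> span {u} \<in> U}" by auto
    qed (use WU in auto)
    moreover have "U \<subseteq> {span {v} |v. v \<noteq> 0}"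
    proof
      fix l assume "l \<in> U"
      then obtain u where "l = span {u}" "u \<in> W" unfolding U_def by blast
      moreover from this have "u \<noteq> 0" by (auto simp: W_def)
      ultimately show "l \<in> {span {v} |v. v \<noteq> 0}" by blast
    qed
    ultimately have "openin proj_topology U" using W by (simp add: openin_proj_topology)
    moreover have "span {v} \<in> U"
      unfolding U_def using v e by (intro imageI) (simp add: W_def)
    ultimately have "\<forall>\<^sub>F n in sequentially. span {x n} \<in> U"
      using lim by (simp add: limitin_def)
    then show "\<forall>\<^sub>F n in sequentially. dist (x n /\<^sub>R fst (x n)) (v /\<^sub>R fst v) < e"
    proof eventually_elim
      case (elim n)
      then have "x n \<in> W" by (rule WU)
      then show ?case by (simp add: W_def dist_commute)
    qed
  qed
next
  assume lim: "(\<lambda>n. x n /\<^sub>R fst (x n)) \<longlonglongrightarrow> v /\<^sub>R fst v"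
  have sp: "span {u /\<^sub>R fst u} = span {u}" if "fst u \<noteq> 0" for u :: "real \<times> 'a ell2"
    using that by (intro span_scaleR) simp
  show "limitin proj_topology (\<lambda>n. span {x n}) (span {v}) sequentially"
    unfolding limitin_def
  proof (intro conjI allI impI)
    have "v \<noteq> 0" using v by auto
    then show "span {v} \<in> topspace proj_topology" unfolding topspace_proj_topology by blast
  next
    fix U assume U: "openin proj_topology U \<and> span {v} \<in> U"
    define W where "W = {u. u \<noteq> 0 \<and> span {u} \<in> U}"
    have "open W" using U by (simp add: openin_proj_topology W_def)
    moreover have "v /\<^sub>R fst v \<in> W" using U v sp[OF v] by (auto simp: W_def)
    ultimately have "\<forall>\<^sub>F n in sequentially. x n /\<^sub>R fst (x n) \<in> W" using lim
      by (simp add: topological_tendstoD)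
    then show "\<forall>\<^sub>F n in sequentially. span {x n} \<in> U"
      by eventually_elim (simp add: W_def sp[OF x])
  qed
qed

text \<open>The complement of a closed subspace is open and invariant under nonzero scaling, so the
  lines outside \<open>L\<close> form an open set of lines that misses those of
  \<open>S\<close>.\<close>

lemma proj_closure_subspace:
  assumes L: "subspace L" "closed L" "S \<subseteq> L" and v: "v \<noteq> 0"
    and cl: "span {v} \<in> proj_topology closure_of ((\<lambda>x. span {x}) ` S)"
  shows "v \<in> L"
proof (rule ccontr)
  assume nv: "v \<notin> L"
  define U where "U = {span {u} |u. u \<notin> L}"
  have L0: "0 \<in> L" using L(1) by (rule subspace_0)
  have UL: "u \<notin> L" if u: "span {u} \<in> U" for u
  proof
    assume "u \<in> L"
    then have "span {u} \<subseteq> L" using L(1) by (intro span_minimal) auto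
    moreover from u obtain u' where "span {u} = span {u'}" "u' \<notin> L" unfolding U_def by blast
    ultimately show False using span_base[of u' "{u'}"] by auto
  qed
  have "{u. u \<noteq> 0 \<and> span {u} \<in> U} = - L"
    using UL L0 unfolding U_def by blast
  moreover have "U \<subseteq> {span {v} |v. v \<noteq> 0}" using L0 unfolding U_def by blast
  ultimately have "openin proj_topology U"
    using L(2) by (simp add: openin_proj_topology open_Compl)
  moreover have "span {v} \<in> U" using nv unfolding U_def by blast
  ultimately obtain s where "s \<in> S" "span {s} \<in> U"
    using cl unfolding in_closure_of by blast
  with UL L(3) show False by blast
qed

text \<open>If all lines lie in the boundary of a closed totally geodesic \<open>S\<close>, then the
  closed span of \<open>S\<close> contains every \<open>a y\<close>, hence all of
  \<open>hyp I\<close>; by \<open>closure_span_totally_geodesic\<close>, \<open>S\<close> is then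
  not proper.\<close>

lemma dense_imp_total:
  assumes a: "\<And>y. a y \<in> lorentz_space I" "\<And>y. a y \<noteq> 0" "\<And>y. lorentz (a y) (a y) = 0"
    and dense: "lorentz_space I \<subseteq> closure (span (range a))"
  shows "total I (range (\<lambda>y. span {a y}))"
  unfolding total_def
proof (intro conjI notI)
  show "range (\<lambda>y. span {a y}) \<subseteq> boundary I"
    using a unfolding boundary_def by blast
next
  assume "\<exists>S. totally_geodesic I S \<and> hyp_closed I S \<and> S \<noteq> hyp I \<and>
    range (\<lambda>y. span {a y}) \<subseteq> boundary_of I S"
  then obtain S where S: "totally_geodesic I S" "hyp_closed I S" "S \<noteq> hyp I"
    and sub: "range (\<lambda>y. span {a y}) \<subseteq> boundary_of I S" by blast
  let ?L = "closure (span S)"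
  have L: "subspace ?L" "closed ?L" by (simp_all add: subspace_closure)
  have "S \<subseteq> ?L" using span_superset closure_subset by blast
  then have "a y \<in> ?L" for y
    using sub a(2)[of y] by (intro proj_closure_subspace[OF L]) (auto simp: boundary_of_def)
  then have "closure (span (range a)) \<subseteq> ?L"
    using L by (intro closure_minimal span_minimal) auto
  with dense have "hyp I \<subseteq> ?L" by (auto dest: hypD)
  then have "hyp I \<subseteq> S" using closure_span_totally_geodesic[OF S(1,2)] by blast
  moreover have "S \<subseteq> hyp I" using S(1) by (simp add: totally_geodesic_def)
  ultimately show False using S(3) by blast
qed

text \<open>The sum of \<open>a\<close> and a small positive multiple of a second future isotropic
  vector is timelike, and its normalisation tends to the line of \<open>a\<close> while staying in
  \<open>L\<close>.\<close>

lemma boundary_approx: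
  assumes a: "a \<in> L" "lorentz a a = 0" "fst a > 0"
    and b: "b \<in> L" "lorentz b b = 0" "fst b > 0" and ab: "lorentz a b > 0"
    and L: "subspace L" "L \<subseteq> lorentz_space I"
  obtains x where "\<And>n::nat. x n \<in> L \<inter> hyp I"
    "limitin proj_topology (\<lambda>n. span {x n}) (span {a}) sequentially"
proof -
  define z where "z n = a + inverse (real (Suc n)) *\<^sub>R b" for n
  define x where "x n = (1 / sqrt (lorentz (z n) (z n))) *\<^sub>R z n" for n
  have zz: "lorentz (z n) (z n) > 0" for n
    using a b ab by (simp add: z_def lorentz_simps lorentz_commute[of b a])
  have z0: "fst (z n) > 0" for n using a b by (simp add: z_def add_pos_pos)
  have zL: "z n \<in> L" for n
    unfolding z_def using a b by (intro subspace_add[OF L(1)] subspace_mul[OF L(1)])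
  have xh: "x n \<in> L \<inter> hyp I" for n
    unfolding x_def using hyp_normalize[OF subsetD[OF L(2) zL] zz z0] subspace_mul[OF L(1) zL]
    by blast
  have xz: "x n /\<^sub>R fst (x n) = z n /\<^sub>R fst (z n)" for n using zz[of n] by (simp add: x_def inverse_eq_divide)
  have "z \<longlonglongrightarrow> a + 0 *\<^sub>R b"
    unfolding z_def by (intro tendsto_intros LIMSEQ_inverse_real_of_nat)
  then have "z \<longlonglongrightarrow> a" by simp
  then have "(\<lambda>n. z n /\<^sub>R fst (z n)) \<longlonglongrightarrow> a /\<^sub>R fst a"
    using a(3) by (intro tendsto_intros) auto
  moreover have "fst (x n) \<noteq> 0" for n using xh[of n] hypD(3)[of "x n" I] by simp
  ultimately have "limitin proj_topology (\<lambda>n. span {x n}) (span {a}) sequentially"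
    using a(3) by (simp add: limitin_proj_topology xz)
  with xh that show ?thesis by blast
qed

text \<open>Totality is tested on the totally geodesic subspace cut out by the closed span of the
  representatives. The second representative provided by \<open>ab\<close> makes this span contain
  timelike vectors, so each \<open>span {a y}\<close> is a limit of points of the subspace.\<close>

lemma total_imp_dense:
  assumes a: "\<And>y. a y \<in> lorentz_space I" "\<And>y. lorentz (a y) (a y) = 0" "\<And>y. fst (a y) > 0"
    and ab: "\<And>y. \<exists>z. lorentz (a y) (a z) > 0"
    and total: "total I (range (\<lambda>y. span {a y}))"
  shows "closure (span (range a)) = lorentz_space I"
proof -
  let ?L = "closure (span (range a))"
  have L: "subspace ?L" "closed ?L" by (simp_all add: subspace_closure)
  have LI: "?L \<subseteq> lorentz_space I"
    using a(1) by (intro closure_minimal span_minimal closed_lorentz_space subspace_lorentz_space)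
      auto
  have aL: "a y \<in> ?L" for y
    by (rule subsetD[OF closure_subset], rule span_base, rule rangeI)
  have "span {a y} \<in> boundary_of I (?L \<inter> hyp I)" for y
  proof -
    obtain z where z: "lorentz (a y) (a z) > 0" using ab by blast
    obtain x where x: "\<And>n::nat. x n \<in> ?L \<inter> hyp I"
      "limitin proj_topology (\<lambda>n. span {x n}) (span {a y}) sequentially"
      using boundary_approx[OF aL a(2,3) aL a(2,3) z L(1) LI] by metis
    have "span {a y} \<in> proj_topology closure_of ((\<lambda>x. span {x}) ` (?L \<inter> hyp I))"
      unfolding in_closure_of
    proof (intro conjI allI impI)
      show "span {a y} \<in> topspace proj_topology" using x(2) by (simp add: limitin_def)
      fix T assume "span {a y} \<in> T \<and> openin proj_topology T"
      then have "\<forall>\<^sub>F n in sequentially. span {x n} \<in> T" using x(2) by (simp add: limitin_def)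
      then obtain n where "span {x n} \<in> T" using eventually_happens' sequentially_bot by blast
      then show "\<exists>y. y \<in> (\<lambda>x. span {x}) ` (?L \<inter> hyp I) \<and> y \<in> T" using x(1)[of n] by blast
    qed
    moreover have "span {a y} \<in> boundary I"
      using total by (auto simp: total_def)
    ultimately show ?thesis by (simp add: boundary_of_def)
  qed
  then have "range (\<lambda>y. span {a y}) \<subseteq> boundary_of I (?L \<inter> hyp I)" by blast
  then have "?L \<inter> hyp I = hyp I"
    using total totally_geodesic_subspace[OF L(1), of I] hyp_closed_subspace[OF L, of I]
    unfolding total_def by blast
  then have "span (hyp I) \<subseteq> ?L" using L(1) by (intro span_minimal) auto
  then show ?thesis using LI span_hyp by blast
qed

section \<open>Graphs of linear Lorentz isometries\<close>

text \<open>Hyperbolic isometries are extended to linear isometries of the ambient Lorentz spaces. Only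
  the graphs of the latter are used: for these, inverses, linear extensions and closures are
  immediate.\<close>

definition lorentz_graph ::
    "'i set \<Rightarrow> 'j set \<Rightarrow> ((real \<times> 'i ell2) \<times> (real \<times> 'j ell2)) set \<Rightarrow> bool"
  where "lorentz_graph I J G \<longleftrightarrow>
    subspace G \<and> fst ` G = lorentz_space I \<and> snd ` G = lorentz_space J \<and>
    (\<forall>g\<in>G. \<forall>h\<in>G. lorentz (fst g) (fst h) = lorentz (snd g) (snd h))"

lemma abs_lorentz_le: "\<bar>lorentz x y\<bar> \<le> norm x * norm y"
proof -
  have "lorentz x y = inner x (fst y, - snd y)" by (simp add: lorentz_def inner_prod_def)
  moreover have "norm (fst y, - snd y) = norm y" by (simp add: norm_prod_def)
  ultimately show ?thesis using Cauchy_Schwarz_ineq2[of x "(fst y, - snd y)"] by simp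
qed

lemma lorentz_span_preserved:
  assumes S: "\<And>s t. s \<in> S \<Longrightarrow> t \<in> S \<Longrightarrow> lorentz (fst s) (fst t) = lorentz (snd s) (snd t)"
    and g: "g \<in> span S" and h: "h \<in> span S"
  shows "lorentz (fst g) (fst h) = lorentz (snd g) (snd h)"
  using g
proof (induction rule: span_induct_alt)
  case (step c s g)
  have "lorentz (fst s) (fst h) = lorentz (snd s) (snd h)"
    using h
  proof (induction rule: span_induct_alt)
    case (step d t h)
    then show ?case using S[OF \<open>s \<in> S\<close>, of t] by (simp add: lorentz_simps)
  qed simp
  with step.IH show ?case by (simp add: lorentz_simps)
qed simp

text \<open>An indefinite form alone gives no bound on norms. With a timelike unit vector in the
  domain, the positive definite form \<open>2 <v, p>^2 - <v, v>\<close> is preserved; it is at most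
  a multiple of the squared norm on the source and, by \<open>norm_le_timelike_form\<close>, at
  least a multiple of it on the target.\<close>

lemma lorentz_bound:
  assumes G: "subspace G"
    and pres: "\<And>g h. g \<in> G \<Longrightarrow> h \<in> G \<Longrightarrow> lorentz (fst g) (fst h) = lorentz (snd g) (snd h)"
    and q: "q \<in> G" "lorentz (fst q) (fst q) > 0"
  obtains C where "C \<ge> 0" "\<And>g. g \<in> G \<Longrightarrow> norm (snd g) \<le> C * norm (fst g)"
proof -
  define r where "r = 1 / sqrt (lorentz (fst q) (fst q))"
  define p where "p = r *\<^sub>R q"
  have p: "p \<in> G" using q(1) G by (simp add: p_def subspace_mul)
  have "r * r * lorentz (fst q) (fst q) = 1" using q(2) by (simp add: r_def)
  then have p1: "lorentz (fst p) (fst p) = 1" by (simp add: p_def lorentz_simps)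
  then have p2: "lorentz (snd p) (snd p) = 1" using pres[OF p p] by simp
  define M where "M = 4 * (fst (snd p))\<^sup>2 - 1"
  define K where "K = M * (2 * (norm (fst p))\<^sup>2 + 1)"
  have "1 \<le> (fst (snd p))\<^sup>2"
    using p2 zero_le_power2[of "norm (snd (snd p))"] unfolding lorentz_self by linarith
  then have M: "M \<ge> 0" by (simp add: M_def)
  then have K: "K \<ge> 0" by (simp add: K_def)
  have "norm (snd g) \<le> sqrt K * norm (fst g)" if g: "g \<in> G" for g
  proof -
    have "(norm (snd g))\<^sup>2 \<le> M * (2 * (lorentz (snd g) (snd p))\<^sup>2 - lorentz (snd g) (snd g))"
      unfolding M_def by (rule norm_le_timelike_form[OF p2])
    also have "\<dots> = M * (2 * (lorentz (fst g) (fst p))\<^sup>2 - lorentz (fst g) (fst g))"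
      using pres[OF g g] pres[OF g p] by simp
    also have "\<dots> \<le> M * (2 * (norm (fst g) * norm (fst p))\<^sup>2 + norm (fst g) * norm (fst g))"
    proof (rule mult_left_mono[OF _ M])
      have "(lorentz (fst g) (fst p))\<^sup>2 \<le> (norm (fst g) * norm (fst p))\<^sup>2"
        using power_mono[OF abs_lorentz_le[of "fst g" "fst p"], of 2] by simp
      moreover have "- lorentz (fst g) (fst g) \<le> norm (fst g) * norm (fst g)"
        using abs_lorentz_le[of "fst g" "fst g"] by simp
      ultimately show "2 * (lorentz (fst g) (fst p))\<^sup>2 - lorentz (fst g) (fst g)
          \<le> 2 * (norm (fst g) * norm (fst p))\<^sup>2 + norm (fst g) * norm (fst g)" by linarith
    qed
    also have "\<dots> = K * (norm (fst g))\<^sup>2"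
      by (simp add: K_def power2_eq_square algebra_simps)
    finally have "sqrt ((norm (snd g))\<^sup>2) \<le> sqrt (K * (norm (fst g))\<^sup>2)"
      by (rule real_sqrt_le_mono)
    then show ?thesis by (simp add: real_sqrt_mult)
  qed
  with K that show ?thesis by (meson real_sqrt_ge_zero)
qed

lemma lorentz_graphD:
  assumes "lorentz_graph I J G"
  shows "subspace G" "g \<in> G \<Longrightarrow> fst g \<in> lorentz_space I" "g \<in> G \<Longrightarrow> snd g \<in> lorentz_space J"
    "g \<in> G \<Longrightarrow> h \<in> G \<Longrightarrow> lorentz (fst g) (fst h) = lorentz (snd g) (snd h)"
  using assms unfolding lorentz_graph_def by blast+

lemma lorentz_graph_obtain:
  assumes "lorentz_graph I J G"
  shows "v \<in> lorentz_space I \<Longrightarrow> \<exists>v'. (v, v') \<in> G"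
    and "v' \<in> lorentz_space J \<Longrightarrow> \<exists>v. (v, v') \<in> G"
proof -
  have "fst ` G = lorentz_space I" "snd ` G = lorentz_space J"
    using assms by (simp_all add: lorentz_graph_def)
  then show "v \<in> lorentz_space I \<Longrightarrow> \<exists>v'. (v, v') \<in> G"
    "v' \<in> lorentz_space J \<Longrightarrow> \<exists>v. (v, v') \<in> G"
    by (metis imageE prod.collapse)+
qed

lemma lorentz_graph_converse:
  assumes G: "lorentz_graph I J G"
  shows "lorentz_graph J I (G\<inverse>)"
proof -
  have eq: "G\<inverse> = prod.swap ` G" by auto
  have "subspace (G\<inverse>)"
    unfolding eq
    by (intro linear_subspace_image lorentz_graphD(1)[OF G] linearI) auto
  then show ?thesis
    using G unfolding lorentz_graph_def eq by (auto simp: image_image)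
qed

text \<open>The difference of the two images corresponds to \<open>0\<close>, so it is orthogonal to
  all images, which fill \<open>lorentz_space J\<close>; nondegeneracy finishes.\<close>

lemma lorentz_graph_unique:
  assumes G: "lorentz_graph I J G" and v: "(v, v') \<in> G" "(v, v'') \<in> G"
  shows "v' = v''"
proof -
  have d: "(0, v' - v'') \<in> G"
    using subspace_diff[OF lorentz_graphD(1)[OF G] v] by simp
  have "v' - v'' = 0"
  proof (rule lorentz_nondegenerate)
    show "v' - v'' \<in> lorentz_space J" using lorentz_graphD(3)[OF G d] by simp
    fix w' assume "w' \<in> lorentz_space J"
    then obtain w where "(w, w') \<in> G" using lorentz_graph_obtain(2)[OF G] by blast
    from lorentz_graphD(4)[OF G d this] show "lorentz (v' - v'') w' = 0" by simp
  qed
  then show ?thesis by simp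
qed

lemma lorentz_graph_unique':
  assumes "lorentz_graph I J G" "(v, v') \<in> G" "(w, v') \<in> G"
  shows "v = w"
  using lorentz_graph_unique[OF lorentz_graph_converse[OF assms(1)], of v' v w] assms by simp

text \<open>The base point is a timelike vector in the domain, so \<open>lorentz_bound\<close> makes
  the linear map with graph \<open>G\<close> Lipschitz.\<close>

lemma lorentz_graph_tendsto:
  assumes G: "lorentz_graph I J G" and g: "\<And>n. (v n, v' n) \<in> G" "(l, l') \<in> G"
    and lim: "(v \<longlongrightarrow> l) F"
  shows "(v' \<longlongrightarrow> l') F"
proof -
  have "base_point \<in> lorentz_space I" using base_point_hyp by (rule hypD)
  then obtain q where "(base_point, q) \<in> G" using lorentz_graph_obtain(1)[OF G] by blast
  then obtain C where C: "\<And>g. g \<in> G \<Longrightarrow> norm (snd g) \<le> C * norm (fst g)"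
    using lorentz_bound[OF lorentz_graphD(1,4)[OF G], of "(base_point, q)"]
    by (metis fst_conv lorentz_base_point(1) zero_less_one)
  have "norm (v' n - l') \<le> norm (v n - l) * C" for n
    using C[OF subspace_diff[OF lorentz_graphD(1)[OF G] g(1)[of n] g(2)]]
    by (simp add: mult.commute)
  moreover have "((\<lambda>n. norm (v n - l) * C) \<longlongrightarrow> 0) F"
    using lim by (intro tendsto_mult_left_zero tendsto_norm_zero) (simp add: LIM_zero_iff)
  ultimately have "((\<lambda>n. v' n - l') \<longlongrightarrow> 0) F"
    by (rule Lim_null_comparison[OF eventuallyI])
  then show ?thesis by (simp add: LIM_zero_iff)
qed

text \<open>A linear Lorentz isometry may exchange future and past. One pair \<open>q\<close> that
  is future on both sides excludes this; it may be isotropic, so a pair of boundary representatives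
  serves.\<close>

lemma lorentz_graph_hyp:
  assumes G: "lorentz_graph I J G"
    and q: "q \<in> G" "lorentz (fst q) (fst q) \<ge> 0" "fst (fst q) > 0" "fst (snd q) > 0"
    and x: "x \<in> hyp I" "(x, x') \<in> G"
  shows "x' \<in> hyp J"
proof -
  have xx: "lorentz x' x' = 1"
    using lorentz_graphD(4)[OF G x(2) x(2)] hypD(2)[OF x(1)] by simp
  have "lorentz (fst q) x > 0"
    unfolding lorentz_commute[of "fst q"]
    by (rule lorentz_pos) (use q hypD[OF x(1)] in simp_all)
  then have "lorentz (snd q) x' > 0" using lorentz_graphD(4)[OF G q(1) x(2)] by simp
  then have "fst x' > 0"
    using xx q lorentz_graphD(4)[OF G q(1) q(1)]
    by (intro fst_pos_of_lorentz_pos[of x' "snd q"]) auto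
  then show ?thesis using xx lorentz_graphD(3)[OF G x(2)] by (simp add: hyp_def)
qed

section \<open>Passing between graphs and isometries\<close>

lemma hyp_isometryD:
  assumes "\<phi> \<in> hyp_isometries I J"
  shows "\<phi> \<in> extensional (hyp I)" "bij_betw \<phi> (hyp I) (hyp J)"
    "x \<in> hyp I \<Longrightarrow> \<phi> x \<in> hyp J"
    "x \<in> hyp I \<Longrightarrow> y \<in> hyp I \<Longrightarrow> hdist (\<phi> x) (\<phi> y) = hdist x y"
  using assms by (auto simp: hyp_isometries_def dest: bij_betwE)

text \<open>Surjectivity onto \<open>hyp J\<close> is \<open>lorentz_graph_hyp\<close> for the
  converse graph, with the components of the witness \<open>q\<close> exchanged.\<close>

lemma isometry_of_graph:
  assumes G: "lorentz_graph I J G"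
    and q: "q \<in> G" "lorentz (fst q) (fst q) \<ge> 0" "fst (fst q) > 0" "fst (snd q) > 0"
  obtains \<phi> where "\<phi> \<in> hyp_isometries I J" "\<And>x. x \<in> hyp I \<Longrightarrow> (x, \<phi> x) \<in> G"
proof -
  define \<phi> where "\<phi> = restrict (\<lambda>x. SOME x'. (x, x') \<in> G) (hyp I)"
  have \<phi>G: "(x, \<phi> x) \<in> G" if "x \<in> hyp I" for x
    using someI_ex[OF lorentz_graph_obtain(1)[OF G hypD(1)[OF that]]] that
    by (simp only: \<phi>_def restrict_apply if_True)
  have \<phi>h: "\<phi> x \<in> hyp J" if "x \<in> hyp I" for x
    using lorentz_graph_hyp[OF G q that \<phi>G[OF that]] .
  have "bij_betw \<phi> (hyp I) (hyp J)"
    unfolding bij_betw_def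
  proof
    show "inj_on \<phi> (hyp I)"
      by (rule inj_onI) (metis \<phi>G lorentz_graph_unique'[OF G])
    have "x' \<in> \<phi> ` hyp I" if x': "x' \<in> hyp J" for x'
    proof -
      obtain x where x: "(x, x') \<in> G" using lorentz_graph_obtain(2)[OF G hypD(1)[OF x']] by blast
      have "x \<in> hyp I"
        by (rule lorentz_graph_hyp[OF lorentz_graph_converse[OF G], of "prod.swap q" x'])
          (use q x x' lorentz_graphD(4)[OF G q(1) q(1)] in \<open>auto simp: prod.swap_def\<close>)
      moreover from this have "\<phi> x = x'" using lorentz_graph_unique[OF G \<phi>G x] by blast
      ultimately show ?thesis by blast
    qed
    then show "\<phi> ` hyp I = hyp J" using \<phi>h by blast
  qed
  moreover have "hdist (\<phi> x) (\<phi> y) = hdist x y" if "x \<in> hyp I" "y \<in> hyp I" for x y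
    using lorentz_graphD(4)[OF G \<phi>G[OF that(1)] \<phi>G[OF that(2)]]
    by (simp add: hdist_def)
  ultimately have "\<phi> \<in> hyp_isometries I J"
    by (simp add: hyp_isometries_def \<phi>_def)
  with \<phi>G that show ?thesis by blast
qed

text \<open>Distances determine products, so the span of the graph of \<open>\<phi>\<close>
  preserves the form. As \<open>hyp I\<close> and \<open>hyp J\<close> span their ambient spaces,
  both projections are onto.\<close>

lemma graph_of_isometry:
  assumes \<phi>: "\<phi> \<in> hyp_isometries I J"
  obtains G where "lorentz_graph I J G" "\<And>x. x \<in> hyp I \<Longrightarrow> (x, \<phi> x) \<in> G"
proof -
  define S where "S = (\<lambda>x. (x, \<phi> x)) ` hyp I"
  have S: "lorentz (fst s) (fst t) = lorentz (snd s) (snd t)" if "s \<in> S" "t \<in> S" for s t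
  proof -
    from that obtain x y where st: "s = (x, \<phi> x)" "t = (y, \<phi> y)" "x \<in> hyp I" "y \<in> hyp I"
      unfolding S_def by blast
    then have "hdist x y = hdist (\<phi> x) (\<phi> y)" using hyp_isometryD(4)[OF \<phi>] by simp
    then show ?thesis
      using hdist_eq_iff[OF st(3,4) hyp_isometryD(3)[OF \<phi> st(3)] hyp_isometryD(3)[OF \<phi> st(4)]] st
      by simp
  qed
  have "fst ` span S = span (fst ` S)" "snd ` span S = span (snd ` S)"
    by (simp_all add: linear_span_image linear_fst linear_snd)
  moreover have "fst ` S = hyp I" "snd ` S = hyp J"
    using hyp_isometryD(2)[OF \<phi>] by (auto simp: S_def image_image bij_betw_def)
  ultimately have "lorentz_graph I J (span S)"
    unfolding lorentz_graph_def
    using lorentz_span_preserved[of S] S by (simp add: span_hyp)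
  moreover have "(x, \<phi> x) \<in> span S" if "x \<in> hyp I" for x
    using that by (auto simp: S_def intro: span_base)
  ultimately show ?thesis using that by blast
qed

section \<open>Isometries on the boundary\<close>

lemma isotropic_fst: "v \<noteq> 0 \<Longrightarrow> lorentz v v = 0 \<Longrightarrow> fst v \<noteq> 0"
  by (rule iso_rep_span)

lemma boundary_sequence:
  assumes v: "v \<in> lorentz_space I" "v \<noteq> 0" "lorentz v v = 0"
  obtains x where "\<And>n::nat. x n \<in> hyp I"
    "limitin proj_topology (\<lambda>n. span {x n}) (span {v}) sequentially"
proof -
  \<comment> \<open>The sign makes \<open>a\<close> future; its space reflection \<open>b\<close> is
    then a second future isotropic vector, with \<open>lorentz a b = inner a a > 0\<close>.\<close>
  define c where "c = (if fst v > 0 then 1 else - 1 :: real)"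
  define a where "a = c *\<^sub>R v"
  have f: "fst v \<noteq> 0" by (rule isotropic_fst[OF v(2,3)])
  have a: "a \<in> lorentz_space I" "lorentz a a = 0" "fst a > 0"
    using v f by (auto simp: a_def c_def lorentz_simps subspace_mul[OF subspace_lorentz_space])
  define b where "b = (fst a, - snd a)"
  have b: "b \<in> lorentz_space I" "lorentz b b = 0" "fst b > 0"
    using a subspace_neg[OF subspace_ell2_on, of "snd a" I]
    by (auto simp: b_def lorentz_space_iff lorentz_def)
  have "lorentz a b = inner a a" by (simp add: b_def lorentz_def inner_prod_def)
  then have ab: "lorentz a b > 0" using a(3) by auto
  have "span {a} = span {v}" unfolding a_def by (rule span_scaleR) (simp add: c_def)
  obtain x where "\<And>n::nat. x n \<in> lorentz_space I \<inter> hyp I"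
    "limitin proj_topology (\<lambda>n. span {x n}) (span {a}) sequentially"
    using boundary_approx[OF a b ab subspace_lorentz_space order_refl] by blast
  with \<open>span {a} = span {v}\<close> show ?thesis by (intro that[of x]) auto
qed

text \<open>The linear map is continuous, so in the affine chart it carries sequences tending to the
  line of \<open>v\<close> to sequences tending to the line of \<open>v'\<close>.
  \<open>boundary_sequence\<close> provides at least one such sequence, which makes the point in the
  definite description unique.\<close>

lemma boundary_ext_graph:
  assumes G: "lorentz_graph I J G" and \<phi>: "\<phi> \<in> hyp_isometries I J"
    and \<phi>G: "\<And>x. x \<in> hyp I \<Longrightarrow> (x, \<phi> x) \<in> G"
    and v: "(v, v') \<in> G" "v \<noteq> 0" "lorentz v v = 0"
  shows "boundary_ext I J \<phi> (span {v}) = span {v'}" "v' \<noteq> 0" "lorentz v' v' = 0"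
proof -
  have vI: "v \<in> lorentz_space I" "v' \<in> lorentz_space J"
    using lorentz_graphD(2,3)[OF G v(1)] by simp_all
  show v'0: "v' \<noteq> 0"
    using lorentz_graph_unique'[OF G v(1)] subspace_0[OF lorentz_graphD(1)[OF G]] v(2)
    by (auto simp: zero_prod_def)
  show v'l: "lorentz v' v' = 0" using lorentz_graphD(4)[OF G v(1) v(1)] v(3) by simp
  have f: "fst v \<noteq> 0" "fst v' \<noteq> 0" using isotropic_fst v v'0 v'l by blast+
  have lim: "limitin proj_topology (\<lambda>n. span {\<phi> (x n)}) (span {v'}) sequentially"
    if x: "\<And>n. x n \<in> hyp I" and l: "limitin proj_topology (\<lambda>n. span {x n}) (span {v}) sequentially"
    for x :: "nat \<Rightarrow> _"
  proof -
    have fx: "fst (x n) \<noteq> 0" "fst (\<phi> (x n)) \<noteq> 0" for n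
      using hypD(3)[OF x[of n]] hypD(3)[OF hyp_isometryD(3)[OF \<phi> x[of n]]] by simp_all
    have xl: "(\<lambda>n. x n /\<^sub>R fst (x n)) \<longlonglongrightarrow> v /\<^sub>R fst v"
      using l by (simp add: limitin_proj_topology[OF fx(1) f(1)])
    have "(x n /\<^sub>R fst (x n), \<phi> (x n) /\<^sub>R fst (x n)) \<in> G" for n
      using subspace_mul[OF lorentz_graphD(1)[OF G] \<phi>G[OF x[of n]]] by simp
    moreover have "(v /\<^sub>R fst v, v' /\<^sub>R fst v) \<in> G"
      using subspace_mul[OF lorentz_graphD(1)[OF G] v(1)] by simp
    \<comment> \<open>Both components are divided by the first coordinate of the source, to stay in
      the graph; renormalising the image in the chart of the target cancels that factor.\<close>
    ultimately have yl: "(\<lambda>n. \<phi> (x n) /\<^sub>R fst (x n)) \<longlonglongrightarrow> v' /\<^sub>R fst v"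
      by (rule lorentz_graph_tendsto[OF G _ _ xl])
    have nz: "fst (v' /\<^sub>R fst v) \<noteq> 0" using f by simp
    have "(\<lambda>n. (\<phi> (x n) /\<^sub>R fst (x n)) /\<^sub>R fst (\<phi> (x n) /\<^sub>R fst (x n)))
        \<longlonglongrightarrow> (v' /\<^sub>R fst v) /\<^sub>R fst (v' /\<^sub>R fst v)"
      by (intro tendsto_scaleR tendsto_inverse tendsto_fst yl nz)
    moreover have rescale: "(u /\<^sub>R c) /\<^sub>R fst (u /\<^sub>R c) = u /\<^sub>R fst u" if "c \<noteq> 0"
      for c :: real and u :: "real \<times> 'b ell2"
      using that by simp
    ultimately have "(\<lambda>n. \<phi> (x n) /\<^sub>R fst (\<phi> (x n))) \<longlonglongrightarrow> v' /\<^sub>R fst v'"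
      by (simp only: rescale[OF f(1)] rescale[OF fx(1)])
    then show ?thesis by (simp only: limitin_proj_topology[OF fx(2) f(2)])
  qed
  have v'b: "span {v'} \<in> boundary J" using vI(2) v'0 v'l unfolding boundary_def by blast
  show "boundary_ext I J \<phi> (span {v}) = span {v'}"
    unfolding boundary_ext_def
  proof (rule the_equality)
    show "span {v'} \<in> boundary J \<and> (\<forall>x. (\<forall>n::nat. x n \<in> hyp I) \<and>
        limitin proj_topology (\<lambda>n. span {x n}) (span {v}) sequentially \<longrightarrow>
        limitin proj_topology (\<lambda>n. span {\<phi> (x n)}) (span {v'}) sequentially)"
      using v'b lim by blast
  next
    fix \<eta> assume \<eta>: "\<eta> \<in> boundary J \<and> (\<forall>x. (\<forall>n::nat. x n \<in> hyp I) \<and>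
        limitin proj_topology (\<lambda>n. span {x n}) (span {v}) sequentially \<longrightarrow>
        limitin proj_topology (\<lambda>n. span {\<phi> (x n)}) \<eta> sequentially)"
    then obtain u where u: "\<eta> = span {u}" "u \<noteq> 0" "lorentz u u = 0"
      unfolding boundary_def by blast
    have fu: "fst u \<noteq> 0" by (rule isotropic_fst[OF u(2,3)])
    obtain x where x: "\<And>n::nat. x n \<in> hyp I"
      "limitin proj_topology (\<lambda>n. span {x n}) (span {v}) sequentially"
      using boundary_sequence[OF vI(1) v(2,3)] by blast
    have fx: "fst (\<phi> (x n)) \<noteq> 0" for n
      using hypD(3)[OF hyp_isometryD(3)[OF \<phi> x(1)[of n]]] by simp
    have "limitin proj_topology (\<lambda>n. span {\<phi> (x n)}) (span {u}) sequentially"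
      using \<eta> x u(1) by blast
    moreover have "limitin proj_topology (\<lambda>n. span {\<phi> (x n)}) (span {v'}) sequentially"
      using lim x by blast
    ultimately have "u /\<^sub>R fst u = v' /\<^sub>R fst v'"
      using LIMSEQ_unique by (simp add: limitin_proj_topology[OF fx] fu f(2)) blast
    then have "span {u /\<^sub>R fst u} = span {v' /\<^sub>R fst v'}" by simp
    then show "\<eta> = span {v'}" using u(1) fu f(2) by (simp add: span_scaleR)
  qed
qed

text \<open>The image of the base point is future and its product with \<open>v'\<close> is
  \<open>fst v > 0\<close>, whereas a past \<open>v'\<close> would give a negative product. This
  makes the scaling factors in \<open>isometry_unique\<close> positive.\<close>

lemma graph_future:
  assumes G: "lorentz_graph I J G" and \<phi>: "\<phi> \<in> hyp_isometries I J"
    and \<phi>G: "\<And>x. x \<in> hyp I \<Longrightarrow> (x, \<phi> x) \<in> G"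
    and v: "(v, v') \<in> G" "lorentz v v = 0" "fst v > 0"
  shows "fst v' > 0"
proof (rule ccontr)
  assume n: "\<not> fst v' > 0"
  have v0: "v \<noteq> 0" using v(3) by auto
  let ?y = "\<phi> base_point"
  have y: "?y \<in> hyp J" using hyp_isometryD(3)[OF \<phi> base_point_hyp] .
  note v' = boundary_ext_graph(2,3)[OF G \<phi> \<phi>G v(1) v0 v(2)]
  have "fst (- v') > 0" using n isotropic_fst[OF v'] by simp
  moreover have "lorentz (- v') (- v') \<ge> 0" using v'(2) by (simp add: lorentz_def)
  ultimately have "lorentz ?y (- v') > 0"
    using hypD[OF y] by (intro lorentz_pos[of ?y "- v'"]) auto
  then have "lorentz ?y v' < 0" by (simp add: lorentz_def)
  moreover have "lorentz ?y v' = fst v"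
    using lorentz_graphD(4)[OF G \<phi>G[OF base_point_hyp] v(1)] by simp
  ultimately show False using v(3) by simp
qed

text \<open>Agreement on boundary lines leaves a factor \<open>c y\<close> between the two images of
  \<open>a y\<close>. Preservation of products gives \<open>c y * c z = 1\<close> for distinct
  points, so with a third point and positivity all factors are \<open>1\<close>. The two linear maps
  then agree on a dense subspace.\<close>

lemma isometry_unique:
  fixes a :: "'y \<Rightarrow> real \<times> 'i ell2"
  assumes a: "\<And>y. lorentz (a y) (a y) = 0" "\<And>y. fst (a y) > 0"
    and ab: "\<And>y z. y \<noteq> z \<Longrightarrow> lorentz (a y) (a z) > 0"
    and three: "\<And>y::'y. \<exists>z t. z \<noteq> y \<and> t \<noteq> y \<and> z \<noteq> t"
    and dense: "closure (span (range a)) = lorentz_space I"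
    and \<phi>: "\<phi> \<in> hyp_isometries I J" and \<psi>: "\<psi> \<in> hyp_isometries I J"
    and eq: "\<And>y. boundary_ext I J \<phi> (span {a y}) = boundary_ext I J \<psi> (span {a y})"
  shows "\<phi> = \<psi>"
proof -
  obtain G where G: "lorentz_graph I J G" and \<phi>G: "\<And>x. x \<in> hyp I \<Longrightarrow> (x, \<phi> x) \<in> G"
    using graph_of_isometry[OF \<phi>] by blast
  obtain H where H: "lorentz_graph I J H" and \<psi>H: "\<And>x. x \<in> hyp I \<Longrightarrow> (x, \<psi> x) \<in> H"
    using graph_of_isometry[OF \<psi>] by blast
  have aI: "a y \<in> lorentz_space I" for y
    using dense closure_subset span_base by (metis rangeI subsetD)
  have a0: "a y \<noteq> 0" for y using a(2)[of y] by auto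
  obtain b where b: "\<And>y. (a y, b y) \<in> G" using lorentz_graph_obtain(1)[OF G aI] by metis
  obtain d where d: "\<And>y. (a y, d y) \<in> H" using lorentz_graph_obtain(1)[OF H aI] by metis
  have "\<exists>c. d y = c *\<^sub>R b y" for y
  proof -
    have "span {d y} = span {b y}"
      using boundary_ext_graph(1)[OF G \<phi> \<phi>G b a0 a(1), of y]
        boundary_ext_graph(1)[OF H \<psi> \<psi>H d a0 a(1), of y] eq by simp
    then show ?thesis by (rule span_singleton_eq) blast
  qed
  then obtain c where c: "\<And>y. d y = c y *\<^sub>R b y" by metis
  have cpos: "c y > 0" for y
    using graph_future[OF G \<phi> \<phi>G b a(1,2), of y] graph_future[OF H \<psi> \<psi>H d a(1,2), of y]
    by (simp add: c zero_less_mult_iff)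
  have cc: "c y * c z = 1" if "y \<noteq> z" for y z
  proof -
    have "lorentz (a y) (a z) = c y * c z * lorentz (a y) (a z)"
      using lorentz_graphD(4)[OF G b b, of y z] lorentz_graphD(4)[OF H d d, of y z]
      by (simp only: c lorentz_simps fst_conv snd_conv mult_ac)
    then have "(c y * c z - 1) * lorentz (a y) (a z) = 0" by (simp only: left_diff_distrib mult_1_left right_minus_eq)
    then show ?thesis using ab[OF that] by simp
  qed
  have c1: "c y = 1" for y
  proof -
    obtain z t where "z \<noteq> y" "t \<noteq> y" "z \<noteq> t" using three[of y] by blast
    then have "c y * c z = 1" "c y * c t = 1" "c z * c t = 1" using cc by metis+
    then have "(c y)\<^sup>2 = 1"
      by (metis mult.assoc mult.commute mult.right_neutral power2_eq_square)
    then show ?thesis using cpos[of y] by (simp add: power2_eq_1_iff)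
  qed
  have GH: "subspace (G \<inter> H)" using G H by (intro subspace_inter) (auto dest: lorentz_graphD)
  have "range (\<lambda>y. (a y, b y)) \<subseteq> G \<inter> H" using b d c c1 by auto
  then have "span (range (\<lambda>y. (a y, b y))) \<subseteq> G \<inter> H" using GH by (intro span_minimal)
  moreover have "span (range a) = fst ` span (range (\<lambda>y. (a y, b y)))"
    by (simp add: linear_span_image[OF linear_fst, symmetric] image_image)
  ultimately have sub: "span (range a) \<subseteq> fst ` (G \<inter> H)" by auto
  show ?thesis
  proof (rule extensionalityI[OF hyp_isometryD(1)[OF \<phi>] hyp_isometryD(1)[OF \<psi>]])
    fix x assume x: "x \<in> hyp I"
    then have "x \<in> closure (span (range a))" using dense by (auto dest: hypD)
    then obtain v where v: "\<And>n. v n \<in> span (range a)" "v \<longlonglongrightarrow> x"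
      unfolding closure_sequential by blast
    have "\<exists>w. (v n, w) \<in> G \<inter> H" for n using v(1)[of n] sub by force
    then obtain w where w: "\<And>n. (v n, w n) \<in> G" "\<And>n. (v n, w n) \<in> H" by (metis Int_iff)
    have "w \<longlonglongrightarrow> \<phi> x" by (rule lorentz_graph_tendsto[OF G w(1) \<phi>G[OF x] v(2)])
    moreover have "w \<longlonglongrightarrow> \<psi> x" by (rule lorentz_graph_tendsto[OF H w(2) \<psi>H[OF x] v(2)])
    ultimately show "\<phi> x = \<psi> x" by (rule LIMSEQ_unique)
  qed
qed

text \<open>\<open>lorentz_bound\<close> turns convergence of the first components into a Cauchy
  sequence of second components, and completeness of \<open>ell2\<close> supplies the limit.\<close>

lemma closure_graph_domain:
  assumes S: "\<And>s t. s \<in> S \<Longrightarrow> t \<in> S \<Longrightarrow> lorentz (fst s) (fst t) = lorentz (snd s) (snd t)"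
    and q: "q \<in> span S" "lorentz (fst q) (fst q) > 0"
    and v: "v \<in> closure (span (fst ` S))"
  shows "\<exists>v'. (v, v') \<in> closure (span S)"
proof -
  have pres: "lorentz (fst g) (fst h) = lorentz (snd g) (snd h)" if "g \<in> span S" "h \<in> span S" for g h
    by (rule lorentz_span_preserved[OF S that])
  obtain C where C: "C \<ge> 0" "\<And>g. g \<in> span S \<Longrightarrow> norm (snd g) \<le> C * norm (fst g)"
    using lorentz_bound[OF subspace_span pres q] by blast
  from v obtain x where x: "\<And>n. x n \<in> span (fst ` S)" "x \<longlonglongrightarrow> v"
    unfolding closure_sequential by blast
  have "\<exists>g\<in>span S. fst g = x n" for n
  proof -
    have "x n \<in> fst ` span S" using x(1) by (simp add: linear_span_image[OF linear_fst])
    then show ?thesis unfolding image_iff by metis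
  qed
  then obtain g where g: "\<And>n. g n \<in> span S" "\<And>n. fst (g n) = x n" by metis
  have "Cauchy (\<lambda>n. snd (g n))"
  proof (rule CauchyI)
    fix e :: real assume e: "e > 0"
    have "Cauchy x" using x(2) LIMSEQ_imp_Cauchy by blast
    \<comment> \<open>\<open>C + 1\<close> instead of \<open>C\<close> because \<open>C\<close> may
      be zero.\<close>
    then obtain M where M: "\<And>m n. m \<ge> M \<Longrightarrow> n \<ge> M \<Longrightarrow> norm (x m - x n) < e / (C + 1)"
      using CauchyD[of x "e / (C + 1)"] C(1) e by (metis add_nonneg_pos divide_pos_pos zero_less_one)
    have "norm (snd (g m) - snd (g n)) < e" if "m \<ge> M" "n \<ge> M" for m n
    proof -
      have "norm (snd (g m) - snd (g n)) \<le> C * norm (x m - x n)"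
        using C(2)[OF span_diff[OF g(1)[of m] g(1)[of n]]] by (simp add: g(2))
      also have "\<dots> \<le> (C + 1) * norm (x m - x n)" by (simp add: mult_right_mono)
      also have "\<dots> < e" using M[OF that] C(1) by (simp add: field_simps)
      finally show ?thesis .
    qed
    then show "\<exists>M. \<forall>m\<ge>M. \<forall>n\<ge>M. norm (snd (g m) - snd (g n)) < e" by blast
  qed
  then obtain v' where "(\<lambda>n. snd (g n)) \<longlonglongrightarrow> v'"
    using Cauchy_convergent convergent_def by blast
  moreover have "(\<lambda>n. fst (g n)) \<longlonglongrightarrow> v" using x(2) by (simp add: g(2))
  ultimately have "(\<lambda>n. (fst (g n), snd (g n))) \<longlonglongrightarrow> (v, v')" by (intro tendsto_Pair)
  then have "g \<longlonglongrightarrow> (v, v')" by simp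
  with g(1) show ?thesis unfolding closure_sequential by blast
qed

text \<open>The hypotheses are symmetric in the two components, so surjectivity of the second
  projection is \<open>closure_graph_domain\<close> for the swapped relation.\<close>

lemma lorentz_graph_closure:
  assumes S: "\<And>s t. s \<in> S \<Longrightarrow> t \<in> S \<Longrightarrow> lorentz (fst s) (fst t) = lorentz (snd s) (snd t)"
    and q: "q \<in> span S" "lorentz (fst q) (fst q) > 0"
    and I: "closure (span (fst ` S)) = lorentz_space I"
    and J: "closure (span (snd ` S)) = lorentz_space J"
  shows "lorentz_graph I J (closure (span S))"
proof -
  let ?G = "closure (span S)"
  have pres: "lorentz (fst g) (fst h) = lorentz (snd g) (snd h)" if gh: "g \<in> ?G" "h \<in> ?G" for g h
  proof -
    from gh obtain x y where x: "\<And>n. x n \<in> span S" "x \<longlonglongrightarrow> g" and y: "\<And>n. y n \<in> span S" "y \<longlonglongrightarrow> h"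
      unfolding closure_sequential by blast
    have "(\<lambda>n. lorentz (fst (x n)) (fst (y n))) \<longlonglongrightarrow> lorentz (fst g) (fst h)"
      by (intro tendsto_intros x y)
    moreover have "(\<lambda>n. lorentz (snd (x n)) (snd (y n))) \<longlonglongrightarrow> lorentz (snd g) (snd h)"
      by (intro tendsto_intros x y)
    moreover have "lorentz (fst (x n)) (fst (y n)) = lorentz (snd (x n)) (snd (y n))" for n
      by (rule lorentz_span_preserved[OF S x(1) y(1)])
    ultimately show ?thesis using LIMSEQ_unique by simp
  qed
  have sub: "fst g \<in> lorentz_space I" "snd g \<in> lorentz_space J" if g: "g \<in> ?G" for g
  proof -
    from g obtain x where x: "\<And>n. x n \<in> span S" "x \<longlonglongrightarrow> g" unfolding closure_sequential by blast
    have "fst (x n) \<in> span (fst ` S)" "snd (x n) \<in> span (snd ` S)" for n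
      using x(1)[of n] by (simp_all add: linear_span_image linear_fst linear_snd)
    then have "fst g \<in> closure (span (fst ` S))" "snd g \<in> closure (span (snd ` S))"
      unfolding closure_sequential
      by (intro exI[of _ "\<lambda>n. fst (x n)"] exI[of _ "\<lambda>n. snd (x n)"] conjI allI
          tendsto_fst[OF x(2)] tendsto_snd[OF x(2)]; simp)+
    then show "fst g \<in> lorentz_space I" "snd g \<in> lorentz_space J"
      by (simp_all add: I J)
  qed
  have "\<exists>v'. (v, v') \<in> ?G" if "v \<in> lorentz_space I" for v
  proof -
    have "v \<in> closure (span (fst ` S))" using that I by simp
    from closure_graph_domain[OF S q this] show ?thesis .
  qed
  moreover have "\<exists>v. (v, v') \<in> ?G" if "v' \<in> lorentz_space J" for v'
  proof -
    have lin: "linear (prod.swap :: (real \<times> 'a ell2) \<times> (real \<times> 'b ell2) \<Rightarrow> _)"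
      "linear (prod.swap :: (real \<times> 'b ell2) \<times> (real \<times> 'a ell2) \<Rightarrow> _)"
      by (auto intro!: linearI)
    have "lorentz (fst s) (fst t) = lorentz (snd s) (snd t)"
      if "s \<in> prod.swap ` S" "t \<in> prod.swap ` S" for s t
      using that S by auto
    moreover have "prod.swap q \<in> span (prod.swap ` S)"
      using q(1) by (simp add: linear_span_image[OF lin(1)])
    moreover have "lorentz (fst (prod.swap q)) (fst (prod.swap q)) > 0"
      using q(2) lorentz_span_preserved[OF S q(1) q(1)] by (simp add: prod.swap_def)
    moreover have "v' \<in> closure (span (fst ` prod.swap ` S))"
      using that J by (simp add: image_image)
    ultimately have "\<exists>v. (v', v) \<in> closure (span (prod.swap ` S))"
      by (rule closure_graph_domain)
    then obtain v g where g: "\<And>n::nat. g n \<in> span (prod.swap ` S)" "g \<longlonglongrightarrow> (v', v)"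
      unfolding closure_sequential by blast
    have "prod.swap (g n) \<in> prod.swap ` prod.swap ` span S" for n
      using g(1)[of n] unfolding linear_span_image[OF lin(1)] by (rule imageI)
    then have "prod.swap (g n) \<in> span S" for n by (simp add: image_image)
    moreover have "(\<lambda>n. prod.swap (g n)) \<longlonglongrightarrow> (v, v')"
      unfolding prod.swap_def
      using tendsto_Pair[OF tendsto_snd[OF g(2)] tendsto_fst[OF g(2)]] by simp
    ultimately show ?thesis unfolding closure_sequential
      by (intro exI[of _ v] exI[of _ "\<lambda>n. prod.swap (g n)"] conjI allI)
  qed
  ultimately have "lorentz_space I \<subseteq> fst ` ?G" "lorentz_space J \<subseteq> snd ` ?G"
    by (metis fst_conv snd_conv image_eqI subsetI)+
  then have "fst ` ?G = lorentz_space I" "snd ` ?G = lorentz_space J"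
    using sub by blast+
  then show ?thesis
    unfolding lorentz_graph_def using pres by (simp add: subspace_closure)
qed

text \<open>The pairs \<open>(a y, b y)\<close> generate the graph. The sum of those at
  \<open>p\<close> and \<open>w\<close> is timelike, as \<open>lorentz_graph_closure\<close>
  requires, and one pair of future vectors fixes the time orientation.\<close>

lemma isometry_exists:
  fixes a :: "'y \<Rightarrow> real \<times> 'i ell2" and b :: "'y \<Rightarrow> real \<times> 'j ell2"
  assumes a: "\<And>y. lorentz (a y) (a y) = 0" "\<And>y. fst (a y) > 0"
    and b: "\<And>y. fst (b y) > 0"
    and ab: "\<And>y z. lorentz (a y) (a z) = lorentz (b y) (b z)"
    and pw: "lorentz (a p) (a w) > 0"
    and I: "closure (span (range a)) = lorentz_space I"
    and J: "closure (span (range b)) = lorentz_space J"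
  obtains \<phi> where "\<phi> \<in> hyp_isometries I J"
    "\<And>y. boundary_ext I J \<phi> (span {a y}) = span {b y}"
proof -
  define S where "S = range (\<lambda>y. (a y, b y))"
  have S: "lorentz (fst s) (fst t) = lorentz (snd s) (snd t)" if "s \<in> S" "t \<in> S" for s t
    using that ab by (auto simp: S_def)
  let ?q = "(a p, b p) + (a w, b w)"
  have q: "?q \<in> span S" by (intro span_add span_base) (auto simp: S_def)
  have q': "lorentz (fst ?q) (fst ?q) > 0"
    using a(1) pw by (simp add: lorentz_simps lorentz_commute[of "a w" "a p"])
  have fS: "closure (span (fst ` S)) = lorentz_space I" and sS: "closure (span (snd ` S)) = lorentz_space J"
    using I J by (simp_all add: S_def image_image)
  have G: "lorentz_graph I J (closure (span S))"
    using S q q' fS sS by (rule lorentz_graph_closure)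
  have abG: "(a y, b y) \<in> closure (span S)" for y
    by (rule subsetD[OF closure_subset], rule span_base) (simp add: S_def)
  obtain \<phi> where \<phi>: "\<phi> \<in> hyp_isometries I J" "\<And>x. x \<in> hyp I \<Longrightarrow> (x, \<phi> x) \<in> closure (span S)"
    using isometry_of_graph[OF G abG[of p]] a b by auto
  have "boundary_ext I J \<phi> (span {a y}) = span {b y}" for y
  proof (rule boundary_ext_graph(1)[OF G \<phi> abG])
    show "a y \<noteq> 0" using a(2)[of y] by auto
  qed (use a in auto)
  with \<phi>(1) that show ?thesis by blast
qed

section \<open>The cardinality of the index set\<close>

lemma ell2_support_countable: "countable {i. ell2_coord x i \<noteq> 0}"
  using summable_countable_real[OF ell2_coord_summable[of x]] by simp

text \<open>For infinite \<open>J\<close>, the vectors corresponding to a basis over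
  \<open>J\<close> have countable supports, whose union has cardinality at most \<open>|J|\<close>;
  an index of \<open>I\<close> outside it would give a unit vector whose image is orthogonal to
  everything. For finite \<open>J\<close>, linear dimensions are compared.\<close>

lemma lorentz_graph_lepoll:
  includes cardinal_syntax
  assumes G: "lorentz_graph I J G"
  shows "I \<lesssim> J"
proof -
  define u :: "'a \<Rightarrow> real \<times> 'a ell2" where "u i = (0, ell2_unit i)" for i
  define u' :: "'b \<Rightarrow> real \<times> 'b ell2" where "u' j = (0, ell2_unit j)" for j
  have uI: "u i \<in> lorentz_space I \<longleftrightarrow> i \<in> I" for i by (simp add: u_def lorentz_space_iff ell2_unit_mem)
  have uJ: "u' j \<in> lorentz_space J \<longleftrightarrow> j \<in> J" for j
    by (simp add: u'_def lorentz_space_iff ell2_unit_mem)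
  have lu: "lorentz v (u i) = - ell2_coord (snd v) i" for v i
    by (simp add: u_def lorentz_def inner_ell2_unit)
  have lu': "lorentz v (u' j) = - ell2_coord (snd v) j" for v j
    by (simp add: u'_def lorentz_def inner_ell2_unit)
  show ?thesis
  proof (cases "finite J")
    case False
    have "base_point \<in> lorentz_space J" using base_point_hyp by (rule hypD)
    then obtain q where q: "(q, base_point) \<in> G" using lorentz_graph_obtain(2)[OF G] by blast
    have "\<forall>j\<in>J. \<exists>v. (v, u' j) \<in> G" using lorentz_graph_obtain(2)[OF G] uJ by blast
    then obtain g where g: "\<And>j. j \<in> J \<Longrightarrow> (g j, u' j) \<in> G" by metis
    \<comment> \<open>The support of \<open>q\<close> is added to every \<open>A j\<close>, so that
      the union over \<open>J\<close> alone also takes care of the time direction.\<close>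
    define A where "A j = {i. ell2_coord (snd (g j)) i \<noteq> 0} \<union> {i. ell2_coord (snd q) i \<noteq> 0}" for j
    have "I \<subseteq> (\<Union>j\<in>J. A j)"
    proof
      fix i assume i: "i \<in> I"
      then obtain h where h: "(u i, h) \<in> G" using lorentz_graph_obtain(1)[OF G] uI by blast
      show "i \<in> (\<Union>j\<in>J. A j)"
      proof (rule ccontr)
        assume n: "i \<notin> (\<Union>j\<in>J. A j)"
        obtain j0 where "j0 \<in> J" using False by fastforce
        then have "i \<notin> A j0" using n by blast
        then have "ell2_coord (snd q) i = 0" by (simp add: A_def)
        then have "fst h = 0"
          using lorentz_graphD(4)[OF G q h] by (simp add: lu)
        moreover have "ell2_coord (snd h) j = 0" for j
        proof (cases "j \<in> J")
          case True
          then have "i \<notin> A j" using n by blast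
          then have "ell2_coord (snd (g j)) i = 0" by (simp add: A_def)
          then have "lorentz (u' j) h = 0"
            using lorentz_graphD(4)[OF G g[OF True] h] by (simp add: lu)
          then show ?thesis unfolding lorentz_commute[of "u' j"] lu' by simp
        next
          case False
          then show ?thesis using lorentz_graphD(3)[OF G h] by (simp add: lorentz_space_def)
        qed
        then have "snd h = 0" by (intro ell2_eqI) (simp add: zero_ell2.rep_eq)
        ultimately have "(u i, 0) \<in> G" using h by (metis prod.collapse zero_prod_def)
        then have "u i = 0"
          using lorentz_graph_unique'[OF G] subspace_0[OF lorentz_graphD(1)[OF G]]
          unfolding zero_prod_def by blast
        then show False by (simp add: u_def zero_prod_def)
      qed
    qed
    moreover have "|\<Union>j\<in>J. A j| \<le>o |J|"
    proof (rule card_of_UNION_ordLeq_infinite[OF False card_of_refl[THEN ordIso_imp_ordLeq]], rule ballI)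
      fix j
      have "countable (A j)" unfolding A_def by (intro countable_Un ell2_support_countable)
      then have "|A j| \<le>o |UNIV :: nat set|"
        unfolding countable_def card_of_ordLeq[symmetric] by blast
      then show "|A j| \<le>o |J|"
        using False infinite_iff_card_of_nat ordLeq_transitive by blast
    qed
    ultimately have "|I| \<le>o |J|" using card_of_mono1 ordLeq_transitive by blast
    then show ?thesis by (simp add: lepoll_def card_of_ordLeq)
  next
    case True
    define t where "t = insert base_point (u' ` J)"
    have t: "finite t" "card t \<le> Suc (card J)"
      using True by (auto simp: t_def card_insert_if intro: card_image_le le_SucI)
    have tJ: "t \<subseteq> lorentz_space J" using uJ hypD(1)[OF base_point_hyp, of J] by (auto simp: t_def)
    have span_t: "lorentz_space J \<subseteq> span t"
    proof
      fix v assume v: "v \<in> lorentz_space J"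
      have "v = fst v *\<^sub>R base_point + (\<Sum>j\<in>J. ell2_coord (snd v) j *\<^sub>R u' j)"
      proof -
        have c: "ell2_coord (\<Sum>j\<in>K. ell2_coord (snd v) j *\<^sub>R ell2_unit j) i
            = (if i \<in> K then ell2_coord (snd v) i else 0)" if "finite K" for K i
          using that by (induction K) (auto simp: ell2_coord_simps ell2_coord_unit)
        have "snd v = (\<Sum>j\<in>J. ell2_coord (snd v) j *\<^sub>R ell2_unit j)"
          using v by (intro ell2_eqI) (simp add: c[OF True] lorentz_space_def)
        then show ?thesis by (simp add: prod_eq_iff fst_sum snd_sum u'_def)
      qed
      moreover have "fst v *\<^sub>R base_point + (\<Sum>j\<in>J. ell2_coord (snd v) j *\<^sub>R u' j) \<in> span t"
        by (intro span_add span_sum span_mul span_base) (auto simp: t_def)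
      ultimately show "v \<in> span t" by simp
    qed
    have "\<forall>\<tau>\<in>t. \<exists>v. (v, \<tau>) \<in> G" using lorentz_graph_obtain(2)[OF G] tJ by blast
    then obtain g where g: "\<And>\<tau>. \<tau> \<in> t \<Longrightarrow> (g \<tau>, \<tau>) \<in> G" by metis
    have span_g: "lorentz_space I \<subseteq> span (g ` t)"
    proof
      fix v assume "v \<in> lorentz_space I"
      then obtain v' where v': "(v, v') \<in> G" using lorentz_graph_obtain(1)[OF G] by blast
      let ?T = "(\<lambda>\<tau>. (g \<tau>, \<tau>)) ` t"
      have "span ?T \<subseteq> G" using g by (intro span_minimal lorentz_graphD(1)[OF G]) auto
      have "v' \<in> span t" using lorentz_graphD(3)[OF G v'] span_t by auto
      also have "span t = snd ` span ?T" by (simp add: linear_span_image[OF linear_snd, symmetric] image_image)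
      finally obtain w where w: "w \<in> span ?T" "v' = snd w" by blast
      then have "(fst w, v') \<in> G" using \<open>span ?T \<subseteq> G\<close> by auto
      then have "v = fst w" by (rule lorentz_graph_unique'[OF G v'])
      moreover have "fst w \<in> fst ` span ?T" using w(1) by (rule imageI)
      moreover have "fst ` span ?T = span (g ` t)"
        by (simp add: linear_span_image[OF linear_fst, symmetric] image_image)
      ultimately show "v \<in> span (g ` t)" by simp
    qed
    \<comment> \<open>The time direction contributes one vector here and one in \<open>t\<close>, so
      the two extra units cancel in the comparison of cardinalities.\<close>
    define s where "s = insert base_point (u ` I)"
    have "pairwise orthogonal s"
      unfolding s_def pairwise_insert
      by (auto simp: pairwise_def orthogonal_def u_def inner_ell2_unit ell2_coord_unit)
    moreover have "0 \<notin> s"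
      by (auto simp: s_def u_def zero_prod_def)
    ultimately have "independent s" by (rule pairwise_orthogonal_independent)
    moreover have "s \<subseteq> lorentz_space I"
      using uI hypD(1)[OF base_point_hyp, of I] by (auto simp: s_def)
    ultimately have s: "finite s" "card s \<le> card (g ` t)"
      using independent_span_bound[of "g ` t" s] t(1) span_g by auto
    have inj: "inj_on u I"
    proof (rule inj_onI)
      fix i i' assume "u i = u i'"
      then have "ell2_coord (ell2_unit i) i = ell2_coord (ell2_unit i') i" by (simp add: u_def)
      then show "i = i'" by (simp add: ell2_coord_unit split: if_splits)
    qed
    have fI: "finite I" using s(1) inj by (simp add: s_def finite_image_iff)
    have "base_point \<notin> u ` I" by (auto simp: u_def)
    then have "card s = Suc (card I)" using fI by (simp add: s_def card_image[OF inj])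
    moreover have "card (g ` t) \<le> Suc (card J)" using t card_image_le le_trans by blast
    ultimately have "card I \<le> card J" using s(2) by simp
    then show ?thesis using fI True by (simp add: lepoll_iff_card_le)
  qed
qed

lemma hyp_isometry_eqpoll:
  assumes "\<phi> \<in> hyp_isometries I J"
  shows "I \<approx> J"
proof -
  obtain G where G: "lorentz_graph I J G" using graph_of_isometry[OF assms] by blast
  show ?thesis
    using lorentz_graph_lepoll[OF G] lorentz_graph_lepoll[OF lorentz_graph_converse[OF G]]
    by (rule lepoll_antisym)
qed

text \<open>For the boundary, the linear map of the composite has to be the composite of the linear
  maps. This holds on \<open>hyp I\<close>, which spans, and passes to linear combinations.\<close>

lemma hyp_isometry_compose:
  assumes \<phi>: "\<phi> \<in> hyp_isometries I J" and \<psi>: "\<psi> \<in> hyp_isometries J K"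
  shows "compose (hyp I) \<psi> \<phi> \<in> hyp_isometries I K"
    and "\<xi> \<in> boundary I \<Longrightarrow> boundary_ext I K (compose (hyp I) \<psi> \<phi>) \<xi> =
      boundary_ext J K \<psi> (boundary_ext I J \<phi> \<xi>)"
proof -
  let ?c = "compose (hyp I) \<psi> \<phi>"
  have "bij_betw (\<psi> \<circ> \<phi>) (hyp I) (hyp K)"
    using hyp_isometryD(2)[OF \<phi>] hyp_isometryD(2)[OF \<psi>] by (rule bij_betw_trans)
  then have "bij_betw ?c (hyp I) (hyp K)"
    by (rule iffD1[OF bij_betw_cong, rotated]) (simp add: compose_eq)
  then show c: "?c \<in> hyp_isometries I K"
    using hyp_isometryD(3,4)[OF \<phi>] hyp_isometryD(4)[OF \<psi>]
    by (simp add: hyp_isometries_def compose_eq)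
  obtain G where G: "lorentz_graph I J G" and \<phi>G: "\<And>x. x \<in> hyp I \<Longrightarrow> (x, \<phi> x) \<in> G"
    using graph_of_isometry[OF \<phi>] by blast
  obtain H where H: "lorentz_graph J K H" and \<psi>H: "\<And>x. x \<in> hyp J \<Longrightarrow> (x, \<psi> x) \<in> H"
    using graph_of_isometry[OF \<psi>] by blast
  obtain F where F: "lorentz_graph I K F" and cF: "\<And>x. x \<in> hyp I \<Longrightarrow> (x, ?c x) \<in> F"
    using graph_of_isometry[OF c] by blast
  have comp: "(v, w) \<in> F" if v: "(v, v') \<in> G" "(v', w) \<in> H" for v v' w
  proof -
    define S where "S = (\<lambda>x. (x, \<phi> x)) ` hyp I"
    have "v \<in> span (fst ` S)" using lorentz_graphD(2)[OF G v(1)] by (simp add: S_def image_image span_hyp)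
    then obtain g where g: "g \<in> span S" "v = fst g"
      unfolding linear_span_image[OF linear_fst] by blast
    \<comment> \<open>The induction also carries \<open>g \<in> G\<close>, so that afterwards
      \<open>snd g\<close> can be identified with \<open>v'\<close>.\<close>
    have "\<exists>z. (fst g, z) \<in> F \<and> (snd g, z) \<in> H \<and> g \<in> G"
      using g(1)
    proof (induction rule: span_induct_alt)
      case base
      show ?case
        using subspace_0[OF lorentz_graphD(1)[OF F]] subspace_0[OF lorentz_graphD(1)[OF H]]
          subspace_0[OF lorentz_graphD(1)[OF G]]
        by (intro exI[of _ 0]) (simp add: zero_prod_def)
    next
      case (step r s g)
      then obtain z where z: "(fst g, z) \<in> F" "(snd g, z) \<in> H" "g \<in> G" by blast
      from step(1) obtain x where x: "s = (x, \<phi> x)" "x \<in> hyp I" unfolding S_def by blast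
      have "(x, \<psi> (\<phi> x)) \<in> F" using cF[OF x(2)] x(2) by (simp add: compose_eq)
      from subspace_add[OF lorentz_graphD(1)[OF F] subspace_mul[OF lorentz_graphD(1)[OF F] this] z(1)]
      have 1: "(fst (r *\<^sub>R s + g), r *\<^sub>R \<psi> (\<phi> x) + z) \<in> F" by (simp add: x)
      from subspace_add[OF lorentz_graphD(1)[OF H]
          subspace_mul[OF lorentz_graphD(1)[OF H] \<psi>H[OF hyp_isometryD(3)[OF \<phi> x(2)]]] z(2)]
      have 2: "(snd (r *\<^sub>R s + g), r *\<^sub>R \<psi> (\<phi> x) + z) \<in> H" by (simp add: x)
      have 3: "r *\<^sub>R s + g \<in> G"
        using subspace_add[OF lorentz_graphD(1)[OF G]
          subspace_mul[OF lorentz_graphD(1)[OF G] \<phi>G[OF x(2)]] z(3)] by (simp add: x)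
      from 1 2 3 show ?case by blast
    qed
    then obtain z where z: "(v, z) \<in> F" "(snd g, z) \<in> H" "(v, snd g) \<in> G" using g(2) by auto
    have "snd g = v'" using lorentz_graph_unique[OF G z(3) v(1)] .
    then have "z = w" using lorentz_graph_unique[OF H _ v(2)] z(2) by simp
    with z(1) show ?thesis by simp
  qed
  assume "\<xi> \<in> boundary I"
  then obtain v where v: "\<xi> = span {v}" "v \<in> lorentz_space I" "v \<noteq> 0" "lorentz v v = 0"
    unfolding boundary_def by blast
  obtain v' where v': "(v, v') \<in> G" using lorentz_graph_obtain(1)[OF G v(2)] by blast
  note e1 = boundary_ext_graph[OF G \<phi> \<phi>G v' v(3,4)]
  obtain w where w: "(v', w) \<in> H"
    using lorentz_graph_obtain(1)[OF H lorentz_graphD(3)[OF G v', simplified]] by blast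
  show "boundary_ext I K ?c \<xi> = boundary_ext J K \<psi> (boundary_ext I J \<phi> \<xi>)"
    using e1(1) boundary_ext_graph(1)[OF H \<psi> \<psi>H w e1(2,3)]
      boundary_ext_graph(1)[OF F c cF comp[OF v' w] v(3,4)]
    by (simp add: v(1))
qed

section \<open>Uniqueness\<close>

lemma iso_rep_boundary:
  assumes "\<xi> \<in> boundary I"
  shows "iso_rep \<xi> \<in> lorentz_space I" "fst (iso_rep \<xi>) = 1"
    "lorentz (iso_rep \<xi>) (iso_rep \<xi>) = 0" "span {iso_rep \<xi>} = \<xi>"
proof -
  obtain v where v: "\<xi> = span {v}" "v \<in> lorentz_space I" "v \<noteq> 0" "lorentz v v = 0"
    using assms unfolding boundary_def by blast
  note r = iso_rep_span[OF v(3,4)]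
  show "iso_rep \<xi> \<in> lorentz_space I" "fst (iso_rep \<xi>) = 1"
    "lorentz (iso_rep \<xi>) (iso_rep \<xi>) = 0" "span {iso_rep \<xi>} = \<xi>"
    using v r by (simp_all add: subspace_mul[OF subspace_lorentz_space] lorentz_simps span_scaleR)
qed

text \<open>The difference has vanishing first coordinate, so its norm is given by the Lorentz form:
  the product of normalised representatives is half the squared chordal distance on the unit
  sphere.\<close>

lemma lorentz_isotropic_norm:
  assumes "fst v = 1" "fst w = 1" "lorentz v v = 0" "lorentz w w = 0"
  shows "2 * lorentz v w = (norm (v - w))\<^sup>2"
  using assms by (simp add: norm_lorentz lorentz_simps lorentz_commute[of w v])

section \<open>Representatives adapted to a cross-ratio\<close>

lemma abstract_cross_ratioD:
  assumes "abstract_cross_ratio B" "(x, x', y, y') \<in> quads"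
  shows "B (x, x', y, y') = B (y, y', x, x')" "B (x, x', y, y') = B (x', x, y', y)"
    "B (x, x', y, y') = inverse (B (y, x', x, y'))" "B (x, x', y, y') = inverse (B (x, y', y, x'))"
    "B (x, x', y, y') = 0 \<longleftrightarrow> x = x' \<or> y = y'" "B (x, x', y, y') = \<infinity> \<longleftrightarrow> x = y' \<or> y = x'"
  using assms unfolding abstract_cross_ratio_def by blast+

lemma quadsI:
  assumes "distinct [x, y, z]" "{x, y, z} \<subseteq> {a, b, c, d}"
  shows "(a, b, c, d) \<in> quads"
proof -
  have "card {x, y, z} = 3" using assms(1) by simp
  moreover have "card {x, y, z} \<le> card {a, b, c, d}" using assms(2) by (intro card_mono) simp_all
  ultimately show ?thesis by (simp add: quads_def)
qed

text \<open>In contrast to \<open>realizes\<close>, continuity is not required: it plays no role for uniqueness, and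
  the elements of a group acting on \<open>Y\<close> need not be continuous.\<close>

definition represents :: "('y \<times> 'y \<times> 'y \<times> 'y \<Rightarrow> ennreal) \<Rightarrow> 'i set \<Rightarrow>
    ('y \<Rightarrow> (real \<times> 'i ell2) set) \<Rightarrow> bool"
  where "represents R I f \<longleftrightarrow> total I (range f) \<and>
    (\<forall>a a' b b'. (a, a', b, b') \<in> quads \<longrightarrow>
      cross_ratio (f a) (f a') (f b) (f b') = R (a, a', b, b'))"

lemma represents_boundary: "represents R I f \<Longrightarrow> f y \<in> boundary I"
  by (auto simp: represents_def total_def)

lemma three_points:
  fixes p u w y :: 'y
  assumes "distinct [p, u, w]"
  shows "\<exists>z t. z \<noteq> y \<and> t \<noteq> y \<and> z \<noteq> t"
proof -
  consider "y \<noteq> p \<and> y \<noteq> u" | "y = p" | "y = u" by blast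
  then show ?thesis
  proof cases
    case 1
    then show ?thesis using assms by (intro exI[of _ p] exI[of _ u]) auto
  next
    case 2
    then show ?thesis using assms by (intro exI[of _ u] exI[of _ w]) auto
  next
    case 3
    then show ?thesis using assms by (intro exI[of _ p] exI[of _ w]) auto
  qed
qed

text \<open>In the quadruple \<open>(x, y, x, z)\<close> the product of \<open>x\<close> and
  \<open>y\<close> stands in the denominator, and a zero there would make a finite value of
  \<open>R\<close> infinite. The chordal formula gives the weak inequality.\<close>

lemma represents_pos:
  fixes p u w x y :: "'y::topological_space"
  assumes R: "abstract_cross_ratio R" and f: "represents R I f"
    and puw: "distinct [p, u, w]" and xy: "x \<noteq> y"
  shows "lorentz (iso_rep (f x)) (iso_rep (f y)) > 0"
proof -
  note fx = iso_rep_boundary[OF represents_boundary[OF f, of x]]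
  note fy = iso_rep_boundary[OF represents_boundary[OF f, of y]]
  obtain z where z: "z \<noteq> x" "z \<noteq> y"
    using three_points[OF puw, of x] xy by metis
  have q: "(x, y, x, z) \<in> quads" using z xy by (intro quadsI[of x y z]) auto
  have "R (x, y, x, z) \<noteq> \<infinity>" using abstract_cross_ratioD(6)[OF R q] z xy by auto
  then have "cross_ratio (f x) (f y) (f x) (f z) \<noteq> \<infinity>"
    using f q unfolding represents_def by metis
  then have "lorentz (iso_rep (f x)) (iso_rep (f y)) \<noteq> 0"
    unfolding cross_ratio_def Let_def by (metis mult_zero_right)
  moreover have "0 \<le> lorentz (iso_rep (f x)) (iso_rep (f y))"
    using lorentz_isotropic_norm[OF fx(2) fy(2) fx(3) fy(3)]
      zero_le_power2[of "norm (iso_rep (f x) - iso_rep (f y))"] by linarith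
  ultimately show ?thesis by simp
qed

lemma represents_ratio:
  fixes p u w a a' b b' :: "'y::topological_space"
  assumes R: "abstract_cross_ratio R" and f: "represents R I f" and g: "represents R J g"
    and puw: "distinct [p, u, w]" and d: "distinct [a, a', b, b']"
  defines "A \<equiv> \<lambda>y z. lorentz (iso_rep (f y)) (iso_rep (f z))"
    and "B \<equiv> \<lambda>y z. lorentz (iso_rep (g y)) (iso_rep (g z))"
  shows "A a a' * A b b' / (A a b' * A b a') = B a a' * B b b' / (B a b' * B b a')"
proof -
  have A: "A y z > 0" if "y \<noteq> z" for y z unfolding A_def by (rule represents_pos[OF R f puw that])
  have B: "B y z > 0" if "y \<noteq> z" for y z unfolding B_def by (rule represents_pos[OF R g puw that])
  have q: "(a, a', b, b') \<in> quads" using d by (intro quadsI[of a a' b]) auto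
  have "A a b' * A b a' \<noteq> 0" "B a b' * B b a' \<noteq> 0"
    using A[of a b'] A[of b a'] B[of a b'] B[of b a'] d by auto
  moreover have "cross_ratio (f a) (f a') (f b) (f b') = cross_ratio (g a) (g a') (g b) (g b')"
    using f g q by (simp add: represents_def)
  ultimately have "ennreal (sqrt (A a a' * A b b' / (A a b' * A b a'))) =
      ennreal (sqrt (B a a' * B b b' / (B a b' * B b a')))"
    unfolding cross_ratio_def Let_def A_def B_def by simp
  moreover have "0 \<le> A a a' * A b b' / (A a b' * A b a')"
      "0 \<le> B a a' * B b b' / (B a b' * B b a')"
    using A B d by (auto intro!: divide_nonneg_nonneg mult_nonneg_nonneg less_imp_le)
  ultimately show ?thesis by simp
qed

text \<open>\<open>A y z / (A y w * A z w)\<close> does not change when the representatives of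
  \<open>y\<close> and \<open>z\<close> are rescaled; up to a constant it is a squared distance in
  the picture with \<open>w\<close> at infinity. Equality of cross-ratios says that these quantities
  for \<open>f\<close> and \<open>g\<close> differ by a constant factor, which can be absorbed in
  the scaling.\<close>

lemma normalised_representatives:
  fixes f :: "'y::topological_space \<Rightarrow> (real \<times> 'i ell2) set" and g :: "'y \<Rightarrow> (real \<times> 'j ell2) set"
    and p u w :: 'y
  assumes R: "abstract_cross_ratio R" and f: "represents R I f" and g: "represents R J g"
    and puw: "distinct [p, u, w]"
  obtains a b where
    "\<And>y. a y \<in> lorentz_space I" "\<And>y. lorentz (a y) (a y) = 0" "\<And>y. fst (a y) > 0"
    "\<And>y. f y = span {a y}"
    "\<And>y. b y \<in> lorentz_space J" "\<And>y. lorentz (b y) (b y) = 0" "\<And>y. fst (b y) > 0"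
    "\<And>y. g y = span {b y}"
    "\<And>y z. lorentz (a y) (a z) = lorentz (b y) (b z)" "\<And>y z. y \<noteq> z \<Longrightarrow> lorentz (a y) (a z) > 0"
proof -
  define \<alpha> where "\<alpha> y = iso_rep (f y)" for y
  define \<beta> where "\<beta> y = iso_rep (g y)" for y
  define A where "A y z = lorentz (\<alpha> y) (\<alpha> z)" for y z
  define B where "B y z = lorentz (\<beta> y) (\<beta> z)" for y z
  have A: "A y z > 0" if "y \<noteq> z" for y z
    unfolding A_def \<alpha>_def by (rule represents_pos[OF R f puw that])
  have B: "B y z > 0" if "y \<noteq> z" for y z
    unfolding B_def \<beta>_def by (rule represents_pos[OF R g puw that])
  have sym: "A y z = A z y" "B y z = B z y" for y z
    by (simp_all add: A_def B_def lorentz_commute)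
  define C where "C y z = (A y z / (A y w * A z w)) / (B y z / (B y w * B z w))" for y z
  have Csym: "C y z = C z y" for y z by (simp add: C_def sym(1)[of y z] sym(2)[of y z] mult.commute)
  \<comment> \<open>The cross-ratio of \<open>(y, z, t, w)\<close> is governed by the quotient of
    the distances of \<open>y\<close> and \<open>t\<close> from \<open>z\<close>, so it shows that
    \<open>C\<close> does not depend on its first argument.\<close>
  have Cstep: "C y z = C t z" if d: "distinct [y, z, t, w]" for y z t
  proof -
    have "A y z * A t w / (A y w * A t z) = B y z * B t w / (B y w * B t z)"
      unfolding A_def B_def \<alpha>_def \<beta>_def by (rule represents_ratio[OF R f g puw d])
    moreover have "A y z > 0" "A t w > 0" "A y w > 0" "A t z > 0" "A z w > 0"
      "B y z > 0" "B t w > 0" "B y w > 0" "B t z > 0" "B z w > 0"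
      using d by (auto intro!: A B)
    ultimately show ?thesis unfolding C_def by (simp add: field_simps)
  qed
  define \<kappa> where "\<kappa> = C u p"
  have up: "u \<noteq> p" "u \<noteq> w" "p \<noteq> w" using puw by auto
  have \<kappa>: "\<kappa> > 0"
    unfolding \<kappa>_def C_def using up by (intro divide_pos_pos mult_pos_pos A B) auto
  have Cp: "C y p = \<kappa>" if "y \<noteq> p" "y \<noteq> w" for y
    using Cstep[of y p u] that up by (cases "y = u") (auto simp: \<kappa>_def)
  have C: "C y z = \<kappa>" if "y \<noteq> z" "y \<noteq> w" "z \<noteq> w" for y z
  proof (cases "z = p")
    case True
    then show ?thesis using Cp that by simp
  next
    case False
    then have "C y z = C p z" using Cstep[of y z p] that up by (cases "y = p") auto
    then show ?thesis using Cp[of z] False that Csym by simp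
  qed
  \<comment> \<open>With \<open>s\<close>, all products with the representative at \<open>w\<close>
    become \<open>1\<close>. The factors \<open>sqrt \<kappa>\<close> and
    \<open>1 / sqrt \<kappa>\<close> in \<open>t\<close> cancel in products with \<open>w\<close>
    and contribute \<open>\<kappa>\<close> to all others.\<close>
  define s where "s y = (if y = w then 1 else 1 / A y w)" for y
  define t where "t y = (if y = w then 1 / sqrt \<kappa> else sqrt \<kappa> / B y w)" for y
  have s: "s y > 0" for y using A by (simp add: s_def)
  have t: "t y > 0" for y using B \<kappa> by (simp add: t_def)
  have eq: "s y * s z * A y z = t y * t z * B y z" for y z
  proof -
    consider "y = z" | "y \<noteq> z" "y = w" | "y \<noteq> z" "z = w" | "y \<noteq> z" "y \<noteq> w" "z \<noteq> w" by blast
    then show ?thesis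
    proof cases
      case 1
      then show ?thesis
        using iso_rep_boundary(3)[OF represents_boundary[OF f, of y]]
          iso_rep_boundary(3)[OF represents_boundary[OF g, of y]]
        by (simp add: A_def B_def \<alpha>_def \<beta>_def)
    next
      case 2
      then have "A z w > 0" "B z w > 0" using A B by auto
      then show ?thesis using 2 \<kappa> by (simp add: s_def t_def sym[of w z])
    next
      case 3
      then have "A y w > 0" "B y w > 0" using A B by auto
      then show ?thesis using 3 \<kappa> by (simp add: s_def t_def)
    next
      case 4
      then have "B y z > 0" "B y w > 0" "B z w > 0" using B by auto
      then have "B y z / (B y w * B z w) \<noteq> 0" by simp
      then have "A y z / (A y w * A z w) = \<kappa> * (B y z / (B y w * B z w))"
        using C[OF 4] unfolding C_def by (rule iffD1[OF nonzero_divide_eq_eq])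
      moreover have "sqrt \<kappa> * sqrt \<kappa> = \<kappa>" using \<kappa> by simp
      ultimately show ?thesis using 4 by (simp add: s_def t_def)
    qed
  qed
  show ?thesis
  proof (rule that[of "\<lambda>y. s y *\<^sub>R \<alpha> y" "\<lambda>y. t y *\<^sub>R \<beta> y"])
    fix y
    note fy = iso_rep_boundary[OF represents_boundary[OF f, of y], folded \<alpha>_def]
    note gy = iso_rep_boundary[OF represents_boundary[OF g, of y], folded \<beta>_def]
    show "s y *\<^sub>R \<alpha> y \<in> lorentz_space I" "t y *\<^sub>R \<beta> y \<in> lorentz_space J"
      using fy gy by (simp_all add: subspace_mul[OF subspace_lorentz_space])
    show "lorentz (s y *\<^sub>R \<alpha> y) (s y *\<^sub>R \<alpha> y) = 0" "lorentz (t y *\<^sub>R \<beta> y) (t y *\<^sub>R \<beta> y) = 0"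
      using fy gy by (simp_all add: lorentz_simps)
    show "fst (s y *\<^sub>R \<alpha> y) > 0" "fst (t y *\<^sub>R \<beta> y) > 0" using fy gy s t by simp_all
    show "f y = span {s y *\<^sub>R \<alpha> y}" "g y = span {t y *\<^sub>R \<beta> y}"
      using fy gy s[of y] t[of y] by (simp_all add: span_scaleR)
  next
    fix y z
    show "lorentz (s y *\<^sub>R \<alpha> y) (s z *\<^sub>R \<alpha> z) = lorentz (t y *\<^sub>R \<beta> y) (t z *\<^sub>R \<beta> z)"
      using eq[of y z] by (simp add: lorentz_scaleR A_def B_def)
    assume "y \<noteq> z"
    then show "lorentz (s y *\<^sub>R \<alpha> y) (s z *\<^sub>R \<alpha> z) > 0"
      using A[of y z] s by (simp add: lorentz_scaleR A_def)
  qed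
qed

lemma represents_unique:
  fixes f :: "'y::topological_space \<Rightarrow> (real \<times> 'i ell2) set" and g :: "'y \<Rightarrow> (real \<times> 'j ell2) set"
  assumes R: "abstract_cross_ratio R" and f: "represents R I f" and g: "represents R J g"
    and puw: "distinct [p, u, w :: 'y]"
  shows "\<exists>!\<phi>. \<phi> \<in> hyp_isometries I J \<and> (\<forall>y. g y = boundary_ext I J \<phi> (f y))"
proof -
  obtain a :: "'y \<Rightarrow> real \<times> 'i ell2" and b :: "'y \<Rightarrow> real \<times> 'j ell2" where
    a: "\<And>y. a y \<in> lorentz_space I" "\<And>y. lorentz (a y) (a y) = 0" "\<And>y. fst (a y) > 0"
    "\<And>y. f y = span {a y}"
    and b: "\<And>y. b y \<in> lorentz_space J" "\<And>y. lorentz (b y) (b y) = 0" "\<And>y. fst (b y) > 0"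
    "\<And>y. g y = span {b y}"
    and ab: "\<And>y z. lorentz (a y) (a z) = lorentz (b y) (b z)"
    and pos: "\<And>y z. y \<noteq> z \<Longrightarrow> lorentz (a y) (a z) > 0"
    using normalised_representatives[OF R f g puw] by blast
  have three: "\<exists>z t. z \<noteq> y \<and> t \<noteq> y \<and> z \<noteq> t" for y :: 'y by (rule three_points[OF puw])
  have ex: "\<exists>z. lorentz (a y) (a z) > 0" for y using three[of y] pos by metis
  have ex': "\<exists>z. lorentz (b y) (b z) > 0" for y using ex[of y] ab by simp
  have "total I (range (\<lambda>y. span {a y}))" "total J (range (\<lambda>y. span {b y}))"
    using f g unfolding represents_def a(4)[abs_def] b(4)[abs_def] by blast+
  then have dense: "closure (span (range a)) = lorentz_space I"
      "closure (span (range b)) = lorentz_space J"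
    using total_imp_dense[OF a(1-3) ex] total_imp_dense[OF b(1-3) ex'] by blast+
  have pw: "lorentz (a p) (a w) > 0" using pos puw by auto
  obtain \<phi> where \<phi>: "\<phi> \<in> hyp_isometries I J" "\<And>y. boundary_ext I J \<phi> (span {a y}) = span {b y}"
    using isometry_exists[OF a(2,3) b(3) ab pw dense] by blast
  show ?thesis
  proof (rule ex1I)
    show "\<phi> \<in> hyp_isometries I J \<and> (\<forall>y. g y = boundary_ext I J \<phi> (f y))"
      using \<phi> a(4) b(4) by simp
    fix \<psi> assume \<psi>: "\<psi> \<in> hyp_isometries I J \<and> (\<forall>y. g y = boundary_ext I J \<psi> (f y))"
    show "\<psi> = \<phi>"
    proof (rule isometry_unique[OF a(2,3) pos three dense(1)])
      show "boundary_ext I J \<psi> (span {a y}) = boundary_ext I J \<phi> (span {a y})" for y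
        using \<psi> \<phi>(2)[of y] a(4)[of y] b(4)[of y] by metis
    qed (use \<psi> \<phi> in simp_all)
  qed
qed

lemma represents_equivariant:
  fixes f :: "'y::topological_space \<Rightarrow> (real \<times> 'i ell2) set"
  assumes R: "abstract_cross_ratio R" and f: "represents R I f" and puw: "distinct [p, u, w :: 'y]"
    and act: "group_action \<Gamma> UNIV act"
    and inv: "\<And>g a a' b b'. g \<in> carrier \<Gamma> \<Longrightarrow> (a, a', b, b') \<in> quads \<Longrightarrow>
        R (act g a, act g a', act g b, act g b') = R (a, a', b, b')"
  shows "\<exists>\<rho>\<in>hom \<Gamma> (Isom I). \<forall>g\<in>carrier \<Gamma>. \<forall>y. f (act g y) = boundary_ext I I (\<rho> g) (f y)"
proof -
  interpret A: group_action \<Gamma> UNIV act by (rule act)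
  have bij: "bij (act g)" if "g \<in> carrier \<Gamma>" for g using A.bij_prop0[OF that] by (simp add: Bij_def)
  have fg: "represents R I (\<lambda>y. f (act g y))" if g: "g \<in> carrier \<Gamma>" for g
    unfolding represents_def
  proof (intro conjI allI impI)
    \<comment> \<open>\<open>act g\<close> is a bijection, so the image and hence totality are
      unchanged.\<close>
    have "range (\<lambda>y. f (act g y)) = range f"
      using bij[OF g] by (metis bij_is_surj image_image)
    then show "total I (range (\<lambda>y. f (act g y)))" using f by (simp add: represents_def)
    fix a a' b b' :: 'y assume q: "(a, a', b, b') \<in> quads"
    have "card (act g ` {a, a', b, b'}) = card {a, a', b, b'}"
      by (rule card_image) (rule inj_on_subset[OF bij_is_inj[OF bij[OF g]] subset_UNIV])
    then have "(act g a, act g a', act g b, act g b') \<in> quads"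
      using q by (simp add: quads_def)
    then show "cross_ratio (f (act g a)) (f (act g a')) (f (act g b)) (f (act g b')) =
        R (a, a', b, b')"
      using f inv[OF g q] by (simp add: represents_def)
  qed
  define P where "P g \<phi> \<longleftrightarrow> \<phi> \<in> hyp_isometries I I \<and>
      (\<forall>y. f (act g y) = boundary_ext I I \<phi> (f y))" for g \<phi>
  have ex1: "\<exists>!\<phi>. P g \<phi>" if "g \<in> carrier \<Gamma>" for g
    unfolding P_def by (rule represents_unique[OF R f fg[OF that] puw])
  define \<rho> where "\<rho> g = (THE \<phi>. P g \<phi>)" for g
  have \<rho>: "P g (\<rho> g)" if "g \<in> carrier \<Gamma>" for g
    unfolding \<rho>_def by (rule theI'[OF ex1[OF that]])
  have Bij: "\<phi> \<in> Bij (hyp I)" if "\<phi> \<in> hyp_isometries I I" for \<phi>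
    using that by (simp add: hyp_isometries_def Bij_def)
  have "\<rho> \<in> hom \<Gamma> (Isom I)"
  proof (rule homI)
    fix g assume "g \<in> carrier \<Gamma>"
    then show "\<rho> g \<in> carrier (Isom I)" using \<rho> by (simp add: Isom_def P_def)
  next
    fix g h assume gh: "g \<in> carrier \<Gamma>" "h \<in> carrier \<Gamma>"
    then have gG: "g \<otimes>\<^bsub>\<Gamma>\<^esub> h \<in> carrier \<Gamma>"
      using A.group_hom group.is_monoid monoid.m_closed by (metis group_hom.axioms(1))
    have iso: "\<rho> g \<in> hyp_isometries I I" "\<rho> h \<in> hyp_isometries I I"
      using \<rho> gh by (auto simp: P_def)
    note c = hyp_isometry_compose[OF iso(2,1)]
    \<comment> \<open>The composite of the two isometries realises the action of the product, so
      uniqueness identifies it with the value of \<open>\<rho>\<close> there.\<close>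
    have "P (g \<otimes>\<^bsub>\<Gamma>\<^esub> h) (compose (hyp I) (\<rho> g) (\<rho> h))"
      unfolding P_def
    proof (intro conjI allI)
      show "compose (hyp I) (\<rho> g) (\<rho> h) \<in> hyp_isometries I I" by (rule c(1))
      fix y
      have "f (act (g \<otimes>\<^bsub>\<Gamma>\<^esub> h) y) = f (act g (act h y))"
        using A.composition_rule[of y g h] gh by simp
      also have "\<dots> = boundary_ext I I (\<rho> g) (boundary_ext I I (\<rho> h) (f y))"
        using \<rho>[OF gh(1)] \<rho>[OF gh(2)] by (simp add: P_def)
      also have "\<dots> = boundary_ext I I (compose (hyp I) (\<rho> g) (\<rho> h)) (f y)"
        by (rule c(2)[OF represents_boundary[OF f], symmetric])
      finally show "f (act (g \<otimes>\<^bsub>\<Gamma>\<^esub> h) y) = boundary_ext I I (compose (hyp I) (\<rho> g) (\<rho> h)) (f y)" .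
    qed
    then have "\<rho> (g \<otimes>\<^bsub>\<Gamma>\<^esub> h) = compose (hyp I) (\<rho> g) (\<rho> h)"
      using ex1[OF gG] \<rho>[OF gG] by blast
    then show "\<rho> (g \<otimes>\<^bsub>\<Gamma>\<^esub> h) = \<rho> g \<otimes>\<^bsub>Isom I\<^esub> \<rho> h"
      using Bij iso by (simp add: Isom_def BijGroup_def)
  qed
  then show ?thesis using \<rho> by (auto simp: P_def)
qed

section \<open>Existence\<close>

lemma cond_neg_kernel_finite:
  assumes K: "cond_neg_kernel Z K" and A: "finite A" "A \<subseteq> Z" and l: "(\<Sum>x\<in>A. l x) = 0"
  shows "(\<Sum>x\<in>A. \<Sum>y\<in>A. l x * l y * K x y) \<le> 0"
proof -
  obtain h where h: "bij_betw h {..<card A} A"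
    using ex_bij_betw_nat_finite[OF A(1)] by (auto simp: atLeast0LessThan)
  have re: "(\<Sum>x\<in>A. g x) = (\<Sum>i<card A. g (h i))" for g :: "_ \<Rightarrow> real"
    using sum.reindex_bij_betw[OF h, of g] by simp
  have "h i \<in> Z" if "i < card A" for i using bij_betwE[OF h] A(2) that by auto
  moreover have "(\<Sum>i<card A. l (h i)) = 0" using l re by simp
  ultimately have "(\<Sum>i<card A. \<Sum>j<card A. l (h i) * l (h j) * K (h i) (h j)) \<le> 0"
    using K unfolding cond_neg_kernel_def by blast
  then show ?thesis by (simp add: re)
qed

text \<open>Schoenberg's correspondence: negativity for weights of total zero becomes positivity
  with base point \<open>p\<close> when \<open>p\<close> receives the compensating weight, minus the
  sum of the others. The shifted kernel vanishes whenever one argument is \<open>p\<close>, so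
  changing the weight of \<open>p\<close> does not affect its quadratic form.\<close>

lemma cond_neg_kernel_psd:
  assumes K: "cond_neg_kernel Z K" and p: "p \<in> Z" and F: "finite F" "F \<subseteq> Z"
  shows "0 \<le> (\<Sum>x\<in>F. \<Sum>y\<in>F. l x * l y * (K x p + K y p - K x y))"
proof -
  have sym: "K x y = K y x" if "x \<in> Z" "y \<in> Z" for x y using K that by (simp add: cond_neg_kernel_def)
  have diag: "K x x = 0" if "x \<in> Z" for x using K that by (simp add: cond_neg_kernel_def)
  define k where "k x y = K x p + K y p - K x y" for x y
  have kp: "k x y = 0" if "x = p \<or> y = p" "x \<in> F" "y \<in> F" for x y
  proof -
    have "x \<in> Z" "y \<in> Z" using that F by auto
    then show ?thesis using that(1) diag sym by (auto simp: k_def)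
  qed
  define E where "E = F - {p}"
  have E: "finite E" "E \<subseteq> Z" "p \<notin> E" using F by (auto simp: E_def)
  have "(\<Sum>x\<in>F. \<Sum>y\<in>F. l x * l y * k x y) = (\<Sum>x\<in>F. \<Sum>y\<in>E. l x * l y * k x y)"
    by (intro sum.cong refl sum.mono_neutral_right) (use F kp in \<open>auto simp: E_def\<close>)
  also have "\<dots> = (\<Sum>x\<in>E. \<Sum>y\<in>E. l x * l y * k x y)"
    by (intro sum.mono_neutral_right) (use F kp in \<open>auto simp: E_def intro!: sum.neutral\<close>)
  also have "\<dots> = 2 * ((\<Sum>x\<in>E. l x * K x p) * (\<Sum>y\<in>E. l y)) - (\<Sum>x\<in>E. \<Sum>y\<in>E. l x * l y * K x y)"
  proof -
    have "(\<Sum>x\<in>E. \<Sum>y\<in>E. l x * l y * k x y) = (\<Sum>x\<in>E. \<Sum>y\<in>E. (l x * K x p) * l y) +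
        (\<Sum>x\<in>E. \<Sum>y\<in>E. l x * (l y * K y p)) - (\<Sum>x\<in>E. \<Sum>y\<in>E. l x * l y * K x y)"
      unfolding sum.distrib[symmetric] sum_subtractf[symmetric]
      by (intro sum.cong refl) (simp add: k_def algebra_simps)
    also have "(\<Sum>x\<in>E. \<Sum>y\<in>E. (l x * K x p) * l y) = (\<Sum>x\<in>E. l x * K x p) * (\<Sum>y\<in>E. l y)"
      by (rule sum_product[symmetric])
    also have "(\<Sum>x\<in>E. \<Sum>y\<in>E. l x * (l y * K y p)) = (\<Sum>y\<in>E. l y) * (\<Sum>x\<in>E. l x * K x p)"
      by (rule sum_product[symmetric])
    finally show ?thesis by simp
  qed
  finally have eq: "(\<Sum>x\<in>F. \<Sum>y\<in>F. l x * l y * k x y) =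
      2 * ((\<Sum>x\<in>E. l x * K x p) * (\<Sum>y\<in>E. l y)) - (\<Sum>x\<in>E. \<Sum>y\<in>E. l x * l y * K x y)" .
  define m where "m = l(p := - (\<Sum>x\<in>E. l x))"
  have m: "m x = l x" if "x \<in> E" for x using that E(3) by (auto simp: m_def)
  have mp: "m p = - (\<Sum>x\<in>E. l x)" by (simp add: m_def)
  have sE: "(\<Sum>x\<in>E. m x) = (\<Sum>x\<in>E. l x)" by (intro sum.cong refl m)
  have "(\<Sum>x\<in>insert p E. \<Sum>y\<in>insert p E. m x * m y * K x y) \<le> 0"
  proof (rule cond_neg_kernel_finite[OF K])
    show "(\<Sum>x\<in>insert p E. m x) = 0" using E by (simp add: sE mp)
  qed (use E p in auto)
  also have "(\<Sum>x\<in>insert p E. \<Sum>y\<in>insert p E. m x * m y * K x y) =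
      m p * m p * K p p + (\<Sum>y\<in>E. m p * m y * K p y) +
      ((\<Sum>x\<in>E. m x * m p * K x p) + (\<Sum>x\<in>E. \<Sum>y\<in>E. m x * m y * K x y))"
    using E by (simp only: sum.insert sum.distrib if_False simp_thms)
  also have "(\<Sum>y\<in>E. m p * m y * K p y) = m p * (\<Sum>x\<in>E. l x * K x p)"
    unfolding sum_distrib_left
  proof (intro sum.cong refl)
    fix x assume x: "x \<in> E"
    then have "K p x = K x p" using E p by (intro sym) auto
    then show "m p * m x * K p x = m p * (l x * K x p)" using m[OF x] by simp
  qed
  also have "(\<Sum>x\<in>E. m x * m p * K x p) = m p * (\<Sum>x\<in>E. l x * K x p)"
    unfolding sum_distrib_left by (intro sum.cong refl) (simp add: m)
  also have "(\<Sum>x\<in>E. \<Sum>y\<in>E. m x * m y * K x y) = (\<Sum>x\<in>E. \<Sum>y\<in>E. l x * l y * K x y)"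
    by (intro sum.cong refl) (simp add: m)
  finally have "2 * (m p * (\<Sum>x\<in>E. l x * K x p)) + (\<Sum>x\<in>E. \<Sum>y\<in>E. l x * l y * K x y) \<le> 0"
    using diag[OF p] by simp
  then show ?thesis using eq by (simp add: k_def mp mult.commute)
qed

lemma continuous_map_lines:
  assumes F: "continuous_on UNIV F" and F0: "\<And>y. F y \<noteq> 0" and Fb: "\<And>y. span {F y} \<in> boundary I"
  shows "continuous_map euclidean (boundary_topology I) (\<lambda>y. span {F y})"
  unfolding boundary_topology_def continuous_map_in_subtopology
proof
  show "continuous_map euclidean proj_topology (\<lambda>y. span {F y})"
    unfolding continuous_map_def
  proof (intro conjI allI impI)
    show "(\<lambda>y. span {F y}) \<in> topspace euclidean \<rightarrow> topspace proj_topology"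
      unfolding topspace_proj_topology using F0 by blast
    fix U :: "(real \<times> 'b ell2) set set" assume "openin proj_topology U"
    then have "open {v. v \<noteq> 0 \<and> span {v} \<in> U}" by (simp add: openin_proj_topology)
    then have "open (F -` {v. v \<noteq> 0 \<and> span {v} \<in> U})" using F by (rule open_vimage)
    also have "F -` {v. v \<noteq> 0 \<and> span {v} \<in> U} = {y. span {F y} \<in> U}"
      using F0 by (simp add: vimage_def)
    finally show "openin euclidean {y \<in> topspace euclidean. span {F y} \<in> U}" by simp
  qed
  show "(\<lambda>y. span {F y}) \<in> topspace euclidean \<rightarrow> boundary I" using Fb by auto
qed

text \<open>The kernel values are the squared distances in the Euclidean picture in which \<open>w\<close> is the
  point at infinity; the cocycle relation turns their quotients into cross-ratios.\<close>

lemma cr_kernel_ratio: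
  assumes R: "abstract_cross_ratio R" and puw: "distinct [p, u, w]" and d: "distinct [x, y, z, w]"
  shows "cr_kernel R p u w x y = (enn2real (R (x, y, z, w)))\<^sup>2 * cr_kernel R p u w z y"
proof -
  have co: "R (x, y, q, w) = R (x, y, z, w) * R (z, y, q, w)" if q: "q \<noteq> w" "q \<noteq> y" for q
  proof -
    have Q: "(x, y, q, w) \<in> quads" "(x, y, z, w) \<in> quads" "(z, y, q, w) \<in> quads"
      using d q by (intro quadsI[of x y w] quadsI[of z y w]; auto)+
    have "R (x, y, z, w) \<noteq> 0" "R (x, y, z, w) \<noteq> \<infinity>"
      using abstract_cross_ratioD(5,6)[OF R Q(2)] d by auto
    then show ?thesis using R Q unfolding abstract_cross_ratio_def by blast
  qed
  show ?thesis
  proof (cases "y = p")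
    case True
    then have "x \<noteq> p" "z \<noteq> p" "u \<noteq> w" "u \<noteq> y" using d puw by auto
    then show ?thesis using True co[of u]
      by (simp add: cr_kernel_def enn2real_mult power_mult_distrib)
  next
    case False
    moreover have "x \<noteq> y" "z \<noteq> y" "p \<noteq> w" using d puw by auto
    ultimately show ?thesis using co[of p]
      by (simp add: cr_kernel_def enn2real_mult power_mult_distrib mult.assoc)
  qed
qed

lemma cr_kernel_pos:
  assumes R: "abstract_cross_ratio R" and puw: "distinct [p, u, w]" and d: "distinct [x, y, w]"
  shows "cr_kernel R p u w x y > 0"
proof -
  have pos: "enn2real (R (a, b, c, e)) > 0"
    if q: "(a, b, c, e) \<in> quads" and "a \<noteq> b" "c \<noteq> e" "a \<noteq> e" "c \<noteq> b" for a b c e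
    using abstract_cross_ratioD(5,6)[OF R q] that
    by (simp add: enn2real_positive_iff less_top pos2 zero_less_iff_neq_zero)
  show ?thesis
  proof (cases "y = p")
    case True
    then have "enn2real (R (x, p, u, w)) > 0"
      using d puw by (intro pos quadsI[of p u w]) auto
    then show ?thesis using True d by (simp add: cr_kernel_def)
  next
    case False
    have "enn2real (R (x, y, p, w)) > 0"
      using d puw False by (intro pos quadsI[of x y w]) auto
    moreover have "enn2real (R (y, p, u, w)) > 0"
      using d puw False by (intro pos quadsI[of p u w]) auto
    ultimately show ?thesis using False d by (simp add: cr_kernel_def enn2real_mult)
  qed
qed

text \<open>Exchanging the two equal entries leaves the quadruple unchanged but inverts the value,
  and a positive finite number equal to its inverse is \<open>1\<close>.\<close>

lemma abstract_cross_ratio_eq_1: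
  assumes R: "abstract_cross_ratio R" and q: "(a, a', b, b') \<in> quads"
    and eq: "a = b \<or> a' = b'" and ne: "a \<noteq> a'" "b \<noteq> b'" "a \<noteq> b'" "b \<noteq> a'"
  shows "R (a, a', b, b') = 1"
proof -
  define r where "r = R (a, a', b, b')"
  have "r = inverse r"
    using eq abstract_cross_ratioD(3,4)[OF R q] by (auto simp: r_def)
  moreover have "r \<noteq> 0" "r \<noteq> \<infinity>"
    using abstract_cross_ratioD(5,6)[OF R q] ne by (auto simp: r_def)
  ultimately obtain t where t: "r = ennreal t" "t > 0"
    by (cases r) (auto simp: ennreal_eq_0_iff not_le less_le)
  then have "ennreal t = ennreal (inverse t)" using \<open>r = inverse r\<close> by (simp add: inverse_ennreal)
  then have "t = inverse t" using t(2) by simp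
  then have "t * t = 1" using t(2) by (simp add: field_simps)
  then have "t = 1" using t(2) by (simp add: square_eq_1_iff)
  then show ?thesis using t by (simp add: r_def)
qed

text \<open>If \<open>w\<close> is among the four points, symmetries of \<open>R\<close> move it to
  the last place, where \<open>cr_kernel_ratio\<close> applies and products with \<open>w\<close>
  are \<open>1\<close>. Otherwise the cocycle relation inserts \<open>w\<close> and expresses
  \<open>R\<close> through two such quadruples.\<close>

lemma cross_ratio_of_products:
  fixes D :: "'y::topological_space \<Rightarrow> 'y \<Rightarrow> real"
  assumes R: "abstract_cross_ratio R" and puw: "distinct [p, u, w]"
    and Dw: "\<And>y. y \<noteq> w \<Longrightarrow> D y w = 1" "\<And>y. y \<noteq> w \<Longrightarrow> D w y = 1"
    and DK: "\<And>x y. x \<noteq> w \<Longrightarrow> y \<noteq> w \<Longrightarrow> D x y = cr_kernel R p u w x y / 2"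
    and Dsym: "\<And>x y. D x y = D y x"
    and d: "distinct [a, a', b, b']"
  shows "(enn2real (R (a, a', b, b')))\<^sup>2 * (D a b' * D b a') = D a a' * D b b'"
proof -
  have ratio: "D x y = (enn2real (R (x, y, z, w)))\<^sup>2 * D z y" if "distinct [x, y, z, w]" for x y z
    using cr_kernel_ratio[OF R puw that] that by (simp add: DK)
  have sw: "R (x, x', y, y') = R (y, y', x, x')" "R (x, x', y, y') = R (x', x, y', y)"
    if "distinct [x, x', y, y']" for x x' y y'
    by (rule abstract_cross_ratioD[OF R quadsI[of x x' y]]; use that in auto)+
  consider "w \<notin> {a, a', b, b'}" | "b' = w" | "a' = w" | "a = w" | "b = w" by auto
  then show ?thesis
  proof cases
    case 1
    have q: "(a', a, b', b) \<in> quads" "(a', a, w, b) \<in> quads" "(w, a, b', b) \<in> quads"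
      using d 1 by (auto intro: quadsI[of a a' b] quadsI[of a b b'])
    have "R (a', a, w, b) \<noteq> 0" "R (a', a, w, b) \<noteq> \<infinity>"
      using abstract_cross_ratioD(5,6)[OF R q(2)] d 1 by auto
    then have "R (a', a, b', b) = R (a', a, w, b) * R (w, a, b', b)"
      using R q unfolding abstract_cross_ratio_def by blast
    moreover have "R (a, a', b, b') = R (a', a, b', b)" "R (a', a, w, b) = R (a, a', b, w)"
      "R (w, a, b', b) = R (b, b', a, w)"
      using sw(2)[of a a' b b'] sw(2)[of a' a w b] sw(1)[of w a b' b] sw(2)[of b' b w a] d 1
      by auto
    ultimately have "enn2real (R (a, a', b, b')) = enn2real (R (a, a', b, w)) * enn2real (R (b, b', a, w))"
      by (simp add: enn2real_mult)
    moreover have "D a a' = (enn2real (R (a, a', b, w)))\<^sup>2 * D b a'"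
      "D b b' = (enn2real (R (b, b', a, w)))\<^sup>2 * D a b'"
      using d 1 by (auto intro!: ratio)
    ultimately show ?thesis by (simp add: power_mult_distrib)
  next
    case 2
    then have "D a a' = (enn2real (R (a, a', b, w)))\<^sup>2 * D b a'" using d by (intro ratio) auto
    then show ?thesis using 2 d by (auto simp: Dw)
  next
    case 3
    have "R (a, a', b, b') = R (b, b', a, w)" using sw(1)[of a a' b b'] d 3 by auto
    moreover have "D b b' = (enn2real (R (b, b', a, w)))\<^sup>2 * D a b'" using d 3 by (intro ratio) auto
    ultimately show ?thesis using 3 d by (auto simp: Dw)
  next
    case 4
    have "R (a, a', b, b') = R (b', b, a', w)"
      using sw(2)[of a a' b b'] sw(1)[of a' a b' b] d 4 by auto
    moreover have "D b' b = (enn2real (R (b', b, a', w)))\<^sup>2 * D a' b" using d 4 by (intro ratio) auto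
    ultimately show ?thesis using 4 d by (auto simp: Dw Dsym[of b])
  next
    case 5
    have "R (a, a', b, b') = R (a', a, b', w)" using sw(2)[of a a' b b'] d 5 by auto
    moreover have "D a' a = (enn2real (R (a', a, b', w)))\<^sup>2 * D b' a" using d 5 by (intro ratio) auto
    ultimately show ?thesis using 5 d by (auto simp: Dw Dsym[of a])
  qed
qed

text \<open>Four distinct points are covered by \<open>cross_ratio_of_products\<close>; on
  degenerate quadruples the axioms already determine \<open>R\<close> as infinity, \<open>0\<close>
  or \<open>1\<close>.\<close>

lemma cross_ratio_realized:
  fixes v :: "'y::topological_space \<Rightarrow> real \<times> 'i ell2"
  assumes R: "abstract_cross_ratio R" and puw: "distinct [p, u, w]"
    and v: "\<And>y. v y \<noteq> 0" "\<And>y. lorentz (v y) (v y) = 0"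
    and vw: "\<And>y. y \<noteq> w \<Longrightarrow> lorentz (v y) (v w) = 1"
    and vK: "\<And>x y. x \<noteq> w \<Longrightarrow> y \<noteq> w \<Longrightarrow> lorentz (v x) (v y) = cr_kernel R p u w x y / 2"
    and q: "(a, a', b, b') \<in> quads"
  shows "cross_ratio (span {v a}) (span {v a'}) (span {v b}) (span {v b'}) = R (a, a', b, b')"
proof -
  define D where "D x y = lorentz (v x) (v y)" for x y
  have Dsym: "D x y = D y x" for x y by (simp add: D_def lorentz_commute)
  have Dpos: "D x y > 0" if "x \<noteq> y" for x y
  proof -
    consider "x = w" | "y = w" | "x \<noteq> w" "y \<noteq> w" by blast
    then show ?thesis
    proof cases
      case 3
      then have "cr_kernel R p u w x y > 0" using that by (intro cr_kernel_pos[OF R puw]) auto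
      then show ?thesis using vK[OF 3] by (simp add: D_def)
    qed (use that vw Dsym[of x y] in \<open>auto simp: D_def\<close>)
  qed
  have D0: "D x x = 0" for x by (simp add: D_def v)
  have "cross_ratio (span {v a}) (span {v a'}) (span {v b}) (span {v b'}) =
      (if D a b' * D b a' = 0 then \<infinity> else ennreal (sqrt (D a a' * D b b' / (D a b' * D b a'))))"
    unfolding D_def by (rule cross_ratio_span) (simp_all add: v)
  also have "\<dots> = R (a, a', b, b')"
  proof -
    consider "a = b' \<or> b = a'" | "a = a' \<or> b = b'" "a \<noteq> b'" "b \<noteq> a'"
      | "a = b \<or> a' = b'" "a \<noteq> a'" "b \<noteq> b'" "a \<noteq> b'" "b \<noteq> a'" | "distinct [a, a', b, b']" by auto
    then show ?thesis
    proof cases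
      case 1
      then have "R (a, a', b, b') = \<infinity>" using abstract_cross_ratioD(6)[OF R q] by blast
      then show ?thesis using 1 D0 by auto
    next
      case 2
      then have "R (a, a', b, b') = 0" using abstract_cross_ratioD(5)[OF R q] by blast
      then show ?thesis using 2 D0 Dpos[of a b'] Dpos[of b a'] by auto
    next
      case 3
      then have "R (a, a', b, b') = 1" by (rule abstract_cross_ratio_eq_1[OF R q])
      moreover have "D a a' * D b b' = D a b' * D b a'" using 3(1) Dsym by auto
      ultimately show ?thesis using 3 Dpos[of a b'] Dpos[of b a'] by auto
    next
      case 4
      define r where "r = enn2real (R (a, a', b, b'))"
      have "R (a, a', b, b') \<noteq> \<infinity>" using abstract_cross_ratioD(6)[OF R q] 4 by auto
      then have r: "R (a, a', b, b') = ennreal r" "r \<ge> 0" by (simp_all add: r_def less_top)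
      have "r\<^sup>2 * (D a b' * D b a') = D a a' * D b b'"
        unfolding r_def
        by (rule cross_ratio_of_products[OF R puw _ _ _ Dsym 4])
          (use vw vK in \<open>simp_all add: D_def lorentz_commute[of "v w"]\<close>)
      moreover have "D a b' * D b a' \<noteq> 0" using Dpos[of a b'] Dpos[of b a'] 4 by auto
      ultimately have "D a a' * D b b' / (D a b' * D b a') = r\<^sup>2" by (simp add: divide_eq_eq)
      then show ?thesis using r \<open>D a b' * D b a' \<noteq> 0\<close> by simp
    qed
  qed
  finally show ?thesis .
qed

text \<open>The index type consists of functions on \<open>Y\<close> so that it contains both a copy
  of \<open>Y\<close> for the basis and one more index, \<open>i0\<close>, for the extra dimension
  of the horospherical coordinates.\<close>

lemma realization_exists:
  fixes R :: "'y::topological_space \<times> 'y \<times> 'y \<times> 'y \<Rightarrow> ennreal"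
  assumes alg: "algebraic_cross_ratio R" and puw: "distinct [p, u, w :: 'y]"
  obtains I :: "('y \<Rightarrow> real) set" and f where "realizes R I f"
proof -
  define K where "K = cr_kernel R p u w"
  have R: "abstract_cross_ratio R" and CK: "cond_neg_kernel (UNIV - {w}) K"
    using alg puw by (auto simp: algebraic_cross_ratio_def K_def)
  have Kdiag: "K x x = 0" for x by (simp add: K_def cr_kernel_def)
  have Ksym: "K x y = K y x" if "x \<noteq> w" "y \<noteq> w" for x y
    using CK that by (simp add: cond_neg_kernel_def)
  have pw: "p \<noteq> w" "u \<noteq> w" "p \<noteq> u" using puw by auto
  \<comment> \<open>Gram kernel of the embedding with origin at \<open>p\<close>. The value
    \<open>0\<close> at \<open>w\<close>, which has no position in the Hilbert space, is a default
    that makes \<open>k\<close> total.\<close>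
  define k where "k x y = (if x = w \<or> y = w then 0 else (K x p + K y p - K x y) / 2)" for x y
  have psd: "0 \<le> (\<Sum>x\<in>F. \<Sum>y\<in>F. l x * l y * k x y)" if F: "finite F" for F l
  proof -
    have "(\<Sum>x\<in>F. \<Sum>y\<in>F. l x * l y * k x y) = (\<Sum>x\<in>F. \<Sum>y\<in>F-{w}. l x * l y * k x y)"
      using F by (intro sum.cong refl sum.mono_neutral_right) (auto simp: k_def)
    also have "\<dots> = (\<Sum>x\<in>F-{w}. \<Sum>y\<in>F-{w}. l x * l y * k x y)"
      using F by (intro sum.mono_neutral_right) (auto simp: k_def)
    also have "\<dots> = (\<Sum>x\<in>F-{w}. \<Sum>y\<in>F-{w}. l x * l y * (K x p + K y p - K x y)) / 2"
      unfolding sum_divide_distrib by (intro sum.cong refl) (simp add: k_def)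
    also have "0 \<le> \<dots>"
      using cond_neg_kernel_psd[OF CK, of p "F - {w}" l] F pw by (intro divide_nonneg_pos) auto
    finally show ?thesis .
  qed
  have ksym: "k x y = k y x" for x y using Ksym[of x y] by (auto simp: k_def)
  define \<iota> :: "'y \<Rightarrow> 'y \<Rightarrow> real" where "\<iota> y = (\<lambda>z. if z = y then 1 else 0)" for y
  have "inj \<iota>"
  proof (rule injI)
    fix x y assume "\<iota> x = \<iota> y"
    then have "\<iota> x x = \<iota> y x" by simp
    then show "x = y" by (simp add: \<iota>_def split: if_splits)
  qed
  have "\<exists>(T :: 'y \<Rightarrow> ('y \<Rightarrow> real) ell2) I. I \<subseteq> range \<iota> \<and>
      (\<forall>x y. inner (T x) (T y) = k x y) \<and> closure (span (range T)) = ell2_on I"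
  proof (rule gram_embedding[OF \<open>inj \<iota>\<close> ksym psd])
    fix T :: "'y \<Rightarrow> ('y \<Rightarrow> real) ell2" and I
    assume "I \<subseteq> range \<iota>" "\<And>x y. inner (T x) (T y) = k x y" "closure (span (range T)) = ell2_on I"
    then show ?thesis by (intro exI[of _ T] exI[of _ I] conjI allI)
  qed
  then obtain T :: "'y \<Rightarrow> ('y \<Rightarrow> real) ell2" and I where
    I\<iota>: "I \<subseteq> range \<iota>" and T: "\<And>x y. inner (T x) (T y) = k x y"
    and TI: "closure (span (range T)) = ell2_on I"
    by blast
  \<comment> \<open>The constant \<open>2\<close> differs from every indicator function
    \<open>\<iota> y\<close>, so this index is free.\<close>
  define i0 :: "'y \<Rightarrow> real" where "i0 = (\<lambda>_. 2)"
  have "i0 \<noteq> \<iota> y" for y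
  proof
    assume "i0 = \<iota> y"
    then have "i0 y = \<iota> y y" by simp
    then show False by (simp add: i0_def \<iota>_def)
  qed
  then have i0: "i0 \<notin> I" using I\<iota> by blast
  define e where "e = ell2_unit i0"
  have Tmem: "T y \<in> ell2_on I" for y
    unfolding TI[symmetric] by (rule subsetD[OF closure_subset], rule span_base, rule rangeI)
  have Te: "inner (T y) e = 0" for y
    using Tmem[of y] i0 by (simp add: e_def inner_ell2_unit ell2_on_def)
  then have eT: "inner e (T y) = 0" for y by (simp only: inner_commute[of e])
  have ee: "inner e e = 1" by (simp add: e_def)
  have nT: "inner (T y) (T y) = K y p" if "y \<noteq> w" for y using that by (simp add: T k_def Kdiag)
  have Kp: "K y p \<ge> 0" if "y \<noteq> w" for y using nT[OF that] by (metis inner_ge_zero)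
  have Tw: "T w = 0" using T[of w w] by (simp add: k_def)
  have Tp: "T p = 0" using nT[of p] pw by (simp add: Kdiag)
  \<comment> \<open>Given the component \<open>T y\<close>, the coefficients solve the two
    conditions that \<open>v y\<close> is isotropic and that
    \<open>lorentz (v y) (v w) = 1\<close>.\<close>
  define v where "v y = (if y = w then (1, e)
      else ((K y p + 1) / 2, ((K y p - 1) / 2) *\<^sub>R e + T y))" for y
  have vw: "v w = (1, e)" by (simp add: v_def)
  have vn: "v y = ((K y p + 1) / 2, ((K y p - 1) / 2) *\<^sub>R e + T y)" if "y \<noteq> w" for y
    using that by (simp add: v_def)
  have lww: "lorentz (v w) (v w) = 0" by (simp add: vw lorentz_def ee)
  have lw: "lorentz (v y) (v w) = 1" if "y \<noteq> w" for y
    by (simp add: vw vn[OF that] lorentz_def inner_add_left eT Te ee field_simps)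
  have lK: "lorentz (v x) (v y) = K x y / 2" if "x \<noteq> w" "y \<noteq> w" for x y
    using that T[of x y]
    by (simp add: vn lorentz_def inner_add_left inner_add_right eT Te ee k_def field_simps)
  have iso: "lorentz (v y) (v y) = 0" for y using lww lK[of y y] by (cases "y = w") (auto simp: Kdiag)
  have fv: "fst (v y) > 0" for y using Kp[of y] by (cases "y = w") (auto simp: vw vn)
  have v0: "v y \<noteq> 0" for y using fv[of y] by auto
  define I' where "I' = insert i0 I"
  have eI': "e \<in> ell2_on I'" by (simp add: e_def ell2_unit_mem I'_def)
  have TI': "T y \<in> ell2_on I'" for y using Tmem ell2_on_mono[of I I'] by (auto simp: I'_def)
  have vI': "v y \<in> lorentz_space I'" for y
    by (cases "y = w") (simp_all add: vw vn lorentz_space_iff eI' TI' subspace_add subspace_mul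
        subspace_ell2_on)
  define L where "L = closure (span (range v))"
  have L: "subspace L" "closed L" by (simp_all add: L_def subspace_closure)
  have vL: "v y \<in> L" for y
    unfolding L_def by (rule subsetD[OF closure_subset], rule span_base, rule rangeI)
  \<comment> \<open>As \<open>T p = 0\<close>, \<open>v p\<close> is \<open>(1/2, - e/2)\<close>;
    the combination recovers the base point, then \<open>e\<close>, and then every
    \<open>T y\<close>.\<close>
  have "v p + (1 / 2) *\<^sub>R v w \<in> L" by (intro subspace_add[OF L(1)] vL subspace_mul[OF L(1)])
  also have "v p + (1 / 2) *\<^sub>R v w = base_point"
    using pw by (simp add: vw vn Tp Kdiag)
  finally have bL: "base_point \<in> L" .
  have "v w - base_point \<in> L" by (rule subspace_diff[OF L(1) vL bL])
  then have eL: "(0, e) \<in> L" by (simp add: vw)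
  have TL: "(0, T y) \<in> L" for y
  proof (cases "y = w")
    case True
    then show ?thesis using subspace_0[OF L(1)] by (simp add: Tw zero_prod_def)
  next
    case False
    have "v y - ((K y p + 1) / 2) *\<^sub>R base_point - ((K y p - 1) / 2) *\<^sub>R (0, e) \<in> L"
      by (intro subspace_diff[OF L(1)] vL subspace_mul[OF L(1)] bL eL)
    then show ?thesis using False by (simp add: vn)
  qed
  have sub: "ell2_on I \<subseteq> (\<lambda>x. (0, x)) -` L"
  proof -
    have "linear (\<lambda>x :: ('y \<Rightarrow> real) ell2. (0 :: real, x))" by (intro linearI) auto
    then have "subspace ((\<lambda>x. (0, x)) -` L)" using L(1) by (rule linear_subspace_vimage)
    moreover have "closed ((\<lambda>x. (0, x)) -` L)"
      by (rule closed_vimage[OF L(2)]) (intro continuous_intros)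
    ultimately show ?thesis
      unfolding TI[symmetric] using TL by (intro closure_minimal span_minimal) auto
  qed
  have dense: "lorentz_space I' \<subseteq> L"
  proof
    fix x assume x: "x \<in> lorentz_space I'"
    define c where "c = ell2_coord (snd x) i0"
    have "snd x - c *\<^sub>R e \<in> ell2_on I"
      unfolding ell2_on_def
      using x by (auto simp: ell2_coord_simps e_def ell2_coord_unit c_def lorentz_space_def I'_def)
    then have h: "(0, snd x - c *\<^sub>R e) \<in> L" using sub by blast
    have "fst x *\<^sub>R base_point + c *\<^sub>R (0, e) + (0, snd x - c *\<^sub>R e) \<in> L"
      by (intro subspace_add[OF L(1)] subspace_mul[OF L(1)] bL eL h)
    then show "x \<in> L" by simp
  qed
  have total: "total I' (range (\<lambda>y. span {v y}))"
    using dense unfolding L_def by (intro dense_imp_total vI' v0 iso)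
  have contR: "continuous_on UNIV (\<lambda>y. R (g y))"
    if "continuous_on UNIV g" "\<And>y. g y \<in> quads" for g :: "'y \<Rightarrow> _"
    using R that continuous_on_compose2[of quads R UNIV g]
    by (auto simp: abstract_cross_ratio_def)
  \<comment> \<open>The topology on \<open>Y\<close> carries no separation axiom; that
    \<open>{w}\<close> is closed follows from the continuity of \<open>R\<close> and its zero
    set.\<close>
  have "closed {w}"
  proof -
    have q: "(y, w, p, u) \<in> quads" for y using pw by (intro quadsI[of p u w]) auto
    have "closed {y. R (y, w, p, u) = 0}"
      by (intro closed_Collect_eq contR q continuous_on_const continuous_on_Pair continuous_on_id)
    also have "{y. R (y, w, p, u) = 0} = {w}"
      using abstract_cross_ratioD(5)[OF R q] pw by auto
    finally show ?thesis .
  qed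
  then have openZ: "open (UNIV - {w})" by (simp add: Compl_eq_Diff_UNIV[symmetric] open_Compl)
  have near: "\<forall>\<^sub>F y in at x. y \<noteq> w" if "x \<noteq> w" for x
    using eventually_at_in_open'[OF openZ, of x] that by (auto elim: eventually_mono)
  have Klim: "((\<lambda>y. K y q) \<longlongrightarrow> K x q) (at x)" if "x \<noteq> w" "q \<noteq> w" for x q
  proof -
    have "continuous_on (UNIV - {w}) (\<lambda>y. case (y, q) of (x, y) \<Rightarrow> K x y)"
      by (rule continuous_on_compose2[of "(UNIV - {w}) \<times> (UNIV - {w})" _ _ "\<lambda>y. (y, q)"])
        (use CK that in \<open>auto simp: cond_neg_kernel_def intro!: continuous_on_Pair continuous_on_id
          continuous_on_const\<close>)
    then have "((\<lambda>y. K y q) \<longlongrightarrow> K x q) (at x within (UNIV - {w}))"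
      using that by (simp add: continuous_on_def)
    then show ?thesis using at_within_open[OF _ openZ] that by simp
  qed
  have Tlim: "(T \<longlongrightarrow> T x) (at x)" if x: "x \<noteq> w" for x
  proof -
    have "\<forall>\<^sub>F y in at x. K y x = (norm (T y - T x))\<^sup>2"
      using near[OF x]
    proof eventually_elim
      case (elim y)
      then show ?case using x Ksym[of x y] unfolding power2_norm_eq_inner
        by (simp add: inner_diff_left inner_diff_right T k_def Kdiag field_simps)
    qed
    with Klim[OF x x] have "((\<lambda>y. (norm (T y - T x))\<^sup>2) \<longlongrightarrow> K x x) (at x)"
      by (rule Lim_transform_eventually)
    then have "((\<lambda>y. (norm (T y - T x))\<^sup>2) \<longlongrightarrow> 0) (at x)" by (simp only: Kdiag)
    from tendsto_real_sqrt[OF this] have "((\<lambda>y. norm (T y - T x)) \<longlongrightarrow> 0) (at x)"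
      by (simp only: real_sqrt_abs abs_norm_cancel real_sqrt_zero)
    then have "((\<lambda>y. T y - T x) \<longlongrightarrow> 0) (at x)" by (rule tendsto_norm_zero_cancel)
    then show ?thesis by (simp add: LIM_zero_iff)
  qed
  \<comment> \<open>The vectors \<open>v y\<close> diverge as \<open>y\<close> tends to
    \<open>w\<close>, so continuity is proved for the normalised representatives.\<close>
  define F where "F y = v y /\<^sub>R fst (v y)" for y
  have "(F \<longlongrightarrow> F x) (at x)" for x
  proof (cases "x = w")
    case False
    have "((\<lambda>y. ((K y p + 1) / 2, ((K y p - 1) / 2) *\<^sub>R e + T y)) \<longlongrightarrow>
        ((K x p + 1) / 2, ((K x p - 1) / 2) *\<^sub>R e + T x)) (at x)"
      by (intro tendsto_intros Klim Tlim False pw) simp_all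
    then have "(v \<longlongrightarrow> v x) (at x)"
      unfolding vn[OF False, symmetric]
      by (rule Lim_transform_eventually) (use near[OF False] in \<open>auto elim!: eventually_mono simp: vn\<close>)
    then show ?thesis
      unfolding F_def using fv[of x] by (intro tendsto_scaleR tendsto_inverse tendsto_fst) auto
  next
    case True
    \<comment> \<open>At \<open>w\<close> the kernel is undefined. Its growth nearby is read off
      from \<open>R (y, p, u, w)\<close>, which is continuous with value infinity at
      \<open>y = w\<close>, and whose squared real value is \<open>K y p\<close>.\<close>
    define S where "S y = enn2real (R (y, p, u, w))" for y
    have q: "(y, p, u, w) \<in> quads" for y using pw by (intro quadsI[of p u w]) auto
    have KS: "K y p = (S y)\<^sup>2" for y
    proof (cases "y = p")
      case True
      have "R (p, p, u, w) = 0" using abstract_cross_ratioD(5)[OF R q, of p] by simp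
      then show ?thesis using True by (simp add: Kdiag S_def)
    next
      case False
      then show ?thesis by (simp add: K_def cr_kernel_def S_def)
    qed
    have "continuous_on UNIV (\<lambda>y. R (y, p, u, w))"
      by (intro contR q continuous_on_const continuous_on_Pair continuous_on_id)
    then have "((\<lambda>y. R (y, p, u, w)) \<longlongrightarrow> R (w, p, u, w)) (at w)"
      by (simp add: continuous_on_def)
    moreover have "R (w, p, u, w) = \<infinity>" using abstract_cross_ratioD(6)[OF R q] by simp
    ultimately have Rlim: "((\<lambda>y. R (y, p, u, w)) \<longlongrightarrow> \<infinity>) (at w)" by simp
    have "filterlim S at_top (at w)"
      unfolding filterlim_at_top
    proof
      fix Z :: real
      have "\<forall>\<^sub>F y in at w. ennreal Z < R (y, p, u, w)"
        by (rule order_tendstoD(1)[OF Rlim]) simp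
      moreover have "\<forall>\<^sub>F y in at w. y \<noteq> w" by (simp add: eventually_at_filter)
      ultimately show "\<forall>\<^sub>F y in at w. Z \<le> S y"
      proof eventually_elim
        case (elim y)
        have "R (y, p, u, w) \<noteq> \<infinity>" using abstract_cross_ratioD(6)[OF R q] elim(2) pw by auto
        then have "R (y, p, u, w) = ennreal (S y)" by (simp add: S_def less_top)
        with elim(1) have "\<not> ennreal (S y) \<le> ennreal Z" by simp
        then have "\<not> S y \<le> Z" using ennreal_leI by blast
        then show ?case by simp
      qed
    qed
    then have "((\<lambda>y. 2 * inverse (S y)) \<longlongrightarrow> 2 * 0) (at w)"
      by (intro tendsto_mult_left tendsto_inverse_0_at_top)
    then have lim0: "((\<lambda>y. 2 * inverse (S y)) \<longlongrightarrow> 0) (at w)" by simp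
    have "\<forall>\<^sub>F y in at w. S y > 0"
      using \<open>filterlim S at_top (at w)\<close> by (simp add: filterlim_at_top_dense)
    moreover have "\<forall>\<^sub>F y in at w. y \<noteq> w" by (simp add: eventually_at_filter)
    ultimately have "\<forall>\<^sub>F y in at w. norm ((norm (F y - F w))\<^sup>2) \<le> 2 * inverse (S y)"
    proof eventually_elim
      case (elim y)
      have f1: "fst (F z) = 1" "lorentz (F z) (F z) = 0" for z
        using fv[of z] iso[of z] by (simp_all add: F_def lorentz_scaleR)
      have "(norm (F y - F w))\<^sup>2 = 2 * lorentz (F y) (F w)"
        using lorentz_isotropic_norm[OF f1(1) f1(1) f1(2) f1(2)] by simp
      also have "\<dots> = 4 / ((S y)\<^sup>2 + 1)"
        using elim(2) lw[OF elim(2)] unfolding F_def lorentz_scaleR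
        by (simp add: vw vn KS[symmetric] divide_simps)
      also have "\<dots> \<le> 2 * inverse (S y)"
      proof -
        have "0 \<le> (S y - 1)\<^sup>2" by (rule zero_le_power2)
        then have le: "2 * S y \<le> (S y)\<^sup>2 + 1" unfolding power2_diff by simp
        have "4 / ((S y)\<^sup>2 + 1) \<le> 4 / (2 * S y)"
          by (rule frac_le[OF _ order_refl _ le]) (use elim(1) in simp_all)
        also have "4 / (2 * S y) = 2 * inverse (S y)" by (simp add: inverse_eq_divide)
        finally show ?thesis .
      qed
      finally show ?case by simp
    qed
    then have "((\<lambda>y. (norm (F y - F w))\<^sup>2) \<longlongrightarrow> 0) (at w)"
      by (rule Lim_null_comparison[OF _ lim0])
    from tendsto_real_sqrt[OF this] have "((\<lambda>y. norm (F y - F w)) \<longlongrightarrow> 0) (at w)"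
      by (simp only: real_sqrt_abs abs_norm_cancel real_sqrt_zero)
    then have "((\<lambda>y. F y - F w) \<longlongrightarrow> 0) (at w)" by (rule tendsto_norm_zero_cancel)
    then show ?thesis by (simp add: True LIM_zero_iff)
  qed
  then have contF: "continuous_on UNIV F"
    by (simp add: continuous_on_def)
  have spF: "span {F y} = span {v y}" for y
    unfolding F_def using fv[of y] by (intro span_scaleR) simp
  have "realizes R I' (\<lambda>y. span {v y})"
    unfolding realizes_def
  proof (intro conjI allI impI total)
    have "span {F y} \<in> boundary I'" for y
      unfolding spF boundary_def using vI' v0 iso by blast
    moreover have "F y \<noteq> 0" for y using v0[of y] fv[of y] by (simp add: F_def)
    ultimately have "continuous_map euclidean (boundary_topology I') (\<lambda>y. span {F y})"
      using contF by (intro continuous_map_lines)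
    then show "continuous_map euclidean (boundary_topology I') (\<lambda>y. span {v y})"
      by (simp only: spF)
  next
    fix a a' b b' assume "(a, a', b, b') \<in> (quads :: ('y \<times> 'y \<times> 'y \<times> 'y) set)"
    then show "cross_ratio (span {v a}) (span {v a'}) (span {v b}) (span {v b'}) = R (a, a', b, b')"
      by (rule cross_ratio_realized[where v = v, OF R puw v0 iso lw lK[unfolded K_def], rotated -1])
  qed
  then show ?thesis by (rule that)
qed

lemma realizes_represents: "realizes R I f \<Longrightarrow> represents R I f"
  by (simp add: realizes_def represents_def)

text \<open>Cardinals are represented by index sets up to bijection, so equality of dimensions reads
  \<open>I1 \<approx> I2\<close>. The part about groups concerns every realization, not only the
  constructed one.\<close>

theorem theorem10:
  fixes R :: "'y::topological_space \<times> 'y \<times> 'y \<times> 'y \<Rightarrow> ennreal"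
  assumes "\<exists>S :: 'y set. card S = 4"
    and "algebraic_cross_ratio R"
  shows "(\<exists>(I :: ('y \<Rightarrow> real) set) f. realizes R I f) \<and>
    (\<forall>(I1 :: 'i set) (I2 :: 'j set) f1 f2. realizes R I1 f1 \<and> realizes R I2 f2 \<longrightarrow>
      (\<exists>!\<phi>. \<phi> \<in> hyp_isometries I1 I2 \<and> (\<forall>y. f2 y = boundary_ext I1 I2 \<phi> (f1 y))) \<and>
      I1 \<approx> I2) \<and>
    (\<forall>(\<Gamma> :: ('g, 'm) monoid_scheme) act (I :: 'k set) f.
      realizes R I f \<and> group_action \<Gamma> UNIV act \<and>
      (\<forall>g\<in>carrier \<Gamma>. \<forall>a a' b b'. (a, a', b, b') \<in> quads \<longrightarrow>
        R (act g a, act g a', act g b, act g b') = R (a, a', b, b')) \<longrightarrow>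
      (\<exists>\<rho>\<in>hom \<Gamma> (Isom I). \<forall>g\<in>carrier \<Gamma>. \<forall>y. f (act g y) = boundary_ext I I (\<rho> g) (f y)))"
proof -
  obtain S :: "'y set" where "card S = 4" using assms(1) by blast
  then have "3 \<le> card S" by simp
  then obtain P where "P \<subseteq> S" "card P = 3" by (rule obtain_subset_with_card_n)
  then obtain p u w :: 'y where "p \<noteq> u" "u \<noteq> w" "p \<noteq> w" unfolding card_3_iff by blast
  then have puw: "distinct [p, u, w]" by simp
  have R: "abstract_cross_ratio R" using assms(2) by (simp add: algebraic_cross_ratio_def)
  show ?thesis
  proof (intro conjI allI impI)
    show "\<exists>(I :: ('y \<Rightarrow> real) set) f. realizes R I f"
      using realization_exists[OF assms(2) puw] by blast
  next
    fix I1 :: "'i set" and I2 :: "'j set" and f1 f2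
    assume "realizes R I1 f1 \<and> realizes R I2 f2"
    then show ex: "\<exists>!\<phi>. \<phi> \<in> hyp_isometries I1 I2 \<and> (\<forall>y. f2 y = boundary_ext I1 I2 \<phi> (f1 y))"
      by (intro represents_unique[OF R _ _ puw] realizes_represents) auto
    then show "I1 \<approx> I2" using hyp_isometry_eqpoll by blast
  next
    fix \<Gamma> :: "('g, 'm) monoid_scheme" and act and I :: "'k set" and f
    assume A: "realizes R I f \<and> group_action \<Gamma> UNIV act \<and>
      (\<forall>g\<in>carrier \<Gamma>. \<forall>a a' b b'. (a, a', b, b') \<in> quads \<longrightarrow>
        R (act g a, act g a', act g b, act g b') = R (a, a', b, b'))"
    show "\<exists>\<rho>\<in>hom \<Gamma> (Isom I). \<forall>g\<in>carrier \<Gamma>. \<forall>y. f (act g y) = boundary_ext I I (\<rho> g) (f y)"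
    proof (rule represents_equivariant[OF R _ puw])
      show "represents R I f" "group_action \<Gamma> UNIV act" using A realizes_represents by blast+
    qed (use A in blast)
  qed
qed

end
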